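(* Let $\mathcal{A}$, $\mathcal{B}\in \mathrm{Bir}(S/\pi)$ be of order $2$. The elements $\mathcal{A}$ and $\mathcal{B}$ are conjugate in $\mathrm{Bir}(S/\pi)$ if and only if there exists a birational map $\rho\colon \mathrm{Fix}(\mathcal{A})\dashrightarrow\mathrm{Fix}(\mathcal{B})$ defined over $\mathbb{R}$ such that $\pi\circ\rho=\pi$.
   Context: $S\subset\mathbb{P}^3_{\mathbb{R}}$ is the real projective surface $w^2=x^2+y^2+z^2$, and $\pi\colon S\dashrightarrow\mathbb{P}^1$ is $(w:x:y:z)\mapsto(w:z)$. $\mathrm{Bir}(S/\pi)$ is the group of birational maps $g\colon S\dashrightarrow S$ defined over $\mathbb{R}$ with $\pi g=\pi$. For $\mathcal{A}\in\mathrm{Bir}(S/\pi)$ of order $2$ and general $z_0$, $\mathcal{A}$ restricts to an automorphism of the conic $\Gamma_{z_0}=\pi^{-1}(z_0)$ with exactly two fixed points (for $z_0$ real: two real points or two conjugate imaginary points). The closure of the set of these fixed points, as $z_0$ varies in $\mathbb{P}^1$, is the curve of fixed points $\mathrm{Fix}(\mathcal{A})$, which is a double covering of $\mathbb{P}^1$ via (the restriction of) $\pi$. Isolated fixed points are not included. If the fixed points on the fibres are the base-points $(0:\pm\mathbf{i}:1:0)$ of $\pi$ (as for the rotation $(w:x:y:z)\mapsto(w:-x:-y:z)$), the curve is understood on the surface obtained by blowing up these two points, where $\pi$ becomes a morphism; it need not be geometrically irreducible. *)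

theory Defs
  imports "HOL-Analysis.Analysis"
begin

text \<open>
  Points of complex projective space are written as nonzero vectors of homogeneous coordinates, and
  two vectors are the same point when they are \<open>proj_eq\<close>. A polynomial over the infinite field of
  complex numbers is identified with its polynomial function. An object is defined over a subfield
  \<open>K\<close> when its coefficients lie in \<open>K\<close>; the real ground field is \<open>\<real>\<close>.
\<close>

definition proj_eq :: "complex ^ 'n \<Rightarrow> complex ^ 'n \<Rightarrow> bool" where
  "proj_eq u v \<longleftrightarrow> (\<exists>c. c \<noteq> 0 \<and> u = c *s v)"

definition monom_fun :: "('n::finite \<Rightarrow> nat) \<Rightarrow> complex ^ 'n \<Rightarrow> complex" where
  "monom_fun \<alpha> v = (\<Prod>i\<in>UNIV. v $ i ^ \<alpha> i)"

definition exponents :: "nat \<Rightarrow> ('n::finite \<Rightarrow> nat) set" where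
  "exponents d = {\<alpha>. (\<Sum>i\<in>UNIV. \<alpha> i) = d}"

lemma finite_exponents: "finite (exponents d :: ('n::finite \<Rightarrow> nat) set)"
proof (rule finite_subset)
  show "exponents d \<subseteq> (UNIV :: 'n set) \<rightarrow>\<^sub>E {..d}"
    by (auto simp: exponents_def PiE_def extensional_def intro: member_le_sum)
  show "finite ((UNIV :: 'n set) \<rightarrow>\<^sub>E {..d})"
    by (intro finite_PiE) auto
qed

text \<open>Homogeneous polynomials of degree \<open>d\<close>, and bihomogeneous ones of bidegree \<open>(d, e)\<close>.\<close>

definition form :: "complex set \<Rightarrow> nat \<Rightarrow> (complex ^ 'n \<Rightarrow> complex) \<Rightarrow> bool" where
  "form K d f \<longleftrightarrow> (\<exists>c. range c \<subseteq> K \<and> f = (\<lambda>v. \<Sum>\<alpha>\<in>exponents d. c \<alpha> * monom_fun \<alpha> v))"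

definition biform ::
  "complex set \<Rightarrow> nat \<Rightarrow> nat \<Rightarrow> ((complex ^ 'n) \<times> (complex ^ 'm) \<Rightarrow> complex) \<Rightarrow> bool" where
  "biform K d e f \<longleftrightarrow> (\<exists>c. range c \<subseteq> K \<and>
     f = (\<lambda>(u, v). \<Sum>(\<alpha>, \<beta>)\<in>exponents d \<times> exponents e. c (\<alpha>, \<beta>) * monom_fun \<alpha> u * monom_fun \<beta> v))"

definition form_map :: "complex set \<Rightarrow> (complex ^ 'n \<Rightarrow> complex ^ 'k) \<Rightarrow> bool" where
  "form_map K F \<longleftrightarrow> (\<exists>d. \<forall>i. form K d (\<lambda>v. F v $ i))"

definition biform_map ::
  "complex set \<Rightarrow> ((complex ^ 'n) \<times> (complex ^ 'm) \<Rightarrow> complex ^ 'k) \<Rightarrow> bool" where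
  "biform_map K F \<longleftrightarrow> (\<exists>d e. \<forall>i. biform K d e (\<lambda>q. F q $ i))"

text \<open>
  A tuple of forms of the same degree represents a rational map, which is defined wherever some form
  of the tuple is nonzero. The next predicate says that two tuples represent the same rational map
  on \<open>X\<close>. It is the right notion for irreducible \<open>X\<close>, and is used only for the quadric
  and for its general conic fibres.
\<close>

definition rat_eq ::
  "(complex ^ 'n) set \<Rightarrow> (complex ^ 'n \<Rightarrow> complex ^ 'k) \<Rightarrow> (complex ^ 'n \<Rightarrow> complex ^ 'k) \<Rightarrow> bool" where
  "rat_eq X F G \<longleftrightarrow> (\<exists>p\<in>X. F p \<noteq> 0) \<and> (\<exists>p\<in>X. G p \<noteq> 0) \<and>
     (\<forall>p\<in>X. F p \<noteq> 0 \<longrightarrow> G p \<noteq> 0 \<longrightarrow> proj_eq (F p) (G p))"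

text \<open>The coordinates \<open>(w : x : y : z)\<close> are the components 1, 2, 3, 4.\<close>

definition quadric_S :: "(complex ^ 4) set" where
  "quadric_S = {p. p \<noteq> 0 \<and> (p $ 1)\<^sup>2 = (p $ 2)\<^sup>2 + (p $ 3)\<^sup>2 + (p $ 4)\<^sup>2}"

definition pi_S :: "complex ^ 4 \<Rightarrow> complex ^ 2" where
  "pi_S p = vector [p $ 1, p $ 4]"

definition rat_self_map_S :: "(complex ^ 4 \<Rightarrow> complex ^ 4) \<Rightarrow> bool" where
  "rat_self_map_S F \<longleftrightarrow> form_map \<real> F \<and> (\<exists>p\<in>quadric_S. F p \<noteq> 0) \<and>
     (\<forall>p\<in>quadric_S. F p \<noteq> 0 \<longrightarrow> F p \<in> quadric_S)"

definition inverse_maps_S ::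
  "(complex ^ 4 \<Rightarrow> complex ^ 4) \<Rightarrow> (complex ^ 4 \<Rightarrow> complex ^ 4) \<Rightarrow> bool" where
  "inverse_maps_S F G \<longleftrightarrow> rat_eq quadric_S (F \<circ> G) id \<and> rat_eq quadric_S (G \<circ> F) id"

text \<open>
  The elements of the group Bir(S/\<open>\<pi>\<close>) are the classes of the following tuples modulo
  \<open>rat_eq quadric_S\<close>. The group law is induced by composition of tuples.
\<close>

definition Bir_S_pi :: "(complex ^ 4 \<Rightarrow> complex ^ 4) set" where
  "Bir_S_pi = {F. rat_self_map_S F \<and> (\<exists>G. rat_self_map_S G \<and> inverse_maps_S F G) \<and>
     rat_eq quadric_S (pi_S \<circ> F) pi_S}"

definition order_two :: "(complex ^ 4 \<Rightarrow> complex ^ 4) \<Rightarrow> bool" where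
  "order_two A \<longleftrightarrow> rat_eq quadric_S (A \<circ> A) id \<and> \<not> rat_eq quadric_S A id"

definition conjugate_Bir_S_pi ::
  "(complex ^ 4 \<Rightarrow> complex ^ 4) \<Rightarrow> (complex ^ 4 \<Rightarrow> complex ^ 4) \<Rightarrow> bool" where
  "conjugate_Bir_S_pi A B \<longleftrightarrow>
     (\<exists>C\<in>Bir_S_pi. \<exists>D\<in>Bir_S_pi. inverse_maps_S C D \<and> rat_eq quadric_S (C \<circ> A \<circ> D) B)"

text \<open>
  The conic over the point \<open>z\<close> of the projective line. It contains the two base-points of
  \<open>\<pi>\<close>.
\<close>

definition conic :: "complex ^ 2 \<Rightarrow> (complex ^ 4) set" where
  "conic z = {p\<in>quadric_S. p $ 1 * z $ 2 = p $ 4 * z $ 1}"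

text \<open>
  The restriction of a birational map to a smooth conic extends to all points of the conic, also to
  points where the given tuple vanishes. A point is fixed by the extension when some tuple \<open>G\<close>
  that represents the restriction is defined at the point and fixes it.
\<close>

definition fixed_on_conic :: "(complex ^ 4 \<Rightarrow> complex ^ 4) \<Rightarrow> complex ^ 2 \<Rightarrow> (complex ^ 4) set" where
  "fixed_on_conic A z =
     {p\<in>conic z. \<exists>G. form_map UNIV G \<and> rat_eq (conic z) A G \<and> proj_eq (G p) p}"

definition zariski_closure ::
  "((complex ^ 'n) \<times> (complex ^ 'm)) set \<Rightarrow> ((complex ^ 'n) \<times> (complex ^ 'm)) set" where
  "zariski_closure M = {q. fst q \<noteq> 0 \<and> snd q \<noteq> 0 \<and>
     (\<forall>d e f. biform UNIV d e f \<longrightarrow> (\<forall>m\<in>M. f m = 0) \<longrightarrow> f q = 0)}"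

text \<open>
  The blow-up of the quadric in the base-points of \<open>\<pi>\<close> is the closure of the graph of
  \<open>\<pi>\<close>, that is, the set of pairs \<open>(p, z)\<close> with \<open>p \<in> conic z\<close>, and
  \<open>\<pi>\<close> becomes the second projection. The curve of fixed points is taken there in all cases.
  Away from the base-points the blow-up changes nothing. The closure of the fixed points over the
  complement of a finite set \<open>E\<close> of points of the projective line is constant once \<open>E\<close> is
  large enough. This constant value, the intersection over all \<open>E\<close>, is the closure of the
  fixed points over general points.
\<close>

definition fixed_points_off ::
  "(complex ^ 4 \<Rightarrow> complex ^ 4) \<Rightarrow> (complex ^ 2) set \<Rightarrow> ((complex ^ 4) \<times> (complex ^ 2)) set" where
  "fixed_points_off A E =
     {(p, z). z \<noteq> 0 \<and> (\<forall>e\<in>E. \<not> proj_eq z e) \<and> p \<in> fixed_on_conic A z}"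

definition fix_curve :: "(complex ^ 4 \<Rightarrow> complex ^ 4) \<Rightarrow> ((complex ^ 4) \<times> (complex ^ 2)) set" where
  "fix_curve A = (\<Inter>E\<in>{E. finite E}. zariski_closure (fixed_points_off A E))"

text \<open>
  Rational maps between closed subsets of a product of two projective spaces. The source may be
  reducible, so the domain has to be dense in every component.
\<close>

definition bi_defined :: "('a \<Rightarrow> (complex ^ 'n) \<times> (complex ^ 'm)) \<Rightarrow> 'a \<Rightarrow> bool" where
  "bi_defined \<rho> q \<longleftrightarrow> fst (\<rho> q) \<noteq> 0 \<and> snd (\<rho> q) \<noteq> 0"

definition bi_proj_eq ::
  "(complex ^ 'n) \<times> (complex ^ 'm) \<Rightarrow> (complex ^ 'n) \<times> (complex ^ 'm) \<Rightarrow> bool" where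
  "bi_proj_eq q r \<longleftrightarrow> proj_eq (fst q) (fst r) \<and> proj_eq (snd q) (snd r)"

definition bi_rational_map ::
  "complex set \<Rightarrow> ((complex ^ 'n) \<times> (complex ^ 'm)) set \<Rightarrow> ((complex ^ 'k) \<times> (complex ^ 'l)) set
    \<Rightarrow> ((complex ^ 'n) \<times> (complex ^ 'm) \<Rightarrow> (complex ^ 'k) \<times> (complex ^ 'l)) \<Rightarrow> bool" where
  "bi_rational_map K X Y \<rho> \<longleftrightarrow> biform_map K (fst \<circ> \<rho>) \<and> biform_map K (snd \<circ> \<rho>) \<and>
     X \<subseteq> zariski_closure {q\<in>X. bi_defined \<rho> q} \<and>
     (\<forall>q\<in>X. bi_defined \<rho> q \<longrightarrow> \<rho> q \<in> Y)"

definition bi_birational_map ::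
  "complex set \<Rightarrow> ((complex ^ 'n) \<times> (complex ^ 'm)) set \<Rightarrow> ((complex ^ 'k) \<times> (complex ^ 'l)) set
    \<Rightarrow> ((complex ^ 'n) \<times> (complex ^ 'm) \<Rightarrow> (complex ^ 'k) \<times> (complex ^ 'l)) \<Rightarrow> bool" where
  "bi_birational_map K X Y \<rho> \<longleftrightarrow> bi_rational_map K X Y \<rho> \<and>
     (\<exists>\<sigma>. bi_rational_map K Y X \<sigma> \<and>
       X \<subseteq> zariski_closure {q\<in>X. bi_defined \<rho> q \<and> bi_proj_eq (\<sigma> (\<rho> q)) q} \<and>
       Y \<subseteq> zariski_closure {q\<in>Y. bi_defined \<sigma> q \<and> bi_proj_eq (\<rho> (\<sigma> q)) q})"

end

theory Submission
  imports Defs "HOL-Computational_Algebra.Fundamental_Theorem_Algebra"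
    "HOL-Computational_Algebra.Polynomial_Factorial" "HOL-Computational_Algebra.Field_as_Ring"
begin

text \<open>
  Over the base point \<open>(t : 1)\<close> the fibre is the conic \<open>x\<^sup>2 + y\<^sup>2 = (t\<^sup>2 - 1) z\<^sup>2\<close>, which has no real point
  for real \<open>\<bar>t\<bar> < 1\<close>. An involution restricts to a projective involution of a general fibre, hence it
  is the half-turn about an axis \<open>v\<close>, a vector of real polynomials in \<open>t\<close>, and its fixed points are the
  intersection of the conic with the polar line of \<open>v\<close>. They are defined over the extension by the
  square root of \<open>(t\<^sup>2 - 1) q(v)\<close>, where \<open>q\<close> is the quadratic form of the conic. Both a conjugation and a
  birational map of the curves of fixed points yield a point \<open>c + s d\<close> of the second curve that is
  defined over the extension belonging to the first, and the Gram determinant of the orthogonal basis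
  formed by \<open>c\<close>, \<open>d\<close> and the axis \<open>w\<close> of the second involution shows that \<open>q(v) q(w)\<close> is a square.
  Conversely, if \<open>h\<^sup>2 q(v) = k\<^sup>2 q(w)\<close>, then the half-turn about \<open>h v + k w\<close> or \<open>h v - k w\<close>, whichever is
  nonzero, exchanges the two axes. It conjugates the involutions and maps one curve to the other.
\<close>

text \<open>No function field is constructed. A statement over R(t), or over its extension by
  \<open>s\<close> with \<open>s^2 = (t^2 - 1) q(v)\<close>, is proved by evaluation at all but
  finitely many \<open>t\<close>, and the values at \<open>s\<close> and \<open>- s\<close> separate
  the two coefficients of \<open>F + s G\<close>. The arithmetic comes from real \<open>t\<close>
  between -1 and 1. There \<open>q\<close> is positive definite and \<open>(t^2 - 1) q(v)\<close> is
  negative wherever \<open>v\<close> does not vanish. Hence a nonzero real axis is anisotropic, and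
  \<open>c + s d\<close> with real \<open>c\<close>, \<open>d\<close> vanishes only if both do. Two
  obstacles shape the rest. The half-turn is quadratic in its axis, so the axis is sought through
  the collinearity of a point, its image and the axis: this condition is linear, has polynomial
  solutions, and is stable under complex conjugation, which makes the axis real. And a conjugating
  tuple \<open>C\<close> may vanish at the fixed points over every \<open>t\<close>. It is therefore
  evaluated along a curve in the fibre that passes through the fixed point at \<open>x = 0\<close>,
  and its lowest coefficient in \<open>x\<close> serves as the image of that point.\<close>

section \<open>Forms and biforms\<close>

text \<open>
  Unlike \<open>proj_eq\<close> this relation is given by the vanishing of forms. It holds trivially for the zero
  vector and is transitive only through nonzero vectors.
\<close>

definition par :: "complex ^ 'n \<Rightarrow> complex ^ 'n \<Rightarrow> bool" where
  "par a b \<longleftrightarrow> (\<forall>i j. a $ i * b $ j = a $ j * b $ i)"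

lemma par_sym: "par a b \<Longrightarrow> par b a"
  by (auto simp: par_def) (metis mult.commute)

lemma par_refl [simp]: "par a a"
  by (simp add: par_def)

lemma par_zero [simp]: "par 0 a" "par a 0"
  by (auto simp: par_def)

lemma par_scale_left: "par a b \<Longrightarrow> par (c *s a) b"
  by (auto simp: par_def algebra_simps)

lemma par_scale_right: "par a b \<Longrightarrow> par a (c *s b)"
  by (metis par_scale_left par_sym)

lemma par_iff_scale:
  assumes "b \<noteq> 0"
  shows "par a b \<longleftrightarrow> (\<exists>c. a = c *s b)"
proof
  assume ab: "par a b"
  obtain k where k: "b $ k \<noteq> 0"
    using assms by (auto simp: vec_eq_iff)
  have "a = (a $ k / b $ k) *s b"
    using ab k by (auto simp: vec_eq_iff par_def field_simps)
  then show "\<exists>c. a = c *s b" by blast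
qed (auto simp: par_def)

lemma par_trans:
  assumes "par a b" "par b c" "b \<noteq> 0"
  shows "par a c"
proof -
  obtain x where "a = x *s b" using assms(1,3) par_iff_scale by blast
  then show ?thesis using assms(2) by (simp add: par_scale_left)
qed

lemma par_scale_left_iff: "c \<noteq> 0 \<Longrightarrow> par (c *s a) b \<longleftrightarrow> par a b"
  by (auto simp: par_def mult.assoc)

lemma par_scale_right_iff: "c \<noteq> 0 \<Longrightarrow> par a (c *s b) \<longleftrightarrow> par a b"
  by (metis par_scale_left_iff par_sym)

lemma proj_eq_iff_par:
  assumes "a \<noteq> 0" "b \<noteq> 0"
  shows "proj_eq a b \<longleftrightarrow> par a b"
  using assms par_iff_scale[of b a] by (auto simp: proj_eq_def)

lemma proj_eq_par: "proj_eq a b \<Longrightarrow> par a b"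
  by (auto simp: proj_eq_def par_def)

lemma proj_eq_refl [simp]: "proj_eq a a"
  unfolding proj_eq_def by (rule exI[of _ 1]) simp

lemma proj_eq_sym: "proj_eq a b \<Longrightarrow> proj_eq b a"
proof -
  assume "proj_eq a b"
  then obtain c where "c \<noteq> 0" "a = c *s b" by (auto simp: proj_eq_def)
  then have "inverse c \<noteq> 0" "b = inverse c *s a" by (auto simp: vec_eq_iff)
  then show ?thesis unfolding proj_eq_def by blast
qed

lemma proj_eq_trans: "proj_eq a b \<Longrightarrow> proj_eq b c \<Longrightarrow> proj_eq a c"
  unfolding proj_eq_def by (metis no_zero_divisors vector_smult_assoc)

text \<open>As \<open>par\<close> holds trivially at a zero vector, the guards for points of
  indeterminacy disappear and the comparison becomes the vanishing of 2 by 2 minors, a closed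
  condition.\<close>

lemma rat_eq_iff_par:
  "rat_eq X F G \<longleftrightarrow> (\<exists>p\<in>X. F p \<noteq> 0) \<and> (\<exists>p\<in>X. G p \<noteq> 0) \<and> (\<forall>p\<in>X. par (F p) (G p))"
  unfolding rat_eq_def by (metis proj_eq_iff_par par_zero)

text \<open>Instantiated with the reals, for maps over the ground field, and with all complex
  numbers, for the polynomials that test a closure. The element \<open>- 1\<close> stands in for
  closure under negation.\<close>

definition coeff_ring :: "complex set \<Rightarrow> bool" where
  "coeff_ring K \<longleftrightarrow> 0 \<in> K \<and> 1 \<in> K \<and> - 1 \<in> K \<and>
     (\<forall>a\<in>K. \<forall>b\<in>K. a + b \<in> K \<and> a * b \<in> K)"

lemma coeff_ring_Reals [simp]: "coeff_ring \<real>"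
  by (simp add: coeff_ring_def)

lemma coeff_ring_UNIV [simp]: "coeff_ring UNIV"
  by (simp add: coeff_ring_def)

lemma coeff_ring_sum: "coeff_ring K \<Longrightarrow> (\<And>x. x \<in> A \<Longrightarrow> f x \<in> K) \<Longrightarrow> sum f A \<in> K"
  by (induction A rule: infinite_finite_induct) (auto simp: coeff_ring_def)

text \<open>Common source of the closure lemmas for forms and biforms: \<open>I\<close> is the set
  of exponents and \<open>m\<close> the family of monomials.\<close>

definition lin_span :: "complex set \<Rightarrow> 'i set \<Rightarrow> ('i \<Rightarrow> 'x \<Rightarrow> complex) \<Rightarrow> ('x \<Rightarrow> complex) \<Rightarrow> bool" where
  "lin_span K I m f \<longleftrightarrow> (\<exists>c. range c \<subseteq> K \<and> f = (\<lambda>x. \<Sum>a\<in>I. c a * m a x))"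

lemma lin_span_base:
  assumes "coeff_ring K" "finite I" "a \<in> I" "k \<in> K"
  shows "lin_span K I m (\<lambda>x. k * m a x)"
  unfolding lin_span_def
  using assms by (intro exI[of _ "\<lambda>i. if i = a then k else 0"])
    (auto simp: coeff_ring_def if_distrib[of "\<lambda>c. c * _"] sum.delta cong: if_cong)

lemma lin_span_add:
  assumes "coeff_ring K" "lin_span K I m f" "lin_span K I m g"
  shows "lin_span K I m (\<lambda>x. f x + g x)"
proof -
  from assms(2,3) obtain c d where "range c \<subseteq> K" "range d \<subseteq> K"
    and "f = (\<lambda>x. \<Sum>a\<in>I. c a * m a x)" "g = (\<lambda>x. \<Sum>a\<in>I. d a * m a x)"
    unfolding lin_span_def by blast
  then show ?thesis unfolding lin_span_def
    using assms(1) by (intro exI[of _ "\<lambda>a. c a + d a"])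
      (auto simp: coeff_ring_def sum.distrib distrib_right image_subset_iff)
qed

lemma lin_span_cmul:
  assumes "coeff_ring K" "lin_span K I m f" "k \<in> K"
  shows "lin_span K I m (\<lambda>x. k * f x)"
proof -
  from assms(2) obtain c where "range c \<subseteq> K" "f = (\<lambda>x. \<Sum>a\<in>I. c a * m a x)"
    unfolding lin_span_def by blast
  then show ?thesis unfolding lin_span_def
    using assms(1,3) by (intro exI[of _ "\<lambda>a. k * c a"])
      (auto simp: coeff_ring_def sum_distrib_left mult.assoc image_subset_iff)
qed

lemma lin_span_zero: "coeff_ring K \<Longrightarrow> lin_span K I m (\<lambda>x. 0)"
  unfolding lin_span_def by (rule exI[of _ "\<lambda>_. 0"]) (auto simp: coeff_ring_def)

lemma lin_span_sum:
  assumes "coeff_ring K" "\<And>j. j \<in> J \<Longrightarrow> lin_span K I m (f j)"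
  shows "lin_span K I m (\<lambda>x. \<Sum>j\<in>J. f j x)"
  using assms(2) by (induction J rule: infinite_finite_induct)
    (auto intro: lin_span_add lin_span_zero assms(1))

text \<open>The function \<open>g\<close> sends a pair of exponents to the exponent of the product
  monomial.\<close>

lemma lin_span_mult:
  assumes K: "coeff_ring K" and "finite L"
    and m: "\<And>a b. a \<in> I \<Longrightarrow> b \<in> J \<Longrightarrow> g a b \<in> L \<and> (\<forall>x. m1 a x * m2 b x = m3 (g a b) x)"
    and "lin_span K I m1 f" "lin_span K J m2 h"
  shows "lin_span K L m3 (\<lambda>x. f x * h x)"
proof -
  obtain c d where cd: "range c \<subseteq> K" "range d \<subseteq> K"
    and f: "f = (\<lambda>x. \<Sum>a\<in>I. c a * m1 a x)" and h: "h = (\<lambda>x. \<Sum>a\<in>J. d a * m2 a x)"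
    using assms(4,5) unfolding lin_span_def by blast
  have eq: "f x * h x = (\<Sum>a\<in>I. \<Sum>b\<in>J. (c a * d b) * m3 (g a b) x)" for x
    using m by (auto simp: f h sum_product ac_simps intro!: sum.cong)
  have "lin_span K L m3 (\<lambda>x. \<Sum>a\<in>I. \<Sum>b\<in>J. (c a * d b) * m3 (g a b) x)"
    using m cd K by (intro lin_span_sum lin_span_base K \<open>finite L\<close>) (auto simp: coeff_ring_def image_subset_iff)
  then show ?thesis by (simp add: eq)
qed

definition bimonom_fun ::
  "('n::finite \<Rightarrow> nat) \<times> ('m::finite \<Rightarrow> nat) \<Rightarrow> (complex ^ 'n) \<times> (complex ^ 'm) \<Rightarrow> complex" where
  "bimonom_fun a q = monom_fun (fst a) (fst q) * monom_fun (snd a) (snd q)"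

lemma form_eq_lin_span: "form K d f \<longleftrightarrow> lin_span K (exponents d) monom_fun f"
  by (simp add: form_def lin_span_def)

lemma biform_eq_lin_span: "biform K d e f \<longleftrightarrow> lin_span K (exponents d \<times> exponents e) bimonom_fun f"
  unfolding biform_def lin_span_def bimonom_fun_def
  by (simp add: case_prod_beta' mult.assoc)

lemma monom_fun_add: "monom_fun a v * monom_fun b v = monom_fun (\<lambda>i. a i + b i) v"
  by (simp add: monom_fun_def power_add prod.distrib)

lemma exponents_add: "a \<in> exponents d \<Longrightarrow> b \<in> exponents e \<Longrightarrow> (\<lambda>i. a i + b i) \<in> exponents (d + e)"
  by (simp add: exponents_def sum.distrib)

lemmas form_add = lin_span_add[where I = "exponents d" and m = monom_fun for d, folded form_eq_lin_span]
lemmas form_cmul = lin_span_cmul[where I = "exponents d" and m = monom_fun for d, folded form_eq_lin_span]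
lemmas form_sum = lin_span_sum[where I = "exponents d" and m = monom_fun for d, folded form_eq_lin_span]

lemmas biform_add = lin_span_add[where I = "exponents d \<times> exponents e" and m = bimonom_fun for d e, folded biform_eq_lin_span]
lemmas biform_cmul = lin_span_cmul[where I = "exponents d \<times> exponents e" and m = bimonom_fun for d e, folded biform_eq_lin_span]
lemmas biform_sum = lin_span_sum[where I = "exponents d \<times> exponents e" and m = bimonom_fun for d e, folded biform_eq_lin_span]

lemma form_mult:
  assumes "coeff_ring K" "form K d f" "form K e g"
  shows "form K (d + e) (\<lambda>v. f v * g v)"
  using assms unfolding form_eq_lin_span
  by (intro lin_span_mult[where I = "exponents d" and J = "exponents e" and g = "\<lambda>a b i. a i + b i"
      and ?m1.0 = monom_fun and ?m2.0 = monom_fun])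
    (auto simp: finite_exponents monom_fun_add exponents_add)

lemma biform_mult:
  assumes "coeff_ring K" "biform K d e f" "biform K d' e' g"
  shows "biform K (d + d') (e + e') (\<lambda>v. f v * g v)"
  using assms unfolding biform_eq_lin_span
  by (intro lin_span_mult[where I = "exponents d \<times> exponents e" and J = "exponents d' \<times> exponents e'"
       and g = "\<lambda>a b. (\<lambda>i. fst a i + fst b i, \<lambda>i. snd a i + snd b i)"
      and ?m1.0 = bimonom_fun and ?m2.0 = bimonom_fun])
    (auto simp: finite_exponents monom_fun_add[symmetric] exponents_add bimonom_fun_def)

lemma form_const:
  assumes "coeff_ring K" "k \<in> K"
  shows "form K 0 (\<lambda>v. k)"
  using lin_span_base[where I = "exponents 0" and m = monom_fun and a = "\<lambda>_. 0", OF assms(1) finite_exponents _ assms(2)]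
  by (simp add: form_eq_lin_span exponents_def monom_fun_def)

lemma form_coord:
  assumes "coeff_ring K"
  shows "form K 1 (\<lambda>v. v $ i)"
proof -
  have "monom_fun (\<lambda>j. if j = i then 1 else 0) v = v $ i" for v :: "complex ^ 'a"
    by (simp add: monom_fun_def if_distrib[of "\<lambda>n. _ ^ n"] prod.delta cong: if_cong)
  then show ?thesis
    using lin_span_base[where I = "exponents 1" and m = monom_fun and k = 1
        and a = "\<lambda>j. if j = i then 1 else 0", OF assms finite_exponents] assms
    by (simp add: form_eq_lin_span exponents_def coeff_ring_def)
qed

lemma form_uminus: "coeff_ring K \<Longrightarrow> form K d f \<Longrightarrow> form K d (\<lambda>v. - f v)"
  using form_cmul[of K d f "- 1"] by (simp add: coeff_ring_def)

lemma form_diff: "coeff_ring K \<Longrightarrow> form K d f \<Longrightarrow> form K d g \<Longrightarrow> form K d (\<lambda>v. f v - g v)"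
  using form_add[of K d f "\<lambda>v. - g v"] form_uminus[of K d g] by simp

lemma form_mult':
  "coeff_ring K \<Longrightarrow> form K d f \<Longrightarrow> form K e g \<Longrightarrow> d + e = n \<Longrightarrow> form K n (\<lambda>v. f v * g v)"
  using form_mult by blast

lemma form_power: "coeff_ring K \<Longrightarrow> form K d f \<Longrightarrow> form K (n * d) (\<lambda>v. f v ^ n)"
  by (induction n) (auto simp: coeff_ring_def intro: form_mult form_const)

lemma form_prod:
  assumes "coeff_ring K" "finite J" "\<And>j. j \<in> J \<Longrightarrow> form K (d j) (f j)"
  shows "form K (\<Sum>j\<in>J. d j) (\<lambda>v. \<Prod>j\<in>J. f j v)"
  using assms(2,3) by (induction J rule: finite_induct)
    (use assms(1) in \<open>auto simp: coeff_ring_def intro: form_mult form_const\<close>)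

lemma form_mono:
  assumes "form K d f"
  shows "form UNIV d f"
  using assms unfolding form_def by blast

lemma form_scale:
  assumes "form K d f"
  shows "f (c *s v) = c ^ d * f v"
proof -
  obtain k where f: "f = (\<lambda>v. \<Sum>\<alpha>\<in>exponents d. k \<alpha> * monom_fun \<alpha> v)"
    using assms unfolding form_def by blast
  have "monom_fun \<alpha> (c *s v) = c ^ d * monom_fun \<alpha> v" if "\<alpha> \<in> exponents d" for \<alpha>
    using that by (simp add: monom_fun_def power_mult_distrib prod.distrib exponents_def flip: power_sum)
  then show ?thesis by (simp add: f sum_distrib_left mult.left_commute)
qed

lemma biform_uminus: "coeff_ring K \<Longrightarrow> biform K d e f \<Longrightarrow> biform K d e (\<lambda>v. - f v)"
  using biform_cmul[of K d e f "- 1"] by (simp add: coeff_ring_def)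

lemma biform_diff:
  "coeff_ring K \<Longrightarrow> biform K d e f \<Longrightarrow> biform K d e g \<Longrightarrow> biform K d e (\<lambda>v. f v - g v)"
  using biform_add[of K d e f "\<lambda>v. - g v"] biform_uminus[of K d e g] by simp

lemma biform_mult':
  "coeff_ring K \<Longrightarrow> biform K d e f \<Longrightarrow> biform K d' e' g \<Longrightarrow> d + d' = n \<Longrightarrow> e + e' = m \<Longrightarrow>
    biform K n m (\<lambda>v. f v * g v)"
  using biform_mult by blast

lemma biform_fst:
  assumes "coeff_ring K" "form K d (f :: complex ^ 'n \<Rightarrow> complex)"
  shows "biform K d 0 (\<lambda>q. f (fst (q :: (complex ^ 'n) \<times> (complex ^ 'm))))"
proof -
  obtain k where k: "range k \<subseteq> K" and f: "f = (\<lambda>v. \<Sum>\<alpha>\<in>exponents d. k \<alpha> * monom_fun \<alpha> v)"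
    using assms unfolding form_def by blast
  have "biform K d 0 (\<lambda>q :: (complex ^ 'n) \<times> (complex ^ 'm). \<Sum>\<alpha>\<in>exponents d. k \<alpha> * bimonom_fun (\<alpha>, \<lambda>_. 0) q)"
    unfolding biform_eq_lin_span using k
    by (intro lin_span_sum lin_span_base assms(1) finite_cartesian_product finite_exponents) (auto simp: exponents_def)
  then show ?thesis by (simp add: f bimonom_fun_def monom_fun_def)
qed

lemma biform_snd:
  assumes "coeff_ring K" "form K d (f :: complex ^ 'm \<Rightarrow> complex)"
  shows "biform K 0 d (\<lambda>q. f (snd (q :: (complex ^ 'n) \<times> (complex ^ 'm))))"
proof -
  obtain k where k: "range k \<subseteq> K" and f: "f = (\<lambda>v. \<Sum>\<alpha>\<in>exponents d. k \<alpha> * monom_fun \<alpha> v)"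
    using assms unfolding form_def by blast
  have "biform K 0 d (\<lambda>q :: (complex ^ 'n) \<times> (complex ^ 'm). \<Sum>\<alpha>\<in>exponents d. k \<alpha> * bimonom_fun (\<lambda>_. 0, \<alpha>) q)"
    unfolding biform_eq_lin_span using k
    by (intro lin_span_sum lin_span_base assms(1) finite_cartesian_product finite_exponents) (auto simp: exponents_def)
  then show ?thesis by (simp add: f bimonom_fun_def monom_fun_def)
qed

lemma biform_scale:
  assumes "biform K d e f"
  shows "f (c *s u, k *s v) = c ^ d * k ^ e * f (u, v)"
proof -
  obtain h where f: "f = (\<lambda>v. \<Sum>\<alpha>\<in>exponents d \<times> exponents e. h \<alpha> * bimonom_fun \<alpha> v)"
    using assms unfolding biform_eq_lin_span lin_span_def by blast
  have "bimonom_fun \<alpha> (c *s u, k *s v) = c ^ d * k ^ e * bimonom_fun \<alpha> (u, v)"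
    if "\<alpha> \<in> exponents d \<times> exponents e" for \<alpha>
    using that by (auto simp: bimonom_fun_def monom_fun_def power_mult_distrib prod.distrib exponents_def power_sum)
  then show ?thesis by (simp add: f sum_distrib_left mult.left_commute)
qed

text \<open>Target of substitutions: a form whose arguments are functions in \<open>R\<close> has
  its value in \<open>R\<close>. The instances below are polynomials in one parameter and the rings
  of functions \<open>F + s G\<close>.\<close>

definition fun_algebra :: "complex set \<Rightarrow> ('x \<Rightarrow> complex) set \<Rightarrow> bool" where
  "fun_algebra K R \<longleftrightarrow> (\<forall>k\<in>K. (\<lambda>_. k) \<in> R) \<and>
     (\<forall>f\<in>R. \<forall>g\<in>R. (\<lambda>x. f x + g x) \<in> R \<and> (\<lambda>x. f x * g x) \<in> R)"

lemma fun_algebra_sum: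
  assumes "coeff_ring K" "fun_algebra K R" "\<And>j. j \<in> J \<Longrightarrow> f j \<in> R"
  shows "(\<lambda>x. \<Sum>j\<in>J. f j x) \<in> R"
  using assms(3) by (induction J rule: infinite_finite_induct)
    (use assms(1,2) in \<open>auto simp: fun_algebra_def coeff_ring_def\<close>)

lemma fun_algebra_prod:
  assumes "coeff_ring K" "fun_algebra K R" "\<And>j. j \<in> J \<Longrightarrow> f j \<in> R"
  shows "(\<lambda>x. \<Prod>j\<in>J. f j x) \<in> R"
  using assms(3) by (induction J rule: infinite_finite_induct)
    (use assms(1,2) in \<open>auto simp: fun_algebra_def coeff_ring_def\<close>)

lemma fun_algebra_power:
  assumes "coeff_ring K" "fun_algebra K R" "f \<in> R"
  shows "(\<lambda>x. f x ^ n) \<in> R"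
  using assms by (induction n) (auto simp: fun_algebra_def coeff_ring_def)

lemma fun_algebra_lin_span:
  assumes "coeff_ring K" "fun_algebra K R" "lin_span K I m f"
    and "\<And>a. a \<in> I \<Longrightarrow> (\<lambda>x. m a (G x)) \<in> R"
  shows "(\<lambda>x. f (G x)) \<in> R"
proof -
  obtain c where c: "range c \<subseteq> K" "f = (\<lambda>x. \<Sum>a\<in>I. c a * m a x)"
    using assms(3) unfolding lin_span_def by blast
  have "(\<lambda>x. \<Sum>a\<in>I. c a * m a (G x)) \<in> R"
    using assms(2,4) c by (intro fun_algebra_sum[OF assms(1,2)]) (force simp: fun_algebra_def image_subset_iff)
  then show ?thesis by (simp add: c)
qed

lemma fun_algebra_monom:
  assumes "coeff_ring K" "fun_algebra K R" "\<And>i. (\<lambda>x. G x $ i) \<in> R"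
  shows "(\<lambda>x. monom_fun \<alpha> (G x)) \<in> R"
  unfolding monom_fun_def
  by (intro fun_algebra_prod[OF assms(1,2)] fun_algebra_power[OF assms(1,2)] assms(3))

lemma form_fun_algebra:
  assumes "coeff_ring K" "fun_algebra K R" "form K d f" "\<And>i. (\<lambda>x. G x $ i) \<in> R"
  shows "(\<lambda>x. f (G x)) \<in> R"
  using fun_algebra_lin_span[OF assms(1,2) assms(3)[unfolded form_eq_lin_span]] 
    fun_algebra_monom[OF assms(1,2,4)] by blast

lemma biform_fun_algebra:
  assumes "coeff_ring K" "fun_algebra K R" "biform K d e f" 
    "\<And>i. (\<lambda>x. G x $ i) \<in> R" "\<And>i. (\<lambda>x. H x $ i) \<in> R"
  shows "(\<lambda>x. f (G x, H x)) \<in> R"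
proof (rule fun_algebra_lin_span[OF assms(1,2) assms(3)[unfolded biform_eq_lin_span]])
  show "(\<lambda>x. bimonom_fun a (G x, H x)) \<in> R" for a
    using fun_algebra_monom[OF assms(1,2,4)] fun_algebra_monom[OF assms(1,2,5)] assms(2)
    by (auto simp: bimonom_fun_def fun_algebra_def)
qed

lemma form_compose:
  fixes G :: "complex ^ 'k \<Rightarrow> complex ^ 'n"
  assumes K: "coeff_ring K" and f: "form K d f" and G: "\<And>i. form K e (\<lambda>v. G v $ i)"
  shows "form K (d * e) (\<lambda>v. f (G v))"
proof -
  obtain k where k: "range k \<subseteq> K" and f: "f = (\<lambda>v. \<Sum>\<alpha>\<in>exponents d. k \<alpha> * monom_fun \<alpha> v)"
    using f unfolding form_def by blast
  have "form K (d * e) (\<lambda>v. monom_fun \<alpha> (G v))" if "\<alpha> \<in> exponents d" for \<alpha>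
  proof -
    have "form K (\<Sum>i\<in>UNIV. \<alpha> i * e) (\<lambda>v. \<Prod>i\<in>UNIV. (G v $ i) ^ \<alpha> i)"
      by (intro form_prod form_power K G) auto
    then show ?thesis using that by (simp add: monom_fun_def exponents_def sum_distrib_right[symmetric])
  qed
  then show ?thesis unfolding f using k
    by (intro form_sum[OF K] form_cmul[OF K]) auto
qed

lemma biform_power: "coeff_ring K \<Longrightarrow> biform K d e f \<Longrightarrow> biform K (n * d) (n * e) (\<lambda>v. f v ^ n)"
proof (induction n)
  case 0
  show ?case using biform_fst[OF 0(1) form_const[OF 0(1), of 1]] 0 by (simp add: coeff_ring_def)
qed (auto intro: biform_mult)

lemma biform_prod:
  fixes f :: "'i \<Rightarrow> (complex ^ 'n) \<times> (complex ^ 'm) \<Rightarrow> complex"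
  assumes "coeff_ring K" "finite J" "\<And>j. j \<in> J \<Longrightarrow> biform K (d j) (e j) (f j)"
  shows "biform K (\<Sum>j\<in>J. d j) (\<Sum>j\<in>J. e j) (\<lambda>v. \<Prod>j\<in>J. f j v)"
  using assms(2,3)
proof (induction J rule: finite_induct)
  case empty
  show ?case using biform_fst[OF assms(1) form_const[OF assms(1), of 1]] assms(1)
    by (simp add: coeff_ring_def)
qed (use assms(1) in \<open>auto intro: biform_mult\<close>)

text \<open>Only the first factor is transformed, as by a map of the blown-up surface over the base.
  The base coordinates that enter through \<open>G\<close> contribute \<open>d * b\<close> to the
  second degree.\<close>

lemma biform_compose_fst:
  fixes G :: "(complex ^ 'n) \<times> (complex ^ 'm) \<Rightarrow> complex ^ 'n"
  assumes K: "coeff_ring K" and f: "biform K d e f" and G: "\<And>i. biform K a b (\<lambda>q. G q $ i)"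
  shows "biform K (d * a) (d * b + e) (\<lambda>q. f (G q, snd q))"
proof -
  obtain h where h: "range h \<subseteq> K" and
    f: "f = (\<lambda>v. \<Sum>\<alpha>\<in>exponents d \<times> exponents e. h \<alpha> * bimonom_fun \<alpha> v)"
    using f unfolding biform_eq_lin_span lin_span_def by blast
  have "biform K (d * a) (d * b + e) (\<lambda>q. bimonom_fun \<alpha> (G q, snd q))"
    if "\<alpha> \<in> exponents d \<times> exponents e" for \<alpha>
  proof -
    have 1: "biform K (\<Sum>i\<in>UNIV. fst \<alpha> i * a) (\<Sum>i\<in>UNIV. fst \<alpha> i * b) (\<lambda>q. \<Prod>i\<in>UNIV. (G q $ i) ^ fst \<alpha> i)"
      by (intro biform_prod biform_power K G) auto
    have "form K e (monom_fun (snd \<alpha>))"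
      using lin_span_base[OF K finite_exponents, of "snd \<alpha>" e 1 monom_fun] that K
      by (auto simp: form_eq_lin_span coeff_ring_def)
    then have 2: "biform K 0 e (\<lambda>q :: (complex ^ 'n) \<times> (complex ^ 'm). monom_fun (snd \<alpha>) (snd q))"
      using biform_snd[OF K] by blast
    show ?thesis using biform_mult[OF K 1 2] that
      by (auto simp add: monom_fun_def bimonom_fun_def exponents_def sum_distrib_right[symmetric])
  qed
  then show ?thesis unfolding f using h
    by (intro biform_sum[OF K] biform_cmul[OF K]) auto
qed

section \<open>The affine parametrization of the quadric\<close>

definition vec4 :: "complex \<Rightarrow> complex \<Rightarrow> complex \<Rightarrow> complex \<Rightarrow> complex ^ 4" where
  "vec4 a b c d = (\<chi> i. if i = 1 then a else if i = 2 then b else if i = 3 then c else d)"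

lemma vec4_nth [simp]:
  "vec4 a b c d $ 1 = a" "vec4 a b c d $ 2 = b" "vec4 a b c d $ 3 = c" "vec4 a b c d $ 4 = d"
  by (simp_all add: vec4_def)

lemma vec4_eq_iff: "p = q \<longleftrightarrow> p $ 1 = q $ 1 \<and> p $ 2 = q $ 2 \<and> p $ 3 = q $ 3 \<and> p $ 4 = (q $ 4)"
  for p q :: "complex ^ 4"
  by (simp add: vec_eq_iff forall_4)

definition vec2 :: "complex \<Rightarrow> complex \<Rightarrow> complex ^ 2" where
  "vec2 a b = (\<chi> i. if i = 1 then a else b)"

lemma vec2_nth [simp]: "vec2 a b $ 1 = a" "vec2 a b $ 2 = b"
  by (simp_all add: vec2_def)

lemma pi_S_nth [simp]: "pi_S p $ 1 = p $ 1" "pi_S p $ 2 = p $ 4"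
  by (simp_all add: pi_S_def)

text \<open>The polar form of the quadric. On the plane \<open>w = t z\<close> it is
  \<open>x x' + y y' - (t^2 - 1) z z'\<close>, the form of the conic over
  \<open>(t : 1)\<close>.\<close>

definition lor :: "complex ^ 4 \<Rightarrow> complex ^ 4 \<Rightarrow> complex" where
  "lor p q = p $ 2 * q $ 2 + p $ 3 * q $ 3 + p $ 4 * q $ 4 - p $ 1 * q $ 1"

lemma lor_commute: "lor p q = lor q p"
  by (simp add: lor_def mult.commute)

lemma lor_linear [simp]:
  "lor (p + q) r = lor p r + lor q r" "lor r (p + q) = lor r p + lor r q"
  "lor (p - q) r = lor p r - lor q r" "lor r (p - q) = lor r p - lor r q"
  "lor (c *s p) r = c * lor p r" "lor r (c *s p) = c * lor r p"
  "lor 0 r = 0" "lor r 0 = 0"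
  by (simp_all add: lor_def algebra_simps)

lemma quadric_S_iff: "p \<in> quadric_S \<longleftrightarrow> p \<noteq> 0 \<and> lor p p = 0"
  by (auto simp: quadric_S_def lor_def power2_eq_square)

text \<open>The isometry that fixes \<open>v\<close> and is -1 on its orthogonal complement,
  multiplied by \<open>lor v v\<close>. Clearing this denominator keeps the coordinates polynomial
  in \<open>v\<close> and \<open>p\<close>.\<close>

definition half_turn :: "complex ^ 4 \<Rightarrow> complex ^ 4 \<Rightarrow> complex ^ 4" where
  "half_turn v p = (2 * lor p v) *s v - lor v v *s p"

lemma half_turn_scale_axis: "half_turn (c *s v) p = (c\<^sup>2) *s half_turn v p"
  by (simp add: half_turn_def vec4_eq_iff power2_eq_square algebra_simps)

lemma half_turn_scale: "half_turn v (c *s p) = c *s half_turn v p"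
  by (simp add: half_turn_def vec4_eq_iff algebra_simps)

lemma half_turn_zero [simp]: "half_turn v 0 = 0"
  by (simp add: half_turn_def)

lemma half_turn_twice: "half_turn v (half_turn v p) = ((lor v v)\<^sup>2) *s p"
  by (simp add: half_turn_def vec4_eq_iff power2_eq_square algebra_simps)

lemma lor_half_turn: "lor (half_turn v p) (half_turn v q) = (lor v v)\<^sup>2 * lor p q"
  by (simp add: half_turn_def power2_eq_square algebra_simps lor_commute)

lemma half_turn_nonzero: "lor v v \<noteq> 0 \<Longrightarrow> p \<noteq> 0 \<Longrightarrow> half_turn v p \<noteq> 0"
  using half_turn_twice[of v p] by (metis half_turn_zero power_eq_0_iff vector_mul_eq_0)

text \<open>An eigenvector of the half-turn lies on the axis or in its orthogonal complement, and an
  isotropic vector cannot lie on an anisotropic axis.\<close>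

lemma half_turn_par_self:
  assumes "lor v v \<noteq> 0" "lor p p = 0" "p \<noteq> 0" "par (half_turn v p) p"
  shows "lor p v = 0"
proof (rule ccontr)
  assume n: "lor p v \<noteq> 0"
  obtain c where c: "half_turn v p = c *s p"
    using assms(3,4) par_iff_scale by blast
  then have e: "(2 * lor p v) *s v = (c + lor v v) *s p"
    unfolding half_turn_def by (simp add: vec4_eq_iff algebra_simps)
  have "(2 * lor p v) * lor v v * (2 * lor p v) = lor ((2 * lor p v) *s v) ((2 * lor p v) *s v)"
    by simp
  also have "\<dots> = 0" unfolding e using assms(2) by simp
  finally show False using n assms(1) by simp
qed

lemma half_turn_fix: "lor p v = 0 \<Longrightarrow> half_turn v p = (- lor v v) *s p"
  by (simp add: half_turn_def vec4_eq_iff)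

section \<open>Polynomial dependence on a parameter and generic parameters\<close>

definition poly_over :: "complex set \<Rightarrow> complex poly \<Rightarrow> bool" where
  "poly_over K p \<longleftrightarrow> (\<forall>i. coeff p i \<in> K)"

lemma poly_over_UNIV [simp]: "poly_over UNIV p"
  by (simp add: poly_over_def)

lemma poly_over_add: "coeff_ring K \<Longrightarrow> poly_over K p \<Longrightarrow> poly_over K q \<Longrightarrow> poly_over K (p + q)"
  by (simp add: poly_over_def coeff_ring_def)

lemma poly_over_mult: "coeff_ring K \<Longrightarrow> poly_over K p \<Longrightarrow> poly_over K q \<Longrightarrow> poly_over K (p * q)"
  unfolding poly_over_def coeff_mult by (auto intro!: coeff_ring_sum simp: coeff_ring_def)

lemma poly_over_pCons: "k \<in> K \<Longrightarrow> poly_over K p \<Longrightarrow> poly_over K (pCons k p)"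
  by (auto simp: poly_over_def coeff_pCons split: nat.split)

lemma poly_over_0: "coeff_ring K \<Longrightarrow> poly_over K 0"
  by (auto simp: poly_over_def coeff_ring_def)

lemma poly_over_uminus: "coeff_ring K \<Longrightarrow> poly_over K p \<Longrightarrow> poly_over K (- p)"
  unfolding poly_over_def coeff_ring_def coeff_minus by (metis mult_minus1)

lemma poly_over_diff: "coeff_ring K \<Longrightarrow> poly_over K p \<Longrightarrow> poly_over K q \<Longrightarrow> poly_over K (p - q)"
  using poly_over_add[of K p "- q"] poly_over_uminus[of K q] by simp

lemma poly_over_1: "coeff_ring K \<Longrightarrow> poly_over K 1"
  by (auto simp: poly_over_def coeff_ring_def coeff_1)

lemmas poly_over_intros = poly_over_add poly_over_mult poly_over_pCons poly_over_0 poly_over_1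
  poly_over_uminus poly_over_diff

lemma poly_over_Reals_real: "poly_over \<real> p \<Longrightarrow> t \<in> \<real> \<Longrightarrow> poly p t \<in> \<real>"
  unfolding poly_altdef poly_over_def by (intro sum_in_Reals Reals_mult Reals_power) auto

definition poly_funs :: "(complex \<Rightarrow> complex) set" where
  "poly_funs = range poly"

lemma poly_funs_algebra: "fun_algebra UNIV poly_funs"
  unfolding fun_algebra_def poly_funs_def
proof (intro conjI ballI)
  fix k :: complex
  show "(\<lambda>_. k) \<in> range poly" by (rule image_eqI[of _ _ "[:k:]"]) auto
next
  fix f g :: "complex \<Rightarrow> complex"
  assume "f \<in> range poly" "g \<in> range poly"
  then obtain p q where "f = poly p" "g = poly q" by auto
  then have "(\<lambda>x. f x + g x) = poly (p + q)" "(\<lambda>x. f x * g x) = poly (p * q)"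
    by (simp_all add: fun_eq_iff)
  then show "(\<lambda>x. f x + g x) \<in> range poly" "(\<lambda>x. f x * g x) \<in> range poly"
    by simp_all
qed

lemma poly_funs_const [simp]: "(\<lambda>_. k) \<in> poly_funs"
  using poly_funs_algebra by (simp add: fun_algebra_def)

lemma poly_funs_id [simp]: "(\<lambda>x. x) \<in> poly_funs"
  unfolding poly_funs_def by (rule image_eqI[of _ _ "[:0, 1:]"]) auto

lemma poly_funs_poly [simp]: "poly p \<in> poly_funs"
  by (simp add: poly_funs_def)

lemma poly_funs_add: "f \<in> poly_funs \<Longrightarrow> g \<in> poly_funs \<Longrightarrow> (\<lambda>x. f x + g x) \<in> poly_funs"
  and poly_funs_mult: "f \<in> poly_funs \<Longrightarrow> g \<in> poly_funs \<Longrightarrow> (\<lambda>x. f x * g x) \<in> poly_funs"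
  using poly_funs_algebra by (simp_all add: fun_algebra_def)

lemma poly_funs_power: "f \<in> poly_funs \<Longrightarrow> (\<lambda>x. f x ^ n) \<in> poly_funs"
  by (intro fun_algebra_power[OF _ poly_funs_algebra]) auto

lemma poly_funs_diff: "f \<in> poly_funs \<Longrightarrow> g \<in> poly_funs \<Longrightarrow> (\<lambda>x. f x - g x) \<in> poly_funs"
  using poly_funs_add[of f "\<lambda>x. - 1 * g x"] poly_funs_mult[of "\<lambda>_. - 1" g] by simp

lemma poly_funs_divide_const: "f \<in> poly_funs \<Longrightarrow> (\<lambda>x. f x / k) \<in> poly_funs"
  using poly_funs_mult[of f "\<lambda>_. 1 / k"] by simp

lemma poly_funs_uminus: "f \<in> poly_funs \<Longrightarrow> (\<lambda>x. - f x) \<in> poly_funs"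
  using poly_funs_diff[of "\<lambda>_. 0" f] by simp

lemmas poly_funs_intros = poly_funs_add poly_funs_mult poly_funs_power poly_funs_diff
  poly_funs_divide_const poly_funs_uminus

lemma poly_funs_form:
  "form K d f \<Longrightarrow> (\<And>i. (\<lambda>x. G x $ i) \<in> poly_funs) \<Longrightarrow> (\<lambda>x. f (G x)) \<in> poly_funs"
  using form_fun_algebra[OF coeff_ring_UNIV poly_funs_algebra form_mono] by blast

text \<open>This makes the filter \<open>cofinite\<close> a notion of genericity: one nonzero value
  is enough for all but finitely many.\<close>

lemma poly_funs_generic:
  assumes "f \<in> poly_funs" "f x0 \<noteq> 0"
  shows "\<forall>\<^sub>F x in cofinite. f x \<noteq> 0"
proof -
  obtain p where f: "f = poly p" using assms(1) by (auto simp: poly_funs_def)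
  with assms(2) have "p \<noteq> 0" by auto
  then show ?thesis using poly_roots_finite[of p] by (simp add: f eventually_cofinite)
qed

lemma poly_funs_zero:
  assumes "f \<in> poly_funs" "\<exists>\<^sub>F x in cofinite. f x = 0"
  shows "f x = 0"
  by (rule ccontr, drule poly_funs_generic[OF assms(1)]) (use assms(2) in \<open>simp add: frequently_def\<close>)

lemma cofinite_complex_nontriv [simp]: "cofinite \<noteq> (bot :: complex filter)"
  by (simp add: infinite_UNIV_char_0)

lemma poly_funs_zero_eventually:
  assumes "f \<in> poly_funs" "\<forall>\<^sub>F x in cofinite. f x = 0"
  shows "f x = 0"
  by (rule poly_funs_zero[OF assms(1) eventually_frequently[OF cofinite_complex_nontriv assms(2)]])

lemma eventually_cofinite_neq: "\<forall>\<^sub>F x in cofinite. x \<noteq> (a :: 'a)"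
  by (simp add: eventually_cofinite)

text \<open>Genericity is iterated: for generic \<open>t\<close>, then for generic \<open>u\<close>
  depending on \<open>t\<close>. This keeps the fibres visible and needs polynomiality in each
  variable separately only.\<close>

lemma bipoly_generic:
  assumes "\<And>u. (\<lambda>t. f t u) \<in> poly_funs" "\<And>t. (\<lambda>u. f t u) \<in> poly_funs" "f t0 u0 \<noteq> 0"
  shows "\<forall>\<^sub>F t in cofinite. \<forall>\<^sub>F u in cofinite. f t u \<noteq> 0"
  using poly_funs_generic[OF assms(1,3)]
  by eventually_elim (rule poly_funs_generic[OF assms(2)])

text \<open>For fixed \<open>t\<close> this is the conic in its isotropic coordinates:
  \<open>x + i y = u^2\<close>, \<open>x - i y = t^2 - 1\<close> and \<open>z = u\<close>. It is
  defined over the complex numbers only.\<close>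

definition psi :: "complex \<Rightarrow> complex \<Rightarrow> complex ^ 4" where
  "psi t u = vec4 (u * t) ((u\<^sup>2 + (t\<^sup>2 - 1)) / 2) ((u\<^sup>2 - (t\<^sup>2 - 1)) / (2 * \<i>)) u"

lemma psi_nth [simp]:
  "psi t u $ 1 = u * t" "psi t u $ 2 = (u\<^sup>2 + (t\<^sup>2 - 1)) / 2"
  "psi t u $ 3 = (u\<^sup>2 - (t\<^sup>2 - 1)) / (2 * \<i>)" "psi t u $ 4 = u"
  by (simp_all add: psi_def)

lemma lor_psi: "lor (psi t u) (psi t u) = 0"
proof -
  have "(psi t u $ 2)\<^sup>2 + (psi t u $ 3)\<^sup>2 = u\<^sup>2 * (t\<^sup>2 - 1)"
    by (simp add: field_simps power2_eq_square)
  then show ?thesis by (simp add: lor_def power2_eq_square algebra_simps del: psi_nth(2,3))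
qed

lemma psi_nonzero: "u \<noteq> 0 \<Longrightarrow> psi t u \<noteq> 0"
  by (auto simp: vec4_eq_iff)

lemma psi_in_S: "u \<noteq> 0 \<Longrightarrow> psi t u \<in> quadric_S"
  by (simp add: quadric_S_iff lor_psi psi_nonzero)

lemma psi_poly_funs_t: "(\<lambda>t. psi t u $ i) \<in> poly_funs"
  using exhaust_4[of i] by (auto intro!: poly_funs_intros)

lemma psi_poly_funs_u: "(\<lambda>u. psi t u $ i) \<in> poly_funs"
  using exhaust_4[of i] by (auto intro!: poly_funs_intros)

text \<open>The coordinate \<open>u\<close> of a point of the fibre over \<open>(t : 1)\<close> is \<open>(x + i y) / z\<close>.\<close>

lemma psi_coordinate:
  assumes "lor p p = 0" "p $ 1 = t * p $ 4" "p $ 4 \<noteq> 0"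
  shows "psi t ((p $ 2 + \<i> * p $ 3) / p $ 4) = ((p $ 2 + \<i> * p $ 3) / (p $ 4)\<^sup>2) *s p"
proof -
  define X where "X = p $ 2 + \<i> * p $ 3"
  define z where "z = p $ 4"
  have 1: "(t\<^sup>2 - 1) * z\<^sup>2 = X * (p $ 2 - \<i> * p $ 3)"
    using assms(1,2) by (simp add: lor_def X_def z_def power2_eq_square algebra_simps)
  then have 2: "t\<^sup>2 - 1 = X * (p $ 2 - \<i> * p $ 3) / z\<^sup>2"
    using assms(3) by (simp add: field_simps z_def)
  have z: "z \<noteq> 0" using assms(3) by (simp add: z_def)
  have "((X / z)\<^sup>2 + (t\<^sup>2 - 1)) / 2 = X / z\<^sup>2 * p $ 2"
    unfolding 2 X_def using z by (simp add: field_simps power2_eq_square)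
  moreover have "((X / z)\<^sup>2 - (t\<^sup>2 - 1)) / (2 * \<i>) = X / z\<^sup>2 * p $ 3"
    unfolding 2 X_def using z by (simp add: field_simps power2_eq_square)
  moreover have "X / z * t = X / z\<^sup>2 * p $ 1"
    using z unfolding assms(2) z_def[symmetric] by (simp add: field_simps power2_eq_square)
  moreover have "X / z = X / z\<^sup>2 * z" using z by (simp add: power2_eq_square)
  ultimately show ?thesis
    unfolding vec4_eq_iff psi_nth vector_smult_component X_def[symmetric] z_def[symmetric] by blast
qed

text \<open>The two rulings of the quadric: \<open>w - z\<close>, \<open>w + z\<close>,
  \<open>x + i y\<close>, \<open>x - i y\<close> are twice \<open>a c\<close>, \<open>b d\<close>,
  \<open>a d\<close>, \<open>b c\<close>, so the equation of the quadric says that a 2 by 2 matrix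
  has rank at most one.\<close>

definition segre :: "complex \<Rightarrow> complex \<Rightarrow> complex \<Rightarrow> complex \<Rightarrow> complex ^ 4" where
  "segre a b c d = vec4 (a * c + b * d) (a * d + b * c) (- \<i> * (a * d - b * c)) (b * d - a * c)"

lemma lor_segre: "lor (segre a b c d) (segre a b c d) = 0"
  by (simp add: segre_def lor_def algebra_simps)

lemma segre_surj:
  assumes "lor p p = 0"
  shows "\<exists>a b c d. p = segre a b c d"
proof -
  define P Q X Y where "P = p $ 1 - p $ 4" and "Q = p $ 1 + p $ 4"
    and "X = p $ 2 + \<i> * p $ 3" and "Y = p $ 2 - \<i> * p $ 3"
  have pq: "P * Q = X * Y"
    using assms by (simp add: P_def Q_def X_def Y_def lor_def algebra_simps)
  have p: "p = segre a b c d" if "a * c = P / 2" "b * d = Q / 2" "a * d = X / 2" "b * c = Y / 2" for a b c d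
  proof -
    have "p $ 1 = P / 2 + Q / 2" "p $ 2 = X / 2 + Y / 2" "p $ 3 = - \<i> * (X / 2 - Y / 2)" "p $ 4 = Q / 2 - P / 2"
      by (simp_all add: P_def Q_def X_def Y_def field_simps)
    then show ?thesis by (simp add: segre_def vec4_eq_iff flip: that)
  qed
  show ?thesis
  proof (cases "P = 0")
    case False
    then show ?thesis using pq by (intro exI) (rule p[of P "1 / 2" Y "X / (2 * P)"]; simp add: field_simps)
  next
    case P: True
    show ?thesis
    proof (cases "X = 0")
      case True
      then show ?thesis using P by (intro exI) (rule p[of 0 "Y / 2" 1 "Q / 2"]; simp)
    next
      case False
      then show ?thesis using P pq by (intro exI) (rule p[of X 0 Q "1 / 2"]; simp)
    qed
  qed
qed

text \<open>The points \<open>psi t u\<close> miss, even up to scaling, points with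
  \<open>z = 0\<close> or \<open>x + i y = 0\<close>. Such a point is reached as the member
  \<open>s = 0\<close> of a curve on the quadric whose generic member is covered.\<close>

lemma form_zero_on_S:
  assumes f: "form K d f" and z: "\<And>t u. f (psi t u) = 0" and p: "lor p p = 0"
  shows "f p = 0"
proof -
  obtain a b c e where abc: "p = segre a b c e" using segre_surj[OF p] by blast
  \<comment> \<open>The parameter \<open>c\<close> stays fixed. Shifting it as well would cancel the
    \<open>s^2\<close> term of \<open>z\<close>; as it is, \<open>z\<close> and half of
    \<open>x + i y\<close> are monic quadratic polynomials in \<open>s\<close>.\<close>
  define g where "g s = segre (a + s) (b + s) c (e + s)" for s
  have g: "(\<lambda>s. g s $ i) \<in> poly_funs" for i
    using exhaust_4[of i] unfolding g_def segre_def
    by (auto intro!: poly_funs_intros)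
  have v: "f (g s) = 0" if "(a + s) * (e + s) \<noteq> 0" "(b + s) * (e + s) - (a + s) * c \<noteq> 0" for s
  proof -
    have 4: "g s $ 4 \<noteq> 0" using that by (simp add: g_def segre_def)
    have "g s $ 2 + \<i> * g s $ 3 = 2 * ((a + s) * (e + s))"
      by (simp add: g_def segre_def algebra_simps)
    with that have X: "g s $ 2 + \<i> * g s $ 3 \<noteq> 0" by simp
    have "f (psi (g s $ 1 / g s $ 4) ((g s $ 2 + \<i> * g s $ 3) / g s $ 4)) = 0" by (rule z)
    then show ?thesis
      using 4 X by (subst (asm) psi_coordinate) (simp_all add: g_def lor_segre form_scale[OF f])
  qed
  have 1: "\<forall>\<^sub>F s in cofinite. poly [:a * e, a + e, 1:] s \<noteq> 0"
    using poly_roots_finite[of "[:a * e, a + e, 1:]"] by (simp add: eventually_cofinite)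
  have 2: "\<forall>\<^sub>F s in cofinite. poly [:b * e - a * c, b + e - c, 1:] s \<noteq> 0"
    using poly_roots_finite[of "[:b * e - a * c, b + e - c, 1:]"] by (simp add: eventually_cofinite)
  have "\<forall>\<^sub>F s in cofinite. f (g s) = 0"
    using 1 2 by eventually_elim (rule v; simp add: algebra_simps)
  then have "f (g 0) = 0"
    by (intro poly_funs_zero_eventually[of "\<lambda>s. f (g s)"] poly_funs_form[OF f] g)
  then show ?thesis by (simp add: g_def abc)
qed

lemma form_generic:
  assumes f: "form K d f" and p: "p \<in> quadric_S" "f p \<noteq> 0"
  shows "\<forall>\<^sub>F t in cofinite. \<forall>\<^sub>F u in cofinite. f (psi t u) \<noteq> 0"
proof -
  obtain t0 u0 where "f (psi t0 u0) \<noteq> 0"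
    using form_zero_on_S[OF f, of p] p unfolding quadric_S_iff by blast
  then show ?thesis
    by (intro bipoly_generic poly_funs_form[OF f] psi_poly_funs_t psi_poly_funs_u)
qed

lemma eventually2_neq_0: "\<forall>\<^sub>F t in cofinite. \<forall>\<^sub>F u in cofinite. (u :: complex) \<noteq> 0"
  by (simp add: eventually_cofinite_neq)

lemma eventually2_ex:
  "\<forall>\<^sub>F t in cofinite. \<forall>\<^sub>F u in cofinite. P t u \<Longrightarrow> \<exists>t u :: complex. P (t :: complex) u"
  by (meson cofinite_complex_nontriv eventually_happens')

lemma eventually2_conj:
  "\<forall>\<^sub>F t in F. \<forall>\<^sub>F u in G. P t u \<Longrightarrow> \<forall>\<^sub>F t in F. \<forall>\<^sub>F u in G. Q t u \<Longrightarrow>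
    \<forall>\<^sub>F t in F. \<forall>\<^sub>F u in G. P t u \<and> Q t u"
  by (simp add: eventually_conj_iff)

lemma S_irreducible:
  assumes "form K d f" "form K' e g" "p \<in> quadric_S" "f p \<noteq> 0" "q \<in> quadric_S" "g q \<noteq> 0"
  shows "\<exists>x\<in>quadric_S. f x \<noteq> 0 \<and> g x \<noteq> 0"
proof -
  have "\<exists>t u. (f (psi t u) \<noteq> 0 \<and> g (psi t u) \<noteq> 0) \<and> u \<noteq> 0"
    by (intro eventually2_ex eventually2_conj form_generic[OF assms(1,3,4)] form_generic[OF assms(2,5,6)] eventually2_neq_0)
  then show ?thesis using psi_in_S by blast
qed

text \<open>The fibre over \<open>(t : 1)\<close>, base-points included. The fibre over infinity is never needed.\<close>

definition fibre :: "complex \<Rightarrow> (complex ^ 4) set" where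
  "fibre t = {p. p \<noteq> 0 \<and> lor p p = 0 \<and> p $ 1 = t * p $ 4}"

lemma fibre_subset: "fibre t \<subseteq> quadric_S"
  by (auto simp: fibre_def quadric_S_iff)

lemma psi_in_fibre: "u \<noteq> 0 \<Longrightarrow> psi t u \<in> fibre t"
  by (simp add: fibre_def lor_psi psi_nonzero)

lemma conic_eq_fibre:
  assumes "z $ 2 \<noteq> 0"
  shows "conic z = fibre (z $ 1 / z $ 2)"
  using assms by (auto simp: conic_def fibre_def quadric_S_iff field_simps)

lemma fibre_scale: "c \<noteq> 0 \<Longrightarrow> c *s p \<in> fibre t \<longleftrightarrow> p \<in> fibre t"
  by (auto simp: fibre_def)

text \<open>Up to scaling, \<open>psi t\<close> reaches every point with
  \<open>z \<noteq> 0\<close>. The base-point with \<open>x + i y = 0\<close> is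
  \<open>psi t 0\<close>, and the other one is the limit for \<open>u\<close> tending to
  infinity.\<close>

lemma form_zero_on_fibre:
  assumes f: "form K d f" and z: "\<exists>\<^sub>F u in cofinite. f (psi t u) = 0" 
    and p: "p \<in> fibre t" and t: "t\<^sup>2 \<noteq> 1"
  shows "f p = 0"
proof -
  have z: "f (psi t u) = 0" for u
    using poly_funs_zero[OF poly_funs_form[OF f psi_poly_funs_u] z] .
  have p': "p \<noteq> 0" "lor p p = 0" "p $ 1 = t * p $ 4" using p by (auto simp: fibre_def)
  define X Y where "X = p $ 2 + \<i> * p $ 3" and "Y = p $ 2 - \<i> * p $ 3"
  have XY: "X * Y = (t\<^sup>2 - 1) * (p $ 4)\<^sup>2"
    using p'(2,3) by (simp add: lor_def X_def Y_def power2_eq_square algebra_simps)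
  show ?thesis
  proof (cases "p $ 4 = 0")
    case False
    then have "X \<noteq> 0" using XY t by auto
    moreover have "f (psi t ((p $ 2 + \<i> * p $ 3) / p $ 4)) = 0" by (rule z)
    ultimately show ?thesis
      using p' False by (subst (asm) psi_coordinate) (simp_all add: form_scale[OF f] X_def)
  next
    case 4: True
    show ?thesis
    proof (cases "X = 0")
      case True
      then have "p $ 2 = - (\<i> * p $ 3)" by (simp add: X_def add_eq_0_iff2)
      then have "psi t 0 = ((t\<^sup>2 - 1) / (2 * p $ 2)) *s p" "p $ 2 \<noteq> 0"
        using 4 p' by (auto simp: vec4_eq_iff field_simps)
      moreover have "f (psi t 0) = 0" by (rule z)
      ultimately show ?thesis using t by (simp add: form_scale[OF f])
    next
      case False
      then have "Y = 0" using XY 4 by simp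
      then have Y: "p $ 2 = \<i> * p $ 3" by (simp add: Y_def)
      then have 3: "p $ 3 \<noteq> 0" using 4 p' by (auto simp: vec4_eq_iff)
      \<comment> \<open>The parametrization near \<open>u = infinity\<close> in the coordinate
        \<open>r = 1 / u\<close>, with denominators cleared.\<close>
      define h where "h r = vec4 (r * t) ((1 + (t\<^sup>2 - 1) * r\<^sup>2) / 2) ((1 - (t\<^sup>2 - 1) * r\<^sup>2) / (2 * \<i>)) r" for r
      have h: "(\<lambda>r. h r $ i) \<in> poly_funs" for i
        using exhaust_4[of i] unfolding h_def
        by (auto intro!: poly_funs_intros)
      have hr: "h r = (r\<^sup>2) *s psi t (1 / r)" if "r \<noteq> 0" for r
        using that by (simp add: h_def vec4_eq_iff field_simps power2_eq_square)
      have "\<forall>\<^sub>F r in cofinite. f (h r) = 0"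
        using eventually_cofinite_neq[of 0] by eventually_elim (simp add: hr form_scale[OF f] z)
      then have "f (h 0) = 0"
        by (intro poly_funs_zero_eventually[of "\<lambda>r. f (h r)"] poly_funs_form[OF f] h)
      moreover have "h 0 = (1 / (2 * p $ 2)) *s p"
        using 4 p' Y 3 by (simp add: h_def vec4_eq_iff field_simps)
      ultimately show ?thesis using Y 3 by (simp add: form_scale[OF f])
    qed
  qed
qed

lemma fibre_generic:
  assumes "form K d f" "p \<in> fibre t" "t\<^sup>2 \<noteq> 1" "f p \<noteq> 0"
  shows "\<forall>\<^sub>F u in cofinite. f (psi t u) \<noteq> 0"
proof (rule ccontr)
  assume "\<not> ?thesis"
  then have "\<exists>\<^sub>F u in cofinite. f (psi t u) = 0" by (simp add: not_eventually)
  then show False using form_zero_on_fibre[OF assms(1) _ assms(2,3)] assms(4) by blast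
qed

lemma eventually_delta_neq_0: "\<forall>\<^sub>F t in cofinite. (t :: complex)\<^sup>2 \<noteq> 1"
proof -
  have "(\<lambda>t :: complex. t\<^sup>2 - 1) \<in> poly_funs" by (auto intro!: poly_funs_intros)
  from poly_funs_generic[OF this, of 0] show ?thesis by simp
qed

section \<open>Birational self-maps of a fibre\<close>

lemma coprime_poly_no_common_root:
  fixes p q :: "complex poly"
  assumes "coprime p q" "poly p r = 0" "poly q r = 0"
  shows False
proof -
  have "[:- r, 1:] dvd 1"
    using assms by (metis coprime_common_divisor poly_eq_0_iff_dvd)
  then show False by (simp add: is_unit_pCons_iff)
qed

text \<open>
  A generic fibre \<open>p = c q\<close> of a rational function consists of \<open>max (degree p) (degree q)\<close> distinct
  points, because the multiple points are zeros of the Wronskian.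
\<close>

lemma injective_rational_function_moebius:
  fixes P Q :: "complex poly"
  assumes "finite B" and Q: "Q \<noteq> 0"
    and inj: "\<And>x y. x \<notin> B \<Longrightarrow> y \<notin> B \<Longrightarrow> poly Q x \<noteq> 0 \<Longrightarrow> poly Q y \<noteq> 0 \<Longrightarrow>
      poly P x / poly Q x = poly P y / poly Q y \<Longrightarrow> x = y"
  shows "\<exists>a b c d. a * d - b * c \<noteq> 0 \<and> P * [:d, c:] = Q * [:b, a:]"
proof -
  define g where "g = gcd P Q"
  define p where "p = P div g"
  define q where "q = Q div g"
  have g0: "g \<noteq> 0" using Q by (simp add: g_def)
  have P: "P = g * p" and Q': "Q = g * q" by (simp_all add: p_def q_def g_def)
  have cop: "coprime p q" unfolding p_def q_def g_def using Q by (intro div_gcd_coprime) auto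
  have q0: "q \<noteq> 0" using Q Q' by auto
  define B' where "B' = B \<union> {x. poly Q x = 0}"
  have B': "finite B'" using assms(1) poly_roots_finite[OF Q] by (simp add: B'_def)
  have inj': "x = y" if "x \<notin> B'" "y \<notin> B'" "poly p x / poly q x = poly p y / poly q y" for x y
  proof (rule inj)
    have "poly P x / poly Q x = poly p x / poly q x" if "poly Q x \<noteq> 0" for x
      using that by (simp add: P Q')
    with that show "poly P x / poly Q x = poly P y / poly Q y" by (simp add: B'_def)
  qed (use that in \<open>auto simp: B'_def\<close>)
  define W where "W = pderiv p * q - p * pderiv q"
  have W: "W \<noteq> 0"
  proof
    assume "W = 0"
    then have w: "pderiv p * q = p * pderiv q" by (simp add: W_def)
    \<comment> \<open>By coprimality each of \<open>p\<close> and \<open>q\<close> divides its own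
      derivative and is constant, but a constant function takes the same value at two
      points.\<close>
    then have "q dvd p * pderiv q" "p dvd pderiv p * q" by (metis dvd_triv_right, metis dvd_triv_left)
    then have d: "q dvd pderiv q" "p dvd pderiv p"
      using cop by (simp_all add: coprime_dvd_mult_right_iff coprime_dvd_mult_left_iff coprime_commute)
    have const: "degree r = 0" if "r dvd pderiv r" for r :: "complex poly"
      using that dvd_imp_degree_le[of r "pderiv r"] by (cases "pderiv r = 0") (auto simp: degree_pderiv pderiv_eq_0_iff)
    obtain k l where kl: "p = [:k:]" "q = [:l:]" using const[OF d(1)] const[OF d(2)] by (metis degree_eq_zeroE)
    obtain x where x: "x \<notin> B'" using ex_new_if_finite[OF infinite_UNIV_char_0 B'] by blast
    obtain y where y: "y \<notin> insert x B'" 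
      using ex_new_if_finite[OF infinite_UNIV_char_0, of "insert x B'"] B' by blast
    show False using inj'[of x y] x y kl by auto
  qed
  define m where "m = max (degree p) (degree q)"
  \<comment> \<open>The excluded values are the value at infinity, so that \<open>p - k q\<close>
    keeps the degree \<open>m\<close>, the values at bad points, and the critical values.\<close>
  define C where "C = insert (coeff p m / coeff q m) ((\<lambda>r. poly p r / poly q r) ` (B' \<union> {r. poly W r = 0}))"
  have "finite C" using B' poly_roots_finite[OF W] by (simp add: C_def)
  then obtain k where k: "k \<notin> C" using ex_new_if_finite[OF infinite_UNIV_char_0] by blast
  define f where "f = p - smult k q"
  have "degree f = m"
  proof (rule antisym)
    show "degree f \<le> m" unfolding f_def m_def by (rule degree_diff_le) auto
    have pq: "coeff p m \<noteq> 0 \<or> coeff q m \<noteq> 0"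
      unfolding m_def max_def using cop q0 by auto
    have "coeff f m \<noteq> 0"
    proof
      assume "coeff f m = 0"
      then have e: "coeff p m = k * coeff q m" by (simp add: f_def)
      with pq have "k = coeff p m / coeff q m" by auto
      then show False using k by (simp add: C_def)
    qed
    then show "m \<le> degree f" by (rule le_degree)
  qed
  have root: "r \<notin> B' \<and> poly p r / poly q r = k \<and> poly (pderiv f) r \<noteq> 0" if r: "poly f r = 0" for r
  proof -
    have e: "poly p r = k * poly q r" using r by (simp add: f_def)
    then have qr: "poly q r \<noteq> 0" using coprime_poly_no_common_root[OF cop] by auto
    then have kr: "poly p r / poly q r = k" using e by simp
    then have "r \<notin> B'" "poly W r \<noteq> 0" using k by (auto simp: C_def)
    moreover have "poly W r = poly q r * poly (pderiv f) r"
      by (simp add: W_def f_def pderiv_diff pderiv_smult e algebra_simps)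
    ultimately show ?thesis using kr by auto
  qed
  have "m \<le> 1"
  proof (rule ccontr)
    assume "\<not> m \<le> 1"
    then have df: "degree f > 1" using \<open>degree f = m\<close> by simp
    then obtain r where r: "poly f r = 0"
      using fundamental_theorem_of_algebra_alt[of f] by (metis degree_pCons_0 not_one_less_zero)
    then obtain h where h: "f = [:- r, 1:] * h" by (auto simp: poly_eq_0_iff_dvd dvd_def)
    have "h \<noteq> 0" using df h by auto
    then have "degree h > 0" using df unfolding h by (subst (asm) degree_mult_eq) auto
    then obtain r' where r': "poly h r' = 0"
      using fundamental_theorem_of_algebra_alt[of h] by (metis degree_pCons_0 less_irrefl)
    then have "poly f r' = 0" by (simp add: h)
    \<comment> \<open>Injectivity merges the two roots into a double root, which the choice of
      \<open>k\<close> as a noncritical value forbids.\<close>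
    then have "r' = r" using root[OF r] root[of r'] inj' by metis
    then have "poly (pderiv f) r = 0" using r' unfolding h pderiv_mult poly_add poly_mult by simp
    then show False using root[OF r] by blast
  qed
  then have "degree p \<le> 1" "degree q \<le> 1" by (auto simp: m_def)
  moreover have "r = [:coeff r 0, coeff r 1:]" if "degree r \<le> 1" for r :: "complex poly"
    using that by (intro poly_eqI) (auto simp: coeff_pCons coeff_eq_0 split: nat.split)
  ultimately obtain a b c d where ab: "p = [:b, a:]" "q = [:d, c:]" by metis
  have "a * d - b * c \<noteq> 0"
  proof
    assume "a * d - b * c = 0"
    then have "W = 0" by (simp add: W_def ab pderiv_pCons algebra_simps)
    with W show False by blast
  qed
  moreover have "P * [:d, c:] = Q * [:b, a:]" unfolding P Q' ab[symmetric] by simp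
  ultimately show ?thesis by blast
qed

text \<open>A 2 by 2 matrix whose square is scalar is itself scalar or has trace zero. The
  polynomial \<open>?p\<close> is the trace \<open>a + d\<close> times the quadratic polynomial of
  the fixed points, so if the trace is nonzero, the map is the identity.\<close>

lemma involutive_moebius_trace:
  fixes a b c d :: complex
  assumes nt: "\<exists>\<^sub>F u in cofinite. f u \<noteq> u" and det: "a * d - b * c \<noteq> 0"
    and f: "\<forall>\<^sub>F u in cofinite. f u * (c * u + d) = a * u + b \<and> u * (c * f u + d) = a * f u + b"
  shows "d = - a"
proof -
  let ?p = "[:b * (a + d), (a + d) * (a - d), - (c * (a + d)):]"
  have "\<forall>\<^sub>F u in cofinite. poly ?p u = 0"
    using f
  proof eventually_elim
    case (elim u)
    have "poly ?p u = (a * f u + b - u * (c * f u + d)) * (c * u + d) - (a - u * c) * (f u * (c * u + d) - (a * u + b))"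
      by (simp add: algebra_simps)
    with elim show ?case by simp
  qed
  then have "poly ?p x = 0" for x by (rule poly_funs_zero_eventually[OF poly_funs_poly])
  then have "?p = 0" by (metis poly_all_0_iff_0)
  then have e: "b * (a + d) = 0" "(a + d) * (a - d) = 0" "c * (a + d) = 0" by auto
  show ?thesis
  proof (cases "a + d = 0")
    case True then show ?thesis by (simp add: add_eq_0_iff)
  next
    case False
    then have bc: "b = 0" "c = 0" "a = d" using e by auto
    then have "d \<noteq> 0" using det by auto
    have "\<forall>\<^sub>F u in cofinite. f u = u"
      using f by eventually_elim (use bc \<open>d \<noteq> 0\<close> in auto)
    then show ?thesis using nt by (simp add: frequently_def)
  qed
qed

text \<open>The kernel vector is a cross product of two of the covectors, unless these are all proportional.\<close>

lemma polynomial_kernel_vector: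
  fixes l1 l2 l3 :: "complex \<Rightarrow> complex \<Rightarrow> complex"
  assumes l: "\<And>u. (\<lambda>t. l1 t u) \<in> poly_funs" "\<And>u. (\<lambda>t. l2 t u) \<in> poly_funs" "\<And>u. (\<lambda>t. l3 t u) \<in> poly_funs"
    and ker: "\<forall>\<^sub>F t in cofinite. \<exists>a b c. (a, b, c) \<noteq> (0, 0, 0) \<and> (\<forall>u. l1 t u * a + l2 t u * b + l3 t u * c = 0)"
  shows "\<exists>p q r. (p, q, r) \<noteq> (0, 0, 0) \<and>
    (\<forall>t u. l1 t u * poly p t + l2 t u * poly q t + l3 t u * poly r t = 0)"
proof -
  note rules = poly_funs_intros l
  have fin: ?thesis if h: "h1 \<in> poly_funs" "h2 \<in> poly_funs" "h3 \<in> poly_funs"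
    and nz: "(h1 t0, h2 t0, h3 t0) \<noteq> (0, 0, 0)"
    and z: "\<And>t u. l1 t u * h1 t + l2 t u * h2 t + l3 t u * h3 t = 0" for h1 h2 h3 t0
  proof -
    obtain p q r where "h1 = poly p" "h2 = poly q" "h3 = poly r"
      using h by (auto simp: poly_funs_def)
    then show ?thesis using nz z by (intro exI[of _ p] exI[of _ q] exI[of _ r]) auto
  qed
  \<comment> \<open>The triple product of the covectors at \<open>u\<close>, \<open>x\<close> and
    \<open>y\<close>: it vanishes wherever the three have a common nonzero kernel vector.\<close>
  let ?d = "\<lambda>t u x y. l1 t u * (l2 t x * l3 t y - l3 t x * l2 t y) + l2 t u * (l3 t x * l1 t y - l1 t x * l3 t y)
      + l3 t u * (l1 t x * l2 t y - l2 t x * l1 t y)"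
  have det: "?d t u x y = 0" for t u x y
  proof (rule poly_funs_zero_eventually[of "\<lambda>t. ?d t u x y"])
    show "\<forall>\<^sub>F t in cofinite. ?d t u x y = 0"
      using ker
    proof eventually_elim
      case (elim t)
      then obtain a b c where nz: "(a, b, c) \<noteq> (0, 0, 0)"
        and z: "\<And>u. l1 t u * a + l2 t u * b + l3 t u * c = 0" by auto
      have "a * ?d t u x y = 0" "b * ?d t u x y = 0" "c * ?d t u x y = 0"
        using z[of u] z[of x] z[of y] by algebra+
      then show ?case using nz by auto
    qed
  qed (intro rules)
  show ?thesis
  proof (cases "\<exists>t x y. (l2 t x * l3 t y - l3 t x * l2 t y, l3 t x * l1 t y - l1 t x * l3 t y,
      l1 t x * l2 t y - l2 t x * l1 t y) \<noteq> (0, 0, 0)")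
    case True
    then obtain t x y where "(l2 t x * l3 t y - l3 t x * l2 t y, l3 t x * l1 t y - l1 t x * l3 t y,
      l1 t x * l2 t y - l2 t x * l1 t y) \<noteq> (0, 0, 0)" by blast
    then show ?thesis
      by (intro fin[of "\<lambda>t. l2 t x * l3 t y - l3 t x * l2 t y" "\<lambda>t. l3 t x * l1 t y - l1 t x * l3 t y"
        "\<lambda>t. l1 t x * l2 t y - l2 t x * l1 t y" t] rules det)
  next
    case False
    then have z: "l2 t x * l3 t y = l3 t x * l2 t y" "l3 t x * l1 t y = l1 t x * l3 t y"
      "l1 t x * l2 t y = l2 t x * l1 t y" for t x y by auto
    show ?thesis
    proof (cases "\<forall>t u. l1 t u = 0 \<and> l2 t u = 0 \<and> l3 t u = 0")
      case True
      then show ?thesis by (intro exI[of _ 1]) auto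
    next
      case False
      then obtain t0 u0 where nz: "(l1 t0 u0, l2 t0 u0, l3 t0 u0) \<noteq> (0, 0, 0)" by blast
      show ?thesis
      proof (cases "l2 t0 u0 = 0 \<and> l1 t0 u0 = 0")
        case False
        then show ?thesis
          by (intro fin[of "\<lambda>t. l2 t u0" "\<lambda>t. - l1 t u0" "\<lambda>_. 0" t0] rules) (auto simp: z)
      next
        case True
        then show ?thesis using nz
          by (intro fin[of "\<lambda>t. l3 t u0" "\<lambda>_. 0" "\<lambda>t. - l1 t u0" t0] rules) (auto simp: z)
      qed
    qed
  qed
qed

section \<open>Elements of \<open>Bir_S_pi\<close> on a single fibre\<close>

lemma rat_self_mapD:
  assumes "rat_self_map_S A"
  obtains d where "\<And>i. form \<real> d (\<lambda>v. A v $ i)"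
  using assms by (auto simp: rat_self_map_S_def form_map_def)

lemma form_map_degree:
  assumes "F \<in> Bir_S_pi"
  obtains d where "\<And>i. form \<real> d (\<lambda>v. F v $ i)"
  using assms rat_self_mapD unfolding Bir_S_pi_def by blast

lemma Bir_nonzero:
  assumes "F \<in> Bir_S_pi"
  shows "\<exists>p\<in>quadric_S. F p \<noteq> 0"
  using assms by (auto simp: Bir_S_pi_def rat_self_map_S_def)

lemma rat_self_map_quadric:
  assumes "rat_self_map_S A" "p \<in> quadric_S"
  shows "lor (A p) (A p) = 0"
  using assms by (cases "A p = 0") (auto simp: rat_self_map_S_def quadric_S_iff)

lemma Bir_S_pi_first:
  assumes "A \<in> Bir_S_pi" "p \<in> quadric_S"
  shows "A p $ 1 * p $ 4 = A p $ 4 * p $ 1"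
proof -
  have "par (pi_S (A p)) (pi_S p)" using assms by (auto simp: Bir_S_pi_def rat_eq_iff_par)
  from this[unfolded par_def, rule_format, of 1 2] show ?thesis by simp
qed

text \<open>The relation \<open>pi A = pi\<close> gives no information at the base-points, where
  \<open>pi_S\<close> vanishes. There the equation \<open>w = t z\<close> of the image follows by
  density in the fibre.\<close>

lemma Bir_S_pi_fibre:
  assumes A: "A \<in> Bir_S_pi" and t: "t\<^sup>2 \<noteq> 1" and p: "p \<in> fibre t" "A p \<noteq> 0"
  shows "A p \<in> fibre t"
proof -
  have s: "rat_self_map_S A" using A by (simp add: Bir_S_pi_def)
  then obtain d where d: "\<And>i. form \<real> d (\<lambda>v. A v $ i)" by (rule rat_self_mapD) blast
  have "form UNIV d (\<lambda>v. A v $ 1 - t * A v $ 4)"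
    by (intro form_diff form_cmul form_mono[OF d]) auto
  moreover have "\<forall>\<^sub>F u in cofinite. A (psi t u) $ 1 - t * A (psi t u) $ 4 = 0"
    using eventually_cofinite_neq[of 0]
  proof eventually_elim
    case (elim u)
    then show ?case using Bir_S_pi_first[OF A psi_in_S[OF elim, of t]] by simp
  qed
  ultimately have "A p $ 1 - t * A p $ 4 = 0"
    by (rule form_zero_on_fibre[OF _ eventually_frequently[OF cofinite_complex_nontriv] p(1) t])
  moreover have "lor (A p) (A p) = 0"
    using rat_self_map_quadric[OF s] p fibre_subset by blast
  ultimately show ?thesis using p(2) by (simp add: fibre_def)
qed

text \<open>Otherwise the whole quadric would be mapped into the fibre over \<open>(1 : 0)\<close>,
  against \<open>pi A = pi\<close>.\<close>

lemma Bir_S_pi_fourth_nonzero: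
  assumes A: "A \<in> Bir_S_pi"
  shows "\<exists>p\<in>quadric_S. A p $ 4 \<noteq> 0"
proof (rule ccontr)
  assume "\<not> ?thesis"
  then have 4: "A p $ 4 = 0" if "p \<in> quadric_S" for p using that by blast
  obtain p where p: "p \<in> quadric_S" "pi_S (A p) \<noteq> 0" using A by (auto simp: Bir_S_pi_def rat_eq_iff_par)
  then have 1: "A p $ 1 \<noteq> 0" using 4 by (auto simp: vec_eq_iff forall_2)
  obtain d where d: "\<And>i. form \<real> d (\<lambda>v. A v $ i)"
    using A rat_self_mapD by (auto simp: Bir_S_pi_def)
  obtain x where x: "x \<in> quadric_S" "A x $ 1 \<noteq> 0" "x $ 4 \<noteq> 0"
    using S_irreducible[OF d[of 1] form_coord[OF coeff_ring_UNIV, of 4] p(1) 1 psi_in_S[of 1 0]] by auto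
  then show False using Bir_S_pi_first[OF A x(1)] 4[OF x(1)] by simp
qed

text \<open>The map induced by \<open>A\<close> on the coordinate \<open>u\<close> of
  \<open>psi\<close>. It is meaningful where the image has \<open>z \<noteq> 0\<close>.\<close>

definition fibre_coord :: "(complex ^ 4 \<Rightarrow> complex ^ 4) \<Rightarrow> complex \<Rightarrow> complex \<Rightarrow> complex" where
  "fibre_coord A t u = (A (psi t u) $ 2 + \<i> * A (psi t u) $ 3) / A (psi t u) $ 4"

lemma psi_fibre_coord:
  assumes "A \<in> Bir_S_pi" "t\<^sup>2 \<noteq> 1" "u \<noteq> 0" "A (psi t u) $ 4 \<noteq> 0"
  shows "\<exists>c. c \<noteq> 0 \<and> psi t (fibre_coord A t u) = c *s A (psi t u)"
    and "fibre_coord A t u \<noteq> 0"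
proof -
  let ?q = "A (psi t u)"
  have "?q \<noteq> 0" using assms(4) by (metis zero_index)
  then have q: "?q \<in> fibre t" by (rule Bir_S_pi_fibre[OF assms(1,2) psi_in_fibre[OF assms(3)]])
  have "(?q $ 2 + \<i> * ?q $ 3) * (?q $ 2 - \<i> * ?q $ 3) = (t\<^sup>2 - 1) * (?q $ 4)\<^sup>2"
    using q by (simp add: fibre_def lor_def power2_eq_square algebra_simps)
  then have "?q $ 2 + \<i> * ?q $ 3 \<noteq> 0" using assms(2,4) by auto
  moreover have "lor ?q ?q = 0" "?q $ 1 = t * ?q $ 4" using q by (simp_all add: fibre_def)
  from psi_coordinate[OF this assms(4)]
  have "psi t (fibre_coord A t u) = ((?q $ 2 + \<i> * ?q $ 3) / (?q $ 4)\<^sup>2) *s ?q"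
    unfolding fibre_coord_def .
  moreover have "(?q $ 2 + \<i> * ?q $ 3) / (?q $ 4)\<^sup>2 \<noteq> 0" if "?q $ 2 + \<i> * ?q $ 3 \<noteq> 0"
    using that assms(4) by simp
  ultimately show "\<exists>c. c \<noteq> 0 \<and> psi t (fibre_coord A t u) = c *s A (psi t u)" "fibre_coord A t u \<noteq> 0"
    using assms(4) unfolding fibre_coord_def by (blast, simp)
qed

lemma par_psi_imp_eq:
  assumes "par (psi t u) (psi t u')" "u \<noteq> 0" "u' \<noteq> 0"
  shows "u = u'"
proof -
  let ?X = "\<lambda>u. psi t u $ 2 + \<i> * psi t u $ 3"
  have X: "?X v = v\<^sup>2" for v by (simp add: field_simps)
  have "psi t u $ 2 * psi t u' $ 4 = psi t u $ 4 * psi t u' $ 2"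
    "psi t u $ 3 * psi t u' $ 4 = psi t u $ 4 * psi t u' $ 3"
    using assms(1) by (auto simp only: par_def)
  then have "?X u * psi t u' $ 4 = psi t u $ 4 * ?X u'" by algebra
  then have "u\<^sup>2 * u' = u * u'\<^sup>2" unfolding X by simp
  then show ?thesis using assms(2,3) by (simp add: power2_eq_square)
qed

text \<open>Because \<open>A\<close> is its own inverse, the induced map of the coordinate
  \<open>u\<close> is injective outside a finite set; being rational it is a Moebius map, and as a
  nontrivial involution it has trace zero. Hence the matrix with rows \<open>a, b\<close> and
  \<open>c, - a\<close>. The equation is cleared of denominators so that it holds for every
  \<open>u\<close>.\<close>

lemma involution_fibre_moebius:
  assumes A: "A \<in> Bir_S_pi" and A2: "\<And>p. p \<in> quadric_S \<Longrightarrow> par (A (A p)) p"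
    and t: "t\<^sup>2 \<noteq> 1" and good: "\<forall>\<^sub>F u in cofinite. A (psi t u) $ 4 \<noteq> 0"
      "\<forall>\<^sub>F u in cofinite. A (A (psi t u)) \<noteq> 0" "\<forall>\<^sub>F u in cofinite. \<not> par (A (psi t u)) (psi t u)"
  shows "\<exists>a b c. (a, b, c) \<noteq> (0, 0, 0) \<and>
    (\<forall>u. (A (psi t u) $ 2 + \<i> * A (psi t u) $ 3) * (c * u - a) = A (psi t u) $ 4 * (a * u + b))"
proof -
  obtain d where d: "\<And>i. form \<real> d (\<lambda>v. A v $ i)" using form_map_degree[OF A] by metis
  have comp: "(\<lambda>u. A (psi t u) $ i) \<in> poly_funs" for i
    by (intro poly_funs_form[OF d] psi_poly_funs_u)
  obtain P where P: "\<And>u. A (psi t u) $ 2 + \<i> * A (psi t u) $ 3 = poly P u"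
    using poly_funs_add[OF comp[of 2] poly_funs_mult[OF poly_funs_const[of \<i>] comp[of 3]]]
    by (auto simp: poly_funs_def fun_eq_iff)
  obtain Q where Q: "\<And>u. A (psi t u) $ 4 = poly Q u"
    using comp[of 4] by (auto simp: poly_funs_def fun_eq_iff)
  define f where "f = fibre_coord A t"
  have f: "f u = poly P u / poly Q u" for u by (simp add: f_def fibre_coord_def P Q)
  define B where "B = {u. \<not> (A (psi t u) $ 4 \<noteq> 0 \<and> A (A (psi t u)) \<noteq> 0 \<and> u \<noteq> 0)}"
  have B: "finite B" unfolding B_def eventually_cofinite[symmetric]
    using good eventually_cofinite_neq[of 0] by (simp add: eventually_conj_iff)
  have fpsi: "\<exists>c. c \<noteq> 0 \<and> psi t (f u) = c *s A (psi t u)" "f u \<noteq> 0" if "u \<notin> B" for u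
    using psi_fibre_coord[OF A t, of u] that by (auto simp: B_def f_def)
  have Apsi: "par (A (psi t (f u))) (psi t u) \<and> A (psi t (f u)) \<noteq> 0" if u: "u \<notin> B" for u
  proof -
    obtain c where c: "c \<noteq> 0" "psi t (f u) = c *s A (psi t u)" using fpsi(1)[OF u] by blast
    have "A (psi t (f u)) = c ^ d *s A (A (psi t u))"
      unfolding c(2) by (simp add: vec_eq_iff form_scale[OF d])
    moreover have "A (A (psi t u)) \<noteq> 0" "u \<noteq> 0" using u by (auto simp: B_def)
    ultimately show ?thesis using c A2[OF psi_in_S] by (auto intro: par_scale_left)
  qed
  have inj: "x = y" if "x \<notin> B" "y \<notin> B" "f x = f y" for x y
  proof (rule par_psi_imp_eq)
    show "par (psi t x) (psi t y)"
      using Apsi[OF that(1)] Apsi[OF that(2)] that(3) by (metis par_sym par_trans)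
  qed (use that in \<open>auto simp: B_def\<close>)
  have "Q \<noteq> 0"
  proof
    assume "Q = 0"
    then have "UNIV = B" by (auto simp: B_def Q)
    then show False using B infinite_UNIV_char_0 by metis
  qed
  then obtain a b c e where det: "a * e - b * c \<noteq> 0" and PQ: "P * [:e, c:] = Q * [:b, a:]"
    using injective_rational_function_moebius[OF B, of Q P] inj by (auto simp: f)
  have pq: "poly P u * (c * u + e) = poly Q u * (a * u + b)" for u
    using arg_cong[OF PQ, of "\<lambda>p. poly p u"] by (simp add: algebra_simps)
  have mob: "f u * (c * u + e) = a * u + b" if "u \<notin> B" for u
    using pq[of u] that by (simp add: f B_def Q field_simps)
  have "e = - a"
  proof (rule involutive_moebius_trace[of f])
    show "\<exists>\<^sub>F u in cofinite. f u \<noteq> u"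
    proof (rule eventually_frequently)
      have "\<forall>\<^sub>F u in cofinite. u \<notin> B" using B by (simp add: eventually_cofinite)
      then show "\<forall>\<^sub>F u in cofinite. f u \<noteq> u" using good(3)
      proof eventually_elim
        case (elim u)
        obtain c where "psi t (f u) = c *s A (psi t u)" using fpsi(1)[OF elim(1)] by blast
        then have "par (A (psi t u)) (psi t (f u))" by (simp add: par_scale_right)
        then show ?case using elim(2) by metis
      qed
    qed (rule cofinite_complex_nontriv)
    \<comment> \<open>By injectivity only finitely many good points are sent to bad ones, so the
      Moebius equation is also available at \<open>f u\<close> for generic \<open>u\<close>.\<close>
    have "finite {u. u \<notin> B \<and> f u \<in> B}"
    proof (rule finite_imageD)
      show "finite (f ` {u. u \<notin> B \<and> f u \<in> B})" by (rule finite_subset[OF _ B]) auto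
      show "inj_on f {u. u \<notin> B \<and> f u \<in> B}" by (auto intro!: inj_onI inj)
    qed
    with B have "\<forall>\<^sub>F u in cofinite. u \<notin> B \<and> f u \<notin> B" 
      unfolding eventually_cofinite by (rule_tac finite_subset[of _ "B \<union> {u. u \<notin> B \<and> f u \<in> B}"]) auto
    then show "\<forall>\<^sub>F u in cofinite. f u * (c * u + e) = a * u + b \<and> u * (c * f u + e) = a * f u + b"
    proof eventually_elim
      case (elim u)
      have "f (f u) = u"
      proof (rule par_psi_imp_eq)
        obtain k where "psi t (f (f u)) = k *s A (psi t (f u))" using fpsi(1)[of "f u"] elim by blast
        then show "par (psi t (f (f u))) (psi t u)" using Apsi[of u] elim by (simp add: par_scale_left)
        show "f (f u) \<noteq> 0" "u \<noteq> 0" using fpsi(2)[of "f u"] elim by (auto simp: B_def)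
      qed
      then show ?case using mob[of u] mob[of "f u"] elim by simp
    qed
  qed (rule det)
  then show ?thesis using pq det
    by (intro exI[of _ a] exI[of _ b] exI[of _ c]) (auto simp: P Q)
qed

text \<open>In the plane \<open>w = t z\<close> the coordinate \<open>w\<close> is redundant, so
  this determinant tests the collinearity of three points of the plane of a fibre.\<close>

definition det3 :: "complex ^ 4 \<Rightarrow> complex ^ 4 \<Rightarrow> complex ^ 4 \<Rightarrow> complex" where
  "det3 x y v = x $ 2 * (y $ 3 * v $ 4 - y $ 4 * v $ 3) - x $ 3 * (y $ 2 * v $ 4 - y $ 4 * v $ 2)
     + x $ 4 * (y $ 2 * v $ 3 - y $ 3 * v $ 2)"

text \<open>\<open>half_turn v\<close> maps a point \<open>x\<close> of the conic to the second intersection with the line through \<open>x\<close> and \<open>v\<close>.\<close>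

lemma collinear_half_turn:
  assumes "lor x x = 0" "lor y y = 0" "det3 x y v = 0" "x \<noteq> 0"
    and t: "x $ 1 = t * x $ 4" "y $ 1 = t * y $ 4" "v $ 1 = t * v $ 4"
    and np: "\<not> par x y"
  shows "par y (half_turn v x)"
proof -
  have span: "par y (half_turn v x)" if "m \<noteq> 0" "m *s v = a *s x + b *s y" for m a b
  proof -
    have "half_turn (m *s v) x = (2 * b * b * lor x y) *s y"
      unfolding that(2) half_turn_def using assms(1,2)
      by (simp add: vec4_eq_iff lor_commute algebra_simps)
    then have "(m\<^sup>2) *s half_turn v x = (2 * b * b * lor x y) *s y" by (simp add: half_turn_scale_axis)
    moreover have "par y ((2 * b * b * lor x y) *s y)" by (intro par_scale_right) simp
    ultimately show ?thesis using that(1) by (metis par_scale_right_iff power_not_zero)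
  qed
  have d: "x $ 2 * (y $ 3 * v $ 4 - y $ 4 * v $ 3) - x $ 3 * (y $ 2 * v $ 4 - y $ 4 * v $ 2)
     + x $ 4 * (y $ 2 * v $ 3 - y $ 3 * v $ 2) = 0" using assms(3) by (simp add: det3_def)
  \<comment> \<open>Cramer's rule for a nonzero minor of \<open>x\<close> and \<open>y\<close>
    expresses a multiple of \<open>v\<close> by \<open>x\<close> and \<open>y\<close>.\<close>
  consider "x $ 2 * y $ 3 - x $ 3 * y $ 2 \<noteq> 0" | "x $ 2 * y $ 4 - x $ 4 * y $ 2 \<noteq> 0"
    | "x $ 3 * y $ 4 - x $ 4 * y $ 3 \<noteq> 0"
    using np t by (auto simp: par_def forall_4 algebra_simps)
  then show ?thesis
  proof cases
    case 1
    show ?thesis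
    proof (rule span[OF 1, of "v $ 2 * y $ 3 - v $ 3 * y $ 2" "x $ 2 * v $ 3 - x $ 3 * v $ 2"])
      show "(x $ 2 * y $ 3 - x $ 3 * y $ 2) *s v = (v $ 2 * y $ 3 - v $ 3 * y $ 2) *s x + (x $ 2 * v $ 3 - x $ 3 * v $ 2) *s y"
        unfolding vec4_eq_iff using d by (simp add: t) algebra
    qed
  next
    case 2
    show ?thesis
    proof (rule span[OF 2, of "v $ 2 * y $ 4 - v $ 4 * y $ 2" "x $ 2 * v $ 4 - x $ 4 * v $ 2"])
      show "(x $ 2 * y $ 4 - x $ 4 * y $ 2) *s v = (v $ 2 * y $ 4 - v $ 4 * y $ 2) *s x + (x $ 2 * v $ 4 - x $ 4 * v $ 2) *s y"
        unfolding vec4_eq_iff using d by (simp add: t) algebra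
    qed
  next
    case 3
    show ?thesis
    proof (rule span[OF 3, of "v $ 3 * y $ 4 - v $ 4 * y $ 3" "x $ 3 * v $ 4 - x $ 4 * v $ 3"])
      show "(x $ 3 * y $ 4 - x $ 4 * y $ 3) *s v = (v $ 3 * y $ 4 - v $ 4 * y $ 3) *s x + (x $ 3 * v $ 4 - x $ 4 * v $ 3) *s y"
        unfolding vec4_eq_iff using d by (simp add: t) algebra
    qed
  qed
qed

text \<open>The components of \<open>v\<close> are the coordinates \<open>x\<close>,
  \<open>y\<close>, \<open>z\<close>; the first entry \<open>t z\<close> puts the vector into the
  plane of the fibre over \<open>(t : 1)\<close>.\<close>

definition axis_vec :: "complex poly ^ 3 \<Rightarrow> complex \<Rightarrow> complex ^ 4" where
  "axis_vec v t = vec4 (t * poly (v $ 3) t) (poly (v $ 1) t) (poly (v $ 2) t) (poly (v $ 3) t)"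

definition real_axis :: "complex poly ^ 3 \<Rightarrow> bool" where
  "real_axis v \<longleftrightarrow> v \<noteq> 0 \<and> (\<forall>i. poly_over \<real> (v $ i))"

definition axis_of :: "(complex ^ 4 \<Rightarrow> complex ^ 4) \<Rightarrow> complex poly ^ 3 \<Rightarrow> bool" where
  "axis_of A v \<longleftrightarrow> real_axis v \<and>
     (\<forall>\<^sub>F t in cofinite. \<forall>x\<in>fibre t. par (A x) (half_turn (axis_vec v t) x))"

lemma order_two_generic:
  assumes A: "A \<in> Bir_S_pi" and A2: "order_two A"
  shows "\<forall>\<^sub>F t in cofinite. \<forall>\<^sub>F u in cofinite. \<not> par (A (psi t u)) (psi t u)"
proof -
  have s: "rat_self_map_S A" using A by (simp add: Bir_S_pi_def)
  obtain d where d: "\<And>i. form \<real> d (\<lambda>v. A v $ i)" using form_map_degree[OF A] by metis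
  have "\<exists>p\<in>quadric_S. A p \<noteq> 0" using s by (auto simp: rat_self_map_S_def)
  then obtain q where q: "q \<in> quadric_S" "\<not> par (A q) q"
    using A2 by (auto simp: order_two_def rat_eq_iff_par quadric_S_iff)
  obtain i j where ij: "A q $ i * q $ j - A q $ j * q $ i \<noteq> 0" using q by (auto simp: par_def)
  have "form \<real> (d + 1) (\<lambda>v. A v $ i * v $ j - A v $ j * v $ i)"
    by (intro form_diff form_mult d form_coord) auto
  from form_generic[OF this q(1) ij] show ?thesis
    by (rule eventually_mono) (erule eventually_mono, auto simp: par_def)
qed

text \<open>A trace-zero Moebius map relates \<open>u\<close> and its image \<open>u'\<close> by
  \<open>c u u' - a (u + u') - b = 0\<close>. With \<open>u' = P / Q\<close> this is a linear system
  for \<open>(- b, a, c)\<close>, solvable over generic \<open>t\<close> and therefore solvable by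
  polynomials in \<open>t\<close>. The relation says that all chords from a point to its image pass
  through one point, the axis.\<close>

lemma involution_collinear_axis:
  assumes A: "A \<in> Bir_S_pi" and A2: "order_two A"
  shows "\<exists>v. v \<noteq> 0 \<and> (\<forall>\<^sub>F t in cofinite. \<forall>x\<in>fibre t. det3 x (A x) (axis_vec v t) = 0)"
proof -
  obtain d where d: "\<And>i. form \<real> d (\<lambda>v. A v $ i)" using form_map_degree[OF A] by metis
  have par2: "par (A (A p)) p" if "p \<in> quadric_S" for p
    using A2 that by (auto simp: order_two_def rat_eq_iff_par)
  obtain p where p: "p \<in> quadric_S" "A (A p) \<noteq> 0"
    using A2 by (auto simp: order_two_def rat_eq_iff_par)
  obtain r where r: "r \<in> quadric_S" "A r $ 4 \<noteq> 0" using Bir_S_pi_fourth_nonzero[OF A] by blast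
  have g1: "\<forall>\<^sub>F t in cofinite. \<forall>\<^sub>F u in cofinite. A (psi t u) $ 4 \<noteq> 0"
    using form_generic[OF d r] .
  have g2: "\<forall>\<^sub>F t in cofinite. \<forall>\<^sub>F u in cofinite. A (A (psi t u)) \<noteq> 0"
  proof -
    obtain i where i: "A (A p) $ i \<noteq> 0" using p by (auto simp: vec_eq_iff)
    have "form \<real> (d * d) (\<lambda>v. A (A v) $ i)" by (rule form_compose[OF _ d d]) simp
    from form_generic[OF this p(1) i] show ?thesis
      by (rule eventually_mono) (erule eventually_mono, auto)
  qed
  note g3 = order_two_generic[OF A A2]
  define P where "P t u = A (psi t u) $ 2 + \<i> * A (psi t u) $ 3" for t u
  define Q where "Q t u = A (psi t u) $ 4" for t u
  have PQ: "(\<lambda>t. P t u) \<in> poly_funs" "(\<lambda>t. Q t u) \<in> poly_funs" for u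
    unfolding P_def Q_def by (intro poly_funs_intros poly_funs_const poly_funs_form[OF d] psi_poly_funs_t)+
  have "\<exists>w1 w2 w3. (w1, w2, w3) \<noteq> (0, 0, 0) \<and>
    (\<forall>t u. Q t u * poly w1 t + - (u * Q t u + P t u) * poly w2 t + u * P t u * poly w3 t = 0)"
  proof (rule polynomial_kernel_vector[of Q "\<lambda>t u. - (u * Q t u + P t u)" "\<lambda>t u. u * P t u"])
    show "\<forall>\<^sub>F t in cofinite. \<exists>a b c. (a, b, c) \<noteq> (0, 0, 0) \<and>
        (\<forall>u. Q t u * a + - (u * Q t u + P t u) * b + u * P t u * c = 0)"
      using g1 g2 g3 eventually_delta_neq_0
    proof eventually_elim
      case (elim t)
      obtain a b c where "(a, b, c) \<noteq> (0, 0, 0)" and "\<And>u. P t u * (c * u - a) = Q t u * (a * u + b)"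
        using involution_fibre_moebius[OF A par2 elim(4,1,2,3)] unfolding P_def Q_def by blast
      then show ?case
        by (intro exI[of _ "- b"] exI[of _ a] exI[of _ c]) (auto simp: algebra_simps)
    qed
  qed (intro poly_funs_intros poly_funs_const PQ)+
  then obtain w1 w2 w3 where w: "(w1, w2, w3) \<noteq> (0, 0, 0)"
    and ker: "\<And>t u. Q t u * poly w1 t + - (u * Q t u + P t u) * poly w2 t + u * P t u * poly w3 t = 0"
    by blast
  define D where "D = [:- 1, 0, 1 :: complex:]"
  have D: "poly D t = t\<^sup>2 - 1" for t by (simp add: D_def power2_eq_square)
  \<comment> \<open>The axis has \<open>x + i y = w1\<close>, \<open>z = w2\<close> and
    \<open>x - i y = D w3\<close>. In the same coordinates \<open>psi t u\<close> is
    \<open>u^2\<close>, \<open>u\<close> and \<open>D\<close>, so the kernel equation expresses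
    collinearity with \<open>psi t u\<close> and its image.\<close>
  define v :: "complex poly ^ 3" where
    "v = vector [smult (1 / 2) (w1 + D * w3), smult (1 / (2 * \<i>)) (w1 - D * w3), w2]"
  have v: "axis_vec v t = vec4 (t * poly w2 t) ((poly w1 t + (t\<^sup>2 - 1) * poly w3 t) / 2)
     ((poly w1 t - (t\<^sup>2 - 1) * poly w3 t) / (2 * \<i>)) (poly w2 t)" for t
    by (simp add: axis_vec_def v_def D)
  have "v \<noteq> 0"
  proof
    assume "v = 0"
    then have "v $ 1 = 0" "v $ 2 = 0" "v $ 3 = 0" by simp_all
    then have "w1 + D * w3 = 0" "w1 - D * w3 = 0" and w2: "w2 = 0" by (simp_all add: v_def)
    then have "D * w3 = w1" "w1 + w1 = 0" by (auto simp: algebra_simps)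
    then have "coeff w1 n = 0" for n using arg_cong[of "w1 + w1" 0 "\<lambda>p. coeff p n"] by simp
    then have "w1 = 0" "D * w3 = 0" using \<open>D * w3 = w1\<close> by (auto simp: poly_eq_iff)
    moreover have "D \<noteq> 0" by (simp add: D_def)
    ultimately show False using w w2 by simp
  qed
  moreover have "\<forall>\<^sub>F t in cofinite. \<forall>x\<in>fibre t. det3 x (A x) (axis_vec v t) = 0"
    using g1 eventually_delta_neq_0
  proof eventually_elim
    case (elim t)
    let ?v = "axis_vec v t"
    have F: "form UNIV (1 + d) (\<lambda>x. det3 x (A x) ?v)"
    proof -
      have "form UNIV (1 + d) (\<lambda>x. x $ 2 * (?v $ 4 * A x $ 3 - ?v $ 3 * A x $ 4)
         - x $ 3 * (?v $ 4 * A x $ 2 - ?v $ 2 * A x $ 4) + x $ 4 * (?v $ 3 * A x $ 2 - ?v $ 2 * A x $ 3))"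
        by (intro form_diff form_add form_mult form_coord form_cmul form_mono[OF d]) auto
      then show ?thesis by (simp add: det3_def mult.commute)
    qed
    have "\<forall>\<^sub>F u in cofinite. det3 (psi t u) (A (psi t u)) ?v = 0"
      using elim(1) eventually_cofinite_neq[of 0]
    proof eventually_elim
      case (elim u)
      define X Y where "X = P t u" and "Y = A (psi t u) $ 2 - \<i> * A (psi t u) $ 3"
      have q: "Q t u \<noteq> 0" using elim by (simp add: Q_def)
      have "A (psi t u) \<noteq> 0" using elim by auto
      then have "A (psi t u) \<in> fibre t"
        using elim by (intro Bir_S_pi_fibre[OF A \<open>t\<^sup>2 \<noteq> 1\<close>] psi_in_fibre)
      then have XY: "X * Y = (t\<^sup>2 - 1) * (Q t u)\<^sup>2"
        by (simp add: fibre_def lor_def X_def Y_def P_def Q_def power2_eq_square algebra_simps)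
      then have X: "X \<noteq> 0" using q \<open>t\<^sup>2 \<noteq> 1\<close> by auto
      have A23: "A (psi t u) $ 2 = (X + Y) / 2" "A (psi t u) $ 3 = (X - Y) / (2 * \<i>)" "A (psi t u) $ 4 = Q t u"
        by (simp_all add: X_def Y_def P_def Q_def field_simps)
      let ?e = "t\<^sup>2 - 1"
      let ?k = "- \<i> / 2"
      define w where "w = poly w1 t" 
      define w' where "w' = poly w2 t" 
      define w'' where "w'' = poly w3 t" 
      have "det3 (psi t u) (A (psi t u)) ?v = ?k * (u\<^sup>2 * (Q t u * (?e * w'') - Y * w') - u * (X * (?e * w'') - Y * w) + ?e * (X * w' - Q t u * w))"
        unfolding det3_def A23 v w_def[symmetric] w'_def[symmetric] w''_def[symmetric]
        by (simp add: field_simps) 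
      \<comment> \<open>Multiplication by the nonzero \<open>X\<close> allows \<open>Y\<close> to be
        eliminated through \<open>X Y = (t^2 - 1) Q^2\<close>; the kernel equation then splits off
        as a factor.\<close>
      also have "X * \<dots> = ?k * ?e * (u * Q t u - X) * (Q t u * w - (u * Q t u + X) * w' + u * X * w'')"
        using XY by (simp add: power2_eq_square) algebra
      also have "Q t u * w - (u * Q t u + X) * w' + u * X * w'' = 0"
        using ker[where t = t and u = u] by (simp add: X_def w_def w'_def w''_def algebra_simps)
      finally show ?case using X by simp
    qed
    then have "det3 x (A x) ?v = 0" if "x \<in> fibre t" for x
      using form_zero_on_fibre[OF F eventually_frequently[OF cofinite_complex_nontriv] that elim(2)] by blast
    then show ?case by blast
  qed
  ultimately show ?thesis by blast
qed

section \<open>Axes of involutions\<close>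

definition cnj_vec :: "complex ^ 'n \<Rightarrow> complex ^ 'n" where
  "cnj_vec p = (\<chi> i. cnj (p $ i))"

lemma cnj_vec_nth [simp]: "cnj_vec p $ i = cnj (p $ i)"
  by (simp add: cnj_vec_def)

lemma form_cnj:
  assumes "form \<real> d f"
  shows "f (cnj_vec p) = cnj (f p)"
proof -
  obtain c where c: "range c \<subseteq> \<real>" and f: "f = (\<lambda>v. \<Sum>\<alpha>\<in>exponents d. c \<alpha> * monom_fun \<alpha> v)"
    using assms unfolding form_def by blast
  have "cnj (c \<alpha>) = c \<alpha>" for \<alpha> using c by (auto simp: Reals_cnj_iff image_subset_iff)
  then show ?thesis by (simp add: f monom_fun_def)
qed

lemma cnj_vec_fibre: "p \<in> fibre t \<Longrightarrow> cnj_vec p \<in> fibre (cnj t)"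
proof -
  assume p: "p \<in> fibre t"
  have "lor (cnj_vec p) (cnj_vec p) = cnj (lor p p)" by (simp add: lor_def)
  moreover have "cnj_vec p \<noteq> 0" using p by (auto simp: fibre_def vec4_eq_iff)
  ultimately show ?thesis using p by (simp add: fibre_def)
qed

lemma cnj_vec_cnj_vec [simp]: "cnj_vec (cnj_vec p) = p"
  by (simp add: vec_eq_iff)

lemma det3_cnj: "det3 (cnj_vec x) (cnj_vec y) (cnj_vec v) = cnj (det3 x y v)"
  by (simp add: det3_def)

lemma det3_add: "det3 x y (v + w) = det3 x y v + det3 x y w"
  and det3_diff: "det3 x y (v - w) = det3 x y v - det3 x y w"
  and det3_smult: "det3 x y (c *s v) = c * det3 x y v"
  by (simp_all add: det3_def algebra_simps)

lemma poly_map_cnj: "poly (map_poly cnj p) t = cnj (poly p (cnj t))"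
  by (induction p) (simp_all add: map_poly_pCons)

lemma eventually_cofinite_cnj:
  assumes "\<forall>\<^sub>F t in cofinite. P t"
  shows "\<forall>\<^sub>F t in cofinite. P (cnj t)"
proof -
  have "{t. \<not> P (cnj t)} = cnj ` {t. \<not> P t}"
    by (auto simp: image_iff) (metis complex_cnj_cnj)
  then show ?thesis using assms by (simp add: eventually_cofinite)
qed

lemma form_lor: "form UNIV 1 (\<lambda>x. lor x w)"
proof -
  have "form UNIV 1 (\<lambda>x. w $ 2 * x $ 2 + w $ 3 * x $ 3 + w $ 4 * x $ 4 - w $ 1 * x $ 1)"
    by (intro form_add form_diff form_cmul form_coord) auto
  then show ?thesis by (simp add: lor_def mult.commute)
qed

lemma form_half_turn: "form UNIV 1 (\<lambda>x. half_turn w x $ i)"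
proof -
  have "form UNIV 1 (\<lambda>x. (2 * w $ i) * lor x w - lor w w * x $ i)"
    by (intro form_diff form_cmul form_lor form_coord) auto
  then show ?thesis by (simp add: half_turn_def mult_ac)
qed

lemma par_on_fibre:
  assumes F: "\<And>i. form K d (\<lambda>v. F v $ i)" and G: "\<And>i. form K' e (\<lambda>v. G v $ i)"
    and gen: "\<forall>\<^sub>F u in cofinite. par (F (psi t u)) (G (psi t u))" and t: "t\<^sup>2 \<noteq> 1"
    and x: "x \<in> fibre t"
  shows "par (F x) (G x)"
  unfolding par_def
proof (intro allI)
  fix i j
  have 1: "form UNIV (d + e) (\<lambda>v. F v $ i * G v $ j - F v $ j * G v $ i)"
    by (intro form_diff form_mult form_mono[OF F] form_mono[OF G]) auto
  have 2: "\<forall>\<^sub>F u in cofinite. F (psi t u) $ i * G (psi t u) $ j - F (psi t u) $ j * G (psi t u) $ i = 0"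
    using gen by eventually_elim (simp add: par_def)
  have "F x $ i * G x $ j - F x $ j * G x $ i = 0"
    by (rule form_zero_on_fibre[OF 1 eventually_frequently[OF cofinite_complex_nontriv 2] x t])
  then show "F x $ i * G x $ j = F x $ j * G x $ i" by simp
qed

text \<open>A generic point of the fibre is moved, so collinearity with the axis identifies its
  image as the second intersection of the line with the conic. The minors then vanish on the whole
  fibre.\<close>

lemma fibre_axis_half_turn:
  assumes A: "A \<in> Bir_S_pi" and A2: "order_two A"
    and col: "\<forall>\<^sub>F t in cofinite. \<forall>x\<in>fibre t. det3 x (A x) (axis_vec v t) = 0"
  shows "\<forall>\<^sub>F t in cofinite. \<forall>x\<in>fibre t. par (A x) (half_turn (axis_vec v t) x)"
proof -
  obtain d where d: "\<And>i. form \<real> d (\<lambda>v. A v $ i)" using form_map_degree[OF A] by metis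
  note g = order_two_generic[OF A A2]
  show ?thesis
    using col g eventually_delta_neq_0
  proof eventually_elim
    case (elim t)
    have "\<forall>\<^sub>F u in cofinite. par (A (psi t u)) (half_turn (axis_vec v t) (psi t u))"
      using elim(2) eventually_cofinite_neq[of 0]
    proof eventually_elim
      case e: (elim u)
      then have "A (psi t u) \<noteq> 0" by auto
      then have "A (psi t u) \<in> fibre t" "psi t u \<in> fibre t"
        using Bir_S_pi_fibre[OF A elim(3)] psi_in_fibre e by auto
      then show ?case using elim(1) e
        by (intro collinear_half_turn[where t = t]) (auto simp: fibre_def axis_vec_def par_sym)
    qed
    then show ?case by (intro ballI par_on_fibre[OF d form_half_turn _ elim(3)])
  qed
qed

text \<open>Collinearity is linear in the axis and \<open>A\<close> is real, so the conjugate
  \<open>w\<close> of a solution \<open>v\<close> is again a solution. Then \<open>v + w\<close> and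
  \<open>i (v - w)\<close> are real solutions, and they are not both zero.\<close>

lemma involution_axis:
  assumes A: "A \<in> Bir_S_pi" and A2: "order_two A"
  shows "\<exists>v. axis_of A v"
proof -
  obtain d where d: "\<And>i. form \<real> d (\<lambda>v. A v $ i)" using form_map_degree[OF A] by metis
  obtain v where v: "v \<noteq> 0" "\<forall>\<^sub>F t in cofinite. \<forall>x\<in>fibre t. det3 x (A x) (axis_vec v t) = 0"
    using involution_collinear_axis[OF A A2] by blast
  define w :: "complex poly ^ 3" where "w = (\<chi> i. map_poly cnj (v $ i))"
  have w: "axis_vec w t = cnj_vec (axis_vec v (cnj t))" for t
    by (simp add: axis_vec_def w_def vec4_eq_iff poly_map_cnj)
  have Aw: "\<forall>\<^sub>F t in cofinite. \<forall>x\<in>fibre t. det3 x (A x) (axis_vec w t) = 0"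
    using eventually_cofinite_cnj[OF v(2)]
  proof eventually_elim
    case (elim t)
    show ?case
    proof
      fix x assume "x \<in> fibre t"
      then have "det3 (cnj_vec x) (A (cnj_vec x)) (axis_vec v (cnj t)) = 0"
        using elim cnj_vec_fibre by blast
      moreover have "A (cnj_vec x) = cnj_vec (A x)" using form_cnj[OF d] by (simp add: vec_eq_iff)
      ultimately have "cnj (det3 x (A x) (axis_vec w t)) = 0"
        unfolding w by (metis det3_cnj cnj_vec_cnj_vec)
      then show "det3 x (A x) (axis_vec w t) = 0" by simp
    qed
  qed
  define r1 :: "complex poly ^ 3" where "r1 = (\<chi> i. v $ i + w $ i)"
  define r2 :: "complex poly ^ 3" where "r2 = (\<chi> i. smult \<i> (v $ i - w $ i))"
  have r1: "axis_vec r1 t = axis_vec v t + axis_vec w t" for t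
    by (simp add: axis_vec_def r1_def vec4_eq_iff algebra_simps)
  have r2: "axis_vec r2 t = \<i> *s (axis_vec v t - axis_vec w t)" for t
    by (simp add: axis_vec_def r2_def vec4_eq_iff algebra_simps)
  have Ar: "\<forall>\<^sub>F t in cofinite. \<forall>x\<in>fibre t. det3 x (A x) (axis_vec r t) = 0" if "r = r1 \<or> r = r2" for r
    using v(2) Aw by eventually_elim (use that in \<open>auto simp: r1 r2 det3_add det3_diff det3_smult vector_ssub_ldistrib\<close>)
  have "poly_over \<real> (r1 $ i)" "poly_over \<real> (r2 $ i)" for i
    by (auto simp: poly_over_def r1_def r2_def w_def coeff_map_poly Reals_cnj_iff algebra_simps)
  moreover have "r1 \<noteq> 0 \<or> r2 \<noteq> 0"
  proof (rule ccontr)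
    assume "\<not> ?thesis"
    then have "v $ i + w $ i = 0" "v $ i - w $ i = 0" for i
      unfolding r1_def r2_def by (auto simp: vec_eq_iff)
    then have "coeff (v $ i) n + coeff (w $ i) n = 0" "coeff (v $ i) n - coeff (w $ i) n = 0" for i n
      by (metis coeff_add coeff_0, metis coeff_diff coeff_0)
    then have "coeff (v $ i) n = 0" for i n by (metis add_diff_cancel add_0 diff_0 neg_equal_0_iff_equal 
      diff_add_cancel mult_2 mult_eq_0_iff zero_neq_numeral eq_iff_diff_eq_0)
    then show False using v(1) by (auto simp: vec_eq_iff poly_eq_iff)
  qed
  ultimately have "real_axis r1 \<or> real_axis r2" by (auto simp: real_axis_def)
  then show ?thesis using fibre_axis_half_turn[OF A A2 Ar] unfolding axis_of_def by blast
qed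

text \<open>Over real \<open>t\<close> with \<open>\<bar>t\<bar> < 1\<close> the fibre has no real point.\<close>

definition unit_segment :: "complex set" where
  "unit_segment = complex_of_real ` {-1<..<1}"

lemma infinite_unit_segment: "infinite unit_segment"
  unfolding unit_segment_def by (subst finite_image_iff) (auto simp: infinite_Ioo inj_on_def)

lemma poly_zero_on_segment:
  assumes "\<forall>\<^sub>F t in cofinite. t \<in> unit_segment \<longrightarrow> poly p t = 0"
  shows "p = 0"
proof (rule ccontr)
  assume "p \<noteq> 0"
  then have "finite ({t. poly p t = 0} \<union> {t. \<not> (t \<in> unit_segment \<longrightarrow> poly p t = 0)})"
    using assms poly_roots_finite by (simp add: eventually_cofinite)
  moreover have "unit_segment \<subseteq> {t. poly p t = 0} \<union> {t. \<not> (t \<in> unit_segment \<longrightarrow> poly p t = 0)}"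
    by auto
  ultimately show False using infinite_unit_segment finite_subset by blast
qed

lemma eventually_segment_ex:
  assumes "\<forall>\<^sub>F t in cofinite. P t"
  shows "\<exists>t\<in>unit_segment. P t"
proof (rule ccontr)
  assume "\<not> ?thesis"
  then have "unit_segment \<subseteq> {t. \<not> P t}" by auto
  then show False using assms infinite_unit_segment finite_subset by (auto simp: eventually_cofinite)
qed

lemma segment_real: "t \<in> unit_segment \<Longrightarrow> t \<in> \<real>"
  by (auto simp: unit_segment_def)

lemma segment_anisotropic:
  assumes t: "t \<in> unit_segment" and p: "\<And>i. p $ i \<in> \<real>" "p $ 1 = t * p $ 4" "lor p p = 0"
  shows "p = 0"
proof -
  obtain r where r: "t = complex_of_real r" "- 1 < r" "r < 1" using t by (auto simp: unit_segment_def)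
  obtain a b c where abc: "p $ 2 = complex_of_real a" "p $ 3 = complex_of_real b" "p $ 4 = complex_of_real c"
    using p(1) by (metis Reals_cases)
  have "complex_of_real (a\<^sup>2 + b\<^sup>2 + (1 - r\<^sup>2) * c\<^sup>2) = 0"
    using p(3) by (simp add: lor_def p(2) abc r(1) power2_eq_square algebra_simps)
  then have e: "a\<^sup>2 + b\<^sup>2 + (1 - r\<^sup>2) * c\<^sup>2 = 0" by (simp only: of_real_eq_0_iff)
  have "r\<^sup>2 < 1" using r by (simp add: abs_square_less_1)
  moreover have "(1 - r\<^sup>2) * c\<^sup>2 \<ge> 0" using calculation by (intro mult_nonneg_nonneg) auto
  ultimately have "a\<^sup>2 = 0" "b\<^sup>2 = 0" "(1 - r\<^sup>2) * c\<^sup>2 = 0" using e zero_le_power2[of a] zero_le_power2[of b] by linarith+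
  then have "a = 0" "b = 0" "c = 0" using \<open>r\<^sup>2 < 1\<close> by auto
  then show ?thesis using p(2) abc by (simp add: vec4_eq_iff)
qed

abbreviation axis_q :: "complex poly ^ 3 \<Rightarrow> complex \<Rightarrow> complex" where
  "axis_q v t \<equiv> lor (axis_vec v t) (axis_vec v t)"

definition axis_norm :: "complex poly ^ 3 \<Rightarrow> complex poly" where
  "axis_norm v = v $ 1 * v $ 1 + v $ 2 * v $ 2 - [:- 1, 0, 1:] * (v $ 3 * v $ 3)"

text \<open>For nonzero norms this says that \<open>q(v)\<close> and \<open>q(w)\<close> differ by a
  square of R(t), with denominators cleared. It is the invariant on which both sides of the
  equivalence are compared.\<close>

definition norm_equivalent :: "complex poly ^ 3 \<Rightarrow> complex poly ^ 3 \<Rightarrow> bool" where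
  "norm_equivalent v w \<longleftrightarrow> (\<exists>h k. poly_over \<real> h \<and> poly_over \<real> k \<and> h \<noteq> 0 \<and> k \<noteq> 0 \<and>
     k * k * axis_norm w = h * h * axis_norm v)"

lemma poly_axis_norm: "poly (axis_norm v) t = axis_q v t"
  by (simp add: axis_norm_def axis_vec_def lor_def algebra_simps)

lemma axis_vec_first: "axis_vec v t $ 1 = t * axis_vec v t $ 4"
  by (simp add: axis_vec_def)

lemma axis_vec_real:
  assumes "\<And>i. poly_over \<real> (v $ i)" "t \<in> \<real>"
  shows "axis_vec v t $ i \<in> \<real>"
  using assms poly_over_Reals_real exhaust_4[of i] by (auto simp: axis_vec_def)

lemma axis_vec_nonzero:
  assumes "v \<noteq> 0"
  shows "\<forall>\<^sub>F t in cofinite. axis_vec v t \<noteq> 0"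
proof -
  obtain i where i: "v $ i \<noteq> 0" using assms by (auto simp: vec_eq_iff)
  have "\<forall>\<^sub>F t in cofinite. poly (v $ i) t \<noteq> 0"
    using poly_roots_finite[OF i] by (simp add: eventually_cofinite)
  then show ?thesis
    by eventually_elim (use exhaust_3[of i] in \<open>auto simp: axis_vec_def vec4_eq_iff\<close>)
qed

text \<open>On the segment the form of the fibre is positive definite, and some \<open>t\<close>
  there does not annihilate the real vector \<open>v\<close>.\<close>

lemma axis_norm_nonzero:
  assumes "real_axis v"
  shows "axis_norm v \<noteq> 0"
proof
  assume z: "axis_norm v = 0"
  obtain t where t: "t \<in> unit_segment" "axis_vec v t \<noteq> 0"
    using eventually_segment_ex[OF axis_vec_nonzero] assms by (auto simp: real_axis_def)
  have "axis_vec v t = 0"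
    using assms t(1) segment_real[OF t(1)] z poly_axis_norm[of v t]
    by (intro segment_anisotropic[OF t(1)] axis_vec_real) (auto simp: axis_vec_first real_axis_def)
  with t(2) show False by blast
qed

lemma axis_norm_generic: "real_axis v \<Longrightarrow> \<forall>\<^sub>F t in cofinite. axis_q v t \<noteq> 0"
  using poly_roots_finite[OF axis_norm_nonzero] by (simp add: eventually_cofinite poly_axis_norm)

section \<open>The curve of fixed points\<close>

definition delta_poly :: "complex poly" where
  "delta_poly = [:- 1, 0, 1:]"

lemma poly_delta_poly [simp]: "poly delta_poly t = t\<^sup>2 - 1"
  by (simp add: delta_poly_def power2_eq_square)

lemma poly_over_delta: "poly_over \<real> delta_poly"
  unfolding delta_poly_def by (intro poly_over_intros) auto

definition disc :: "complex poly ^ 3 \<Rightarrow> complex poly" where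
  "disc v = delta_poly * axis_norm v"

lemma poly_disc: "poly (disc v) t = (t\<^sup>2 - 1) * axis_q v t"
  by (simp add: disc_def poly_axis_norm)

lemma poly_over_axis_norm: "real_axis v \<Longrightarrow> poly_over \<real> (axis_norm v)"
  unfolding axis_norm_def real_axis_def by (intro poly_over_intros) auto

lemma poly_over_disc: "real_axis v \<Longrightarrow> poly_over \<real> (disc v)"
  unfolding disc_def by (intro poly_over_intros poly_over_delta poly_over_axis_norm) auto

text \<open>
  Two vectors with real coefficients spanning the polar plane of \<open>v\<close>: the second one is the dual
  of the cross product of the first one with \<open>v\<close>, so \<open>lor b b = - disc v * lor a a\<close> and the fixed
  points over \<open>t\<close> are \<open>b + s a\<close> with \<open>s\<^sup>2 = disc v\<close>.
\<close>

definition polar_a :: "complex poly ^ 3 \<Rightarrow> complex poly ^ 3" where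
  "polar_a v = (if v $ 1 = 0 \<and> v $ 2 = 0 then vector [1, 0, 0] else vector [v $ 2, - v $ 1, 0])"

definition polar_b :: "complex poly ^ 3 \<Rightarrow> complex poly ^ 3" where
  "polar_b v = (let a = polar_a v in vector
     [delta_poly * (a $ 2 * v $ 3 - a $ 3 * v $ 2), delta_poly * (a $ 3 * v $ 1 - a $ 1 * v $ 3),
      a $ 2 * v $ 1 - a $ 1 * v $ 2])"

lemma real_axis_polar_a:
  assumes "real_axis v"
  shows "real_axis (polar_a v)"
proof -
  have "polar_a v \<noteq> 0" by (auto simp: polar_a_def vec_eq_iff forall_3)
  then show ?thesis
    using assms unfolding real_axis_def polar_a_def
    by (auto simp: forall_3 intro!: poly_over_intros)
qed

lemma poly_over_polar_b:
  assumes "real_axis v"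
  shows "poly_over \<real> (polar_b v $ i)"
proof -
  note r = real_axis_polar_a[OF assms, unfolded real_axis_def] assms[unfolded real_axis_def]
  show ?thesis using r exhaust_3[of i] unfolding polar_b_def Let_def
    by (auto intro!: poly_over_intros poly_over_delta)
qed

lemma polar_a_orth: "lor (axis_vec (polar_a v) t) (axis_vec v t) = 0"
  by (simp add: polar_a_def axis_vec_def lor_def)

context
  fixes v :: "complex poly ^ 3" and t :: complex and a b w
  defines "a \<equiv> axis_vec (polar_a v) t" and "b \<equiv> axis_vec (polar_b v) t" and "w \<equiv> axis_vec v t"
begin

lemma polar_b_coords:
  "b $ 2 = (t\<^sup>2 - 1) * (a $ 3 * w $ 4 - a $ 4 * w $ 3)"
  "b $ 3 = (t\<^sup>2 - 1) * (a $ 4 * w $ 2 - a $ 2 * w $ 4)"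
  "b $ 4 = a $ 3 * w $ 2 - a $ 2 * w $ 3"
  by (simp_all add: a_def b_def w_def polar_b_def axis_vec_def Let_def)

lemma polar_firsts: "a $ 1 = t * a $ 4" "b $ 1 = t * b $ 4" "w $ 1 = t * w $ 4"
  by (simp_all add: a_def b_def w_def axis_vec_first)

lemma polar_aw: "lor a w = 0"
  by (simp add: a_def w_def polar_a_orth)

lemma polar_bw: "lor b w = 0" and polar_ba: "lor b a = 0"
  unfolding lor_def polar_firsts polar_b_coords
  by (simp_all add: power2_eq_square algebra_simps)

text \<open>Lagrange's identity for a cross product: the norm of \<open>b\<close> is
  \<open>- (t^2 - 1)\<close> times the Gram determinant of \<open>a\<close> and the axis, which are
  orthogonal.\<close>

lemma polar_bb: "lor b b = - poly (disc v) t * lor a a"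
proof -
  have "lor b b = - (t\<^sup>2 - 1) * (lor a a * lor w w - (lor a w)\<^sup>2)"
    unfolding lor_def polar_firsts polar_b_coords
    by (simp add: power2_eq_square algebra_simps)
  then show ?thesis by (simp add: polar_aw poly_disc w_def[symmetric] algebra_simps)
qed

text \<open>The expansion of \<open>x\<close> in the orthogonal basis \<open>a\<close>,
  \<open>b\<close> of the polar plane, multiplied by \<open>disc v * lor a a\<close>, which is the
  negative of \<open>lor b b\<close>.\<close>

lemma polar_decompose:
  assumes "x $ 1 = t * x $ 4" "lor x w = 0"
  shows "(poly (disc v) t * lor a a) *s x = (poly (disc v) t * lor x a) *s a - lor x b *s b"
proof -
  \<comment> \<open>Cramer's rule in the basis \<open>a\<close>, \<open>w\<close>, \<open>b\<close>,
    stated before the orthogonality to \<open>w\<close> is used, so that it is a plain polynomial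
    identity.\<close>
  have gen: "(- (t\<^sup>2 - 1) * (lor a a * lor w w - (lor a w)\<^sup>2)) * x $ i =
     - (t\<^sup>2 - 1) * (lor x a * lor w w - lor x w * lor a w) * a $ i
     - (t\<^sup>2 - 1) * (lor x w * lor a a - lor x a * lor a w) * w $ i + lor x b * b $ i"
    if "i \<in> {2, 3, 4}" for i
    using that unfolding lor_def polar_firsts assms(1)
    by (auto simp: polar_b_coords power2_eq_square algebra_simps)
  then have e: "poly (disc v) t * lor a a * x $ i = poly (disc v) t * lor x a * a $ i - lor x b * b $ i"
    if "i \<in> {2, 3, 4}" for i
    using gen[OF that] unfolding polar_aw assms(2) poly_disc w_def[symmetric] by (simp add: algebra_simps)
  have "poly (disc v) t * lor a a * x $ 1 = poly (disc v) t * lor x a * a $ 1 - lor x b * b $ 1"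
    using e[of 4] unfolding polar_firsts assms(1) by (simp add: algebra_simps) algebra
  then show ?thesis using e[of 2] e[of 3] e[of 4] by (simp add: vec4_eq_iff)
qed

lemma polar_isotropic:
  assumes x: "x $ 1 = t * x $ 4" "lor x w = 0" "lor x x = 0" "x \<noteq> 0"
    and n: "poly (disc v) t \<noteq> 0" "lor a a \<noteq> 0"
  shows "\<exists>s k. s\<^sup>2 = poly (disc v) t \<and> k \<noteq> 0 \<and> x = k *s (b + s *s a)"
proof -
  let ?D = "poly (disc v) t"
  define l m where "l = lor x a / lor a a" and "m = - lor x b / (?D * lor a a)"
  have "(?D * lor a a) *s x = (?D * lor a a) *s (l *s a + m *s b)"
    unfolding polar_decompose[OF x(1,2)] using n by (simp add: l_def m_def vec4_eq_iff field_simps)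
  then have x': "x = l *s a + m *s b" using n by (metis no_zero_divisors vector_mul_lcancel)
  have "lor x x = (l\<^sup>2 - ?D * m\<^sup>2) * lor a a"
    unfolding x' by (simp add: polar_bb polar_ba lor_commute[of a b] power2_eq_square algebra_simps)
  then have lm: "l\<^sup>2 = ?D * m\<^sup>2" using x(3) n(2) by simp
  have m: "m \<noteq> 0"
  proof
    assume "m = 0"
    then show False using lm x' x(4) by simp
  qed
  show ?thesis
  proof (intro exI conjI)
    show "(l / m)\<^sup>2 = ?D" using lm m by (simp add: field_simps)
    show "x = m *s (b + (l / m) *s a)" unfolding x' using m by (simp add: vec4_eq_iff field_simps)
  qed (rule m)
qed

end

definition fixed_pt :: "complex poly ^ 3 \<Rightarrow> complex \<Rightarrow> complex \<Rightarrow> complex ^ 4" where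
  "fixed_pt v t s = axis_vec (polar_b v) t + s *s axis_vec (polar_a v) t"

lemma fixed_pt_props:
  assumes "s\<^sup>2 = poly (disc v) t"
  shows "fixed_pt v t s $ 1 = t * fixed_pt v t s $ 4" "lor (fixed_pt v t s) (axis_vec v t) = 0"
    "lor (fixed_pt v t s) (fixed_pt v t s) = 0"
proof -
  show "fixed_pt v t s $ 1 = t * fixed_pt v t s $ 4"
    by (simp add: fixed_pt_def axis_vec_first algebra_simps)
  show "lor (fixed_pt v t s) (axis_vec v t) = 0"
    by (simp add: fixed_pt_def polar_aw polar_bw)
  have "lor (fixed_pt v t s) (fixed_pt v t s) = (s\<^sup>2 - poly (disc v) t) * axis_q (polar_a v) t"
    unfolding fixed_pt_def
    by (simp add: polar_ba polar_bb lor_commute[of "axis_vec (polar_a v) t" "axis_vec (polar_b v) t"] power2_eq_square algebra_simps)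
  then show "lor (fixed_pt v t s) (fixed_pt v t s) = 0" using assms by simp
qed

lemma fixed_pt_nonzero:
  assumes "s \<noteq> 0" "axis_q (polar_a v) t \<noteq> 0"
  shows "fixed_pt v t s \<noteq> 0"
proof
  assume "fixed_pt v t s = 0"
  then have "lor (fixed_pt v t s) (axis_vec (polar_a v) t) = 0" by simp
  then show False using assms by (simp add: fixed_pt_def polar_ba)
qed

text \<open>The ring \<open>K[t, s] / (s^2 - D)\<close> as functions on the affine curve
  \<open>s^2 = D\<close>; the values off this curve are unconstrained.\<close>

definition quad_funs :: "complex set \<Rightarrow> complex poly \<Rightarrow> (complex \<times> complex \<Rightarrow> complex) set" where
  "quad_funs K D = {g. \<exists>F G. poly_over K F \<and> poly_over K G \<and>
     (\<forall>t s. s\<^sup>2 = poly D t \<longrightarrow> g (t, s) = poly F t + s * poly G t)}"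

lemma quad_funs_algebra:
  assumes K: "coeff_ring K" and D: "poly_over K D"
  shows "fun_algebra K (quad_funs K D)"
  unfolding fun_algebra_def
proof (intro conjI ballI)
  show "(\<lambda>_. k) \<in> quad_funs K D" if "k \<in> K" for k
    unfolding quad_funs_def using that K
    by (intro CollectI exI[of _ "[:k:]"] exI[of _ 0]) (auto intro!: poly_over_intros)
next
  fix f g assume "f \<in> quad_funs K D" "g \<in> quad_funs K D"
  then obtain F G F' G' where o: "poly_over K F" "poly_over K G" "poly_over K F'" "poly_over K G'"
    and f: "\<And>t s. s\<^sup>2 = poly D t \<Longrightarrow> f (t, s) = poly F t + s * poly G t"
    and g: "\<And>t s. s\<^sup>2 = poly D t \<Longrightarrow> g (t, s) = poly F' t + s * poly G' t"
    unfolding quad_funs_def by blast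
  show "(\<lambda>x. f x + g x) \<in> quad_funs K D"
    unfolding quad_funs_def
    by (intro CollectI exI[of _ "F + F'"] exI[of _ "G + G'"])
      (auto intro!: poly_over_intros K o simp: f g algebra_simps)
  have "f (t, s) * g (t, s) = poly (F * F' + D * (G * G')) t + s * poly (F * G' + G * F') t"
    if "s\<^sup>2 = poly D t" for t s
    unfolding f[OF that] g[OF that] by (simp flip: that) (simp add: power2_eq_square algebra_simps)
  then show "(\<lambda>x. f x * g x) \<in> quad_funs K D"
    unfolding quad_funs_def
    by (intro CollectI exI[of _ "F * F' + D * (G * G')"] exI[of _ "F * G' + G * F'"])
      (auto intro!: poly_over_intros K D o)
qed

lemma quad_funs_poly: "coeff_ring K \<Longrightarrow> poly_over K p \<Longrightarrow> (\<lambda>x. poly p (fst x)) \<in> quad_funs K D"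
  unfolding quad_funs_def by (intro CollectI exI[of _ p] exI[of _ 0]) (auto intro!: poly_over_intros)

lemma quad_funs_s: "coeff_ring K \<Longrightarrow> snd \<in> quad_funs K D"
  unfolding quad_funs_def by (intro CollectI exI[of _ 0] exI[of _ 1]) (auto intro!: poly_over_intros)

lemma poly_over_X: "coeff_ring K \<Longrightarrow> poly_over K [:0, 1:]"
  by (intro poly_over_pCons poly_over_0) (auto simp: coeff_ring_def)

lemma fixed_pt_quad:
  assumes K: "coeff_ring K" and D: "poly_over K D"
    and o: "\<And>i. poly_over K (polar_a v $ i)" "\<And>i. poly_over K (polar_b v $ i)"
  shows "(\<lambda>x. fixed_pt v (fst x) (snd x) $ i) \<in> quad_funs K D"
proof -
  have add: "(\<lambda>x. f x + g x) \<in> quad_funs K D" and mult: "(\<lambda>x. f x * g x) \<in> quad_funs K D"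
    if "f \<in> quad_funs K D" "g \<in> quad_funs K D" for f g
    using quad_funs_algebra[OF K D] that by (auto simp: fun_algebra_def)
  have t: "fst \<in> quad_funs K D"
    using quad_funs_poly[OF K poly_over_X[OF K]] by simp
  show ?thesis
    using exhaust_4[of i] unfolding fixed_pt_def axis_vec_def
    by (auto intro!: add mult t quad_funs_poly[OF K] quad_funs_s[OF K] o)
qed

lemma vec2_t_quad:
  assumes "coeff_ring K"
  shows "(\<lambda>x. vec2 (fst x) 1 $ i) \<in> quad_funs K D"
proof -
  have "(\<lambda>x. poly [:0, 1:] (fst x)) \<in> quad_funs K D" "(\<lambda>x. poly 1 (fst x)) \<in> quad_funs K D"
    by (intro quad_funs_poly poly_over_X poly_over_1 assms)+
  then show ?thesis using exhaust_2[of i] by auto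
qed

text \<open>If the axis is anisotropic, its half-turn vanishes nowhere on the fibre. So it
  represents the extension of \<open>A\<close> at every point, and any other representing tuple
  agrees with it wherever that tuple is defined.\<close>

lemma fixed_on_conic_generic:
  assumes A: "A \<in> Bir_S_pi" and v: "axis_of A v"
  shows "\<forall>\<^sub>F t in cofinite. \<forall>z. z $ 2 \<noteq> 0 \<longrightarrow> z $ 1 = t * z $ 2 \<longrightarrow>
    fixed_on_conic A z = {p \<in> fibre t. lor p (axis_vec v t) = 0}"
proof -
  have s: "rat_self_map_S A" using A by (simp add: Bir_S_pi_def)
  obtain d where d: "\<And>i. form \<real> d (\<lambda>v. A v $ i)" using form_map_degree[OF A] by metis
  obtain p i where pi: "p \<in> quadric_S" "A p $ i \<noteq> 0"
    using s by (auto simp: rat_self_map_S_def vec_eq_iff)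
  have g: "\<forall>\<^sub>F t in cofinite. \<forall>\<^sub>F u in cofinite. A (psi t u) $ i \<noteq> 0"
    using form_generic[OF d pi] .
  have v': "\<forall>\<^sub>F t in cofinite. \<forall>x\<in>fibre t. par (A x) (half_turn (axis_vec v t) x)" "real_axis v"
    using v by (auto simp: axis_of_def)
  show ?thesis
    using g v'(1) axis_norm_generic[OF v'(2)] eventually_delta_neq_0
  proof eventually_elim
    case (elim t)
    let ?v = "axis_vec v t"
    show ?case
    proof (intro allI impI)
      fix z :: "complex ^ 2" assume z: "z $ 2 \<noteq> 0" "z $ 1 = t * z $ 2"
      then have c: "conic z = fibre t" by (simp add: conic_eq_fibre)
      have "\<forall>\<^sub>F u in cofinite. A (psi t u) $ i \<noteq> 0 \<and> u \<noteq> 0"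
        using elim(1) eventually_cofinite_neq[of 0] by eventually_elim simp
      then obtain u0 where u0: "A (psi t u0) $ i \<noteq> 0" "u0 \<noteq> 0"
        using eventually_happens' cofinite_complex_nontriv by blast
      then have Anz: "\<exists>x\<in>fibre t. A x \<noteq> 0" using psi_in_fibre[of u0 t] by (intro bexI[of _ "psi t u0"]) auto
      show "fixed_on_conic A z = {p \<in> fibre t. lor p ?v = 0}"
      proof (intro Set.set_eqI iffI)
        fix p assume "p \<in> {p \<in> fibre t. lor p ?v = 0}"
        then have p: "p \<in> fibre t" "lor p ?v = 0" by auto
        have nz: "half_turn ?v p \<noteq> 0" using elim(3) p by (intro half_turn_nonzero) (auto simp: fibre_def)
        have "rat_eq (fibre t) A (half_turn ?v)"
          unfolding rat_eq_iff_par using Anz nz p(1) elim(2) by blast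
        moreover have "form_map UNIV (half_turn ?v)" 
          unfolding form_map_def using form_half_turn by blast
        moreover have "proj_eq (half_turn ?v p) p"
          unfolding half_turn_fix[OF p(2)] proj_eq_def using elim(3) by (intro exI[of _ "- lor ?v ?v"]) simp
        ultimately show "p \<in> fixed_on_conic A z"
          unfolding fixed_on_conic_def c using p(1) by blast
      next
        fix p assume "p \<in> fixed_on_conic A z"
        then obtain G where p: "p \<in> fibre t" and G: "form_map UNIV G" "rat_eq (fibre t) A G" "proj_eq (G p) p"
          unfolding fixed_on_conic_def c by blast
        obtain e where e: "\<And>i. form UNIV e (\<lambda>v. G v $ i)" using G(1) by (auto simp: form_map_def)
        have p0: "p \<noteq> 0" "lor p p = 0" using p by (auto simp: fibre_def)
        have "\<forall>\<^sub>F u in cofinite. par (G (psi t u)) (half_turn ?v (psi t u))"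
          using elim(1) eventually_cofinite_neq[of 0]
        proof eventually_elim
          case (elim u)
          then have f: "psi t u \<in> fibre t" "A (psi t u) \<noteq> 0" by (auto intro: psi_in_fibre)
          have "par (A (psi t u)) (G (psi t u))" using G(2) f by (simp add: rat_eq_iff_par)
          moreover have "par (A (psi t u)) (half_turn ?v (psi t u))"
            using \<open>\<forall>x\<in>fibre t. par (A x) (half_turn ?v x)\<close> f by blast
          ultimately show ?case using f(2) par_sym par_trans by blast
        qed
        then have 1: "par (G p) (half_turn ?v p)" 
          by (rule par_on_fibre[OF e form_half_turn _ elim(4) p])
        have "G p \<noteq> 0" using G(3) p0 by (auto simp: proj_eq_def)
        then have "par (half_turn ?v p) p" using 1 proj_eq_par[OF G(3)] par_sym par_trans by blast
        then have "lor p ?v = 0" using half_turn_par_self elim(3) p0 by blast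
        with p show "p \<in> {p \<in> fibre t. lor p ?v = 0}" by simp
      qed
    qed
  qed
qed

text \<open>Avoiding finitely many points of the base amounts to avoiding infinity and finitely many \<open>t\<close>.\<close>

definition base_points_off :: "complex set \<Rightarrow> (complex ^ 2) set" where
  "base_points_off T = insert (vec2 1 0) ((\<lambda>t. vec2 t 1) ` T)"

lemma base_points_offD:
  assumes "z \<noteq> 0" "\<forall>e\<in>base_points_off T. \<not> proj_eq z e"
  shows "z $ 2 \<noteq> 0" "z $ 1 / z $ 2 \<notin> T"
proof -
  show 2: "z $ 2 \<noteq> 0"
  proof
    assume "z $ 2 = 0"
    then have "z $ 1 \<noteq> 0" "z = (z $ 1) *s vec2 1 0" using assms(1) by (auto simp: vec_eq_iff forall_2)
    then have "proj_eq z (vec2 1 0)" unfolding proj_eq_def by blast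
    then show False using assms(2) by (simp add: base_points_off_def)
  qed
  show "z $ 1 / z $ 2 \<notin> T"
  proof
    assume T: "z $ 1 / z $ 2 \<in> T"
    have "z = (z $ 2) *s vec2 (z $ 1 / z $ 2) 1" using 2 by (simp add: vec_eq_iff forall_2)
    then have "proj_eq z (vec2 (z $ 1 / z $ 2) 1)" using 2 unfolding proj_eq_def by blast
    then show False using assms(2) T by (auto simp: base_points_off_def)
  qed
qed

lemma eventually_not_proj_eq:
  assumes "finite E"
  shows "\<forall>\<^sub>F t in cofinite. \<forall>e\<in>E. \<not> proj_eq (vec2 t 1) e"
  unfolding eventually_ball_finite_distrib[OF assms]
proof
  fix e :: "complex ^ 2"
  show "\<forall>\<^sub>F t in cofinite. \<not> proj_eq (vec2 t 1) e"
    using eventually_cofinite_neq[of "e $ 1 / e $ 2"]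
  proof eventually_elim
    case (elim t)
    show ?case
    proof
      assume "proj_eq (vec2 t 1) e"
      then obtain c where c: "c \<noteq> 0" "vec2 t 1 = c *s e" by (auto simp: proj_eq_def)
      then have "t = c * e $ 1" "1 = c * e $ 2" by (metis vec2_nth(1) vector_smult_component, metis vec2_nth(2) vector_smult_component)
      then show False using elim c(1) by (metis mult_cancel_left1 mult_divide_mult_cancel_left mult_eq_0_iff div_by_1)
    qed
  qed
qed

lemma proj_eq_snd: "z $ 2 \<noteq> 0 \<Longrightarrow> z $ 1 = t * z $ 2 \<Longrightarrow> z = (z $ 2) *s vec2 t 1"
  by (simp add: vec_eq_iff forall_2)

lemma zariski_closure_mono: "M \<subseteq> N \<Longrightarrow> zariski_closure M \<subseteq> zariski_closure N"
  unfolding zariski_closure_def by blast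

lemma fix_curve_nonzero: "q \<in> fix_curve A \<Longrightarrow> fst q \<noteq> 0 \<and> snd q \<noteq> 0"
  unfolding fix_curve_def zariski_closure_def by blast

text \<open>The intersection over all finite \<open>E\<close> is exploited by one choice of
  \<open>E\<close>: the point at infinity together with the exceptional values of
  \<open>t\<close>.\<close>

lemma fix_curve_vanish:
  assumes q: "q \<in> fix_curve A" and f: "biform K d e f" and P: "\<forall>\<^sub>F t in cofinite. P t"
    and z: "\<And>t p z. P t \<Longrightarrow> z $ 2 \<noteq> 0 \<Longrightarrow> z $ 1 = t * z $ 2 \<Longrightarrow> p \<in> fixed_on_conic A z \<Longrightarrow> f (p, z) = 0"
  shows "f q = 0"
proof -
  let ?E = "base_points_off {t. \<not> P t}"
  have "finite ?E" using P by (simp add: base_points_off_def eventually_cofinite)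
  then have "q \<in> zariski_closure (fixed_points_off A ?E)" using q unfolding fix_curve_def by blast
  moreover have "f m = 0" if m: "m \<in> fixed_points_off A ?E" for m
  proof -
    obtain p w where pw: "m = (p, w)" "w \<noteq> 0" "\<forall>e\<in>?E. \<not> proj_eq w e" "p \<in> fixed_on_conic A w"
      using m unfolding fixed_points_off_def by blast
    note 2 = base_points_offD[OF pw(2,3)]
    show ?thesis unfolding pw(1) using 2 pw(4) by (intro z[of "w $ 1 / w $ 2"]) auto
  qed
  moreover have "biform UNIV d e f" using f unfolding biform_def by blast
  ultimately show ?thesis unfolding zariski_closure_def by blast
qed

section \<open>Homogenization in the base coordinates\<close>

definition homogenize :: "nat \<Rightarrow> complex poly \<Rightarrow> complex ^ 2 \<Rightarrow> complex" where
  "homogenize e p z = (\<Sum>j\<le>e. coeff p j * ((z $ 1) ^ j * (z $ 2) ^ (e - j)))"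

lemma form_homogenize:
  assumes K: "coeff_ring K" and p: "poly_over K p"
  shows "form K e (homogenize e p)"
proof -
  have "form K e (\<lambda>z :: complex ^ 2. (z $ 1) ^ j * (z $ 2) ^ (e - j))" if "j \<le> e" for j
    by (rule form_mult'[OF K form_power[OF K form_coord[OF K]] form_power[OF K form_coord[OF K]]]) (use that in simp)
  then show ?thesis
    unfolding homogenize_def using p by (intro form_sum form_cmul K) (auto simp: poly_over_def)
qed

lemma homogenize_affine:
  assumes "degree p \<le> e" "z $ 1 = t * z $ 2"
  shows "homogenize e p z = (z $ 2) ^ e * poly p t"
proof -
  have "poly p t = (\<Sum>j\<le>e. coeff p j * t ^ j)"
    unfolding poly_altdef using assms(1) by (intro sum.mono_neutral_left) (auto simp: coeff_eq_0)
  moreover have "(z $ 1) ^ j * (z $ 2) ^ (e - j) = (z $ 2) ^ e * t ^ j" if "j \<le> e" for j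
    using that by (simp add: assms(2) power_mult_distrib flip: power_add)
  ultimately show ?thesis by (simp add: homogenize_def sum_distrib_left mult_ac)
qed

definition axis_degree :: "complex poly ^ 3 \<Rightarrow> nat" where
  "axis_degree v = (\<Sum>i\<in>UNIV. degree (v $ i))"

text \<open>The entry \<open>w = t z\<close> raises the degree by one. Hence \<open>x\<close> and
  \<open>y\<close> are homogenized in degree \<open>e + 1\<close>, while the third component is
  homogenized in degree \<open>e\<close> and multiplied by a base coordinate.\<close>

definition axis_form :: "complex poly ^ 3 \<Rightarrow> complex ^ 2 \<Rightarrow> complex ^ 4" where
  "axis_form v z = (let e = axis_degree v in
     vec4 (z $ 1 * homogenize e (v $ 3) z) (homogenize (Suc e) (v $ 1) z)
       (homogenize (Suc e) (v $ 2) z) (z $ 2 * homogenize e (v $ 3) z))"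

lemma form_axis_form:
  assumes "coeff_ring K" "\<And>i. poly_over K (v $ i)"
  shows "form K (Suc (axis_degree v)) (\<lambda>z. axis_form v z $ i)"
proof -
  have "form K (1 + axis_degree v) (\<lambda>z. z $ k * homogenize (axis_degree v) (v $ 3) z)" for k :: 2
    by (intro form_mult form_coord form_homogenize assms)
  then show ?thesis
    using exhaust_4[of i] form_homogenize[OF assms(1) assms(2), of "Suc (axis_degree v)"]
    by (auto simp: axis_form_def Let_def)
qed

lemma axis_form_affine:
  assumes "z $ 1 = t * z $ 2"
  shows "axis_form v z = ((z $ 2) ^ Suc (axis_degree v)) *s axis_vec v t"
proof -
  have "degree (v $ i) \<le> axis_degree v" for i
    unfolding axis_degree_def by (rule member_le_sum) auto
  then show ?thesis
    by (simp add: axis_form_def Let_def vec4_eq_iff axis_vec_def homogenize_affine[OF _ assms] le_SucI assms)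
qed

lemma axis_form_first: "axis_form v z $ 1 * z $ 2 = axis_form v z $ 4 * z $ 1"
  by (simp add: axis_form_def Let_def)

lemma biform_lor:
  assumes K: "coeff_ring K" and F: "\<And>i. biform K a b (\<lambda>q. F q $ i)" and G: "\<And>i. biform K c d (\<lambda>q. G q $ i)"
  shows "biform K (a + c) (b + d) (\<lambda>q. lor (F q) (G q))"
  unfolding lor_def by (intro biform_add biform_diff biform_mult F G K)

lemma biform_fst_coord: "coeff_ring K \<Longrightarrow> biform K 1 0 (\<lambda>q. fst q $ i)"
  by (intro biform_fst form_coord)

lemma biform_snd_coord: "coeff_ring K \<Longrightarrow> biform K 0 1 (\<lambda>q. snd q $ i)"
  by (intro biform_snd form_coord)

text \<open>The three equations are biforms that vanish at the fixed points over generic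
  \<open>t\<close>, hence on the closure. So they also hold over exceptional finite values of
  \<open>t\<close>.\<close>

lemma fix_curve_fibre:
  assumes A: "A \<in> Bir_S_pi" and v: "axis_of A v" and q: "(p, z) \<in> fix_curve A"
    and z: "z $ 2 \<noteq> 0" "z $ 1 = t * z $ 2"
  shows "p \<in> fibre t" "lor p (axis_vec v t) = 0"
proof -
  note van = fix_curve_vanish[OF q _ fixed_on_conic_generic[OF A v]]
  have 1: "lor p p = 0"
  proof -
    have "biform UNIV (1 + 1) (0 + 0) (\<lambda>q :: (complex ^ 4) \<times> (complex ^ 2). lor (fst q) (fst q))"
      by (intro biform_lor biform_fst_coord) auto
    from van[OF this] show ?thesis by (auto simp: fibre_def)
  qed
  have 2: "p $ 1 * z $ 2 - p $ 4 * z $ 1 = 0"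
  proof -
    have "biform UNIV (1 + 0) (0 + 1) (\<lambda>q :: (complex ^ 4) \<times> (complex ^ 2). fst q $ 1 * snd q $ 2 - fst q $ 4 * snd q $ 1)"
      by (intro biform_diff biform_mult biform_fst_coord biform_snd_coord) auto
    from van[OF this] show ?thesis by (auto simp: fibre_def)
  qed
  have 3: "lor p (axis_form v z) = 0"
  proof -
    have "biform UNIV (1 + 0) (0 + Suc (axis_degree v)) (\<lambda>q :: (complex ^ 4) \<times> (complex ^ 2). lor (fst q) (axis_form v (snd q)))"
      by (intro biform_lor biform_fst_coord biform_snd form_axis_form) auto
    from van[OF this] show ?thesis by (auto simp: axis_form_affine)
  qed
  show "lor p (axis_vec v t) = 0" using 3 z by (simp add: axis_form_affine)
  show "p \<in> fibre t" using 1 2 z fix_curve_nonzero[OF q] by (simp add: fibre_def)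
qed

text \<open>A biform pulled back to the curve \<open>s^2 = disc v\<close> becomes
  \<open>F + s G\<close>. If it kills the generic fixed points, its values at \<open>s\<close> and
  \<open>- s\<close> give \<open>F = G = 0\<close>, so it also vanishes at exceptional
  \<open>t\<close>.\<close>

lemma fixed_pt_in_fix_curve:
  assumes A: "A \<in> Bir_S_pi" and v: "axis_of A v" and s: "s\<^sup>2 = poly (disc v) t"
    and nz: "fixed_pt v t s \<noteq> 0"
  shows "(fixed_pt v t s, vec2 t 1) \<in> fix_curve A"
proof -
  have rv: "real_axis v" using v by (simp add: axis_of_def)
  show ?thesis
    unfolding fix_curve_def zariski_closure_def
  proof (intro INT_I CollectI conjI allI impI)
    fix E :: "(complex ^ 2) set" and d e and f :: "(complex ^ 4) \<times> (complex ^ 2) \<Rightarrow> complex"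
    assume "E \<in> {E. finite E}" and f: "biform UNIV d e f" and van: "\<forall>m\<in>fixed_points_off A E. f m = 0"
    then have E: "finite E" by simp
    have "(\<lambda>x. f (fixed_pt v (fst x) (snd x), vec2 (fst x) 1)) \<in> quad_funs UNIV (disc v)"
      by (intro biform_fun_algebra[OF _ quad_funs_algebra f] fixed_pt_quad vec2_t_quad) auto
    then obtain F G where FG: "\<And>t s. s\<^sup>2 = poly (disc v) t \<Longrightarrow> f (fixed_pt v t s, vec2 t 1) = poly F t + s * poly G t"
      unfolding quad_funs_def by auto
    have "\<forall>\<^sub>F t in cofinite. poly F t = 0 \<and> poly G t = 0"
      using fixed_on_conic_generic[OF A v] eventually_not_proj_eq[OF E] axis_norm_generic[OF rv]
        axis_norm_generic[OF real_axis_polar_a[OF rv]] eventually_delta_neq_0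
    proof eventually_elim
      case (elim t)
      have zero: "poly F t + s * poly G t = 0" if s: "s\<^sup>2 = poly (disc v) t" for s
      proof -
        have "s \<noteq> 0" using s elim by (auto simp: poly_disc)
        then have "fixed_pt v t s \<in> fibre t" "lor (fixed_pt v t s) (axis_vec v t) = 0"
          using fixed_pt_props[OF s] fixed_pt_nonzero elim by (auto simp: fibre_def)
        then have "fixed_pt v t s \<in> fixed_on_conic A (vec2 t 1)" using elim(1) by simp
        moreover have "vec2 t 1 \<noteq> 0" by (simp add: vec_eq_iff forall_2)
        ultimately have "(fixed_pt v t s, vec2 t 1) \<in> fixed_points_off A E"
          using elim(2) by (simp add: fixed_points_off_def)
        then show ?thesis using van FG[OF s] by auto
      qed
      define s where "s = csqrt (poly (disc v) t)"
      have s: "s\<^sup>2 = poly (disc v) t" "s \<noteq> 0" using elim by (auto simp: s_def poly_disc)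
      then show ?case using zero[of s] zero[of "- s"] by auto
    qed
    then have "poly F t = 0" "poly G t = 0"
      using poly_funs_zero_eventually[OF poly_funs_poly] by (auto simp: eventually_conj_iff)
    then show "f (fixed_pt v t s, vec2 t 1) = 0" using FG[OF s] by simp
  qed (use nz in \<open>auto simp: vec_eq_iff forall_2\<close>)
qed

lemma fix_curve_scale:
  assumes "c \<noteq> 0" "k \<noteq> 0" "(p, z) \<in> fix_curve A"
  shows "(c *s p, k *s z) \<in> fix_curve A"
  using assms unfolding fix_curve_def zariski_closure_def
  by (auto simp: biform_scale)

lemma fix_curve_generic:
  assumes A: "A \<in> Bir_S_pi" and v: "axis_of A v"
  shows "\<forall>\<^sub>F t in cofinite. \<forall>p z. z $ 2 \<noteq> 0 \<longrightarrow> z $ 1 = t * z $ 2 \<longrightarrow>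
    (p, z) \<in> fix_curve A \<longleftrightarrow> p \<in> fibre t \<and> lor p (axis_vec v t) = 0"
proof -
  have rv: "real_axis v" using v by (simp add: axis_of_def)
  show ?thesis
    using axis_norm_generic[OF rv] axis_norm_generic[OF real_axis_polar_a[OF rv]] eventually_delta_neq_0
  proof eventually_elim
    case (elim t)
    have "(p, z) \<in> fix_curve A" if z: "z $ 2 \<noteq> 0" "z $ 1 = t * z $ 2"
      and p: "p \<in> fibre t" "lor p (axis_vec v t) = 0" for p z
    proof -
      obtain s k where sk: "s\<^sup>2 = poly (disc v) t" "k \<noteq> 0" "p = k *s fixed_pt v t s"
        using polar_isotropic[of p t v] p elim unfolding fibre_def fixed_pt_def by (auto simp: poly_disc)
      have "s \<noteq> 0" using sk(1) elim by (auto simp: poly_disc)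
      then have "(fixed_pt v t s, vec2 t 1) \<in> fix_curve A"
        using fixed_pt_in_fix_curve[OF A v sk(1)] fixed_pt_nonzero elim by blast
      then show ?thesis using fix_curve_scale[OF sk(2) z(1)] proj_eq_snd[OF z] sk(3) by metis
    qed
    then show ?case using fix_curve_fibre[OF A v] by blast
  qed
qed

text \<open>The curve is the closure of its fixed points over generic \<open>t\<close>, so it is
  enough that \<open>M\<close> contains the points of the curve there.\<close>

lemma fix_curve_dense:
  assumes A: "A \<in> Bir_S_pi" and v: "axis_of A v" and P: "\<forall>\<^sub>F t in cofinite. P t"
    and M: "\<And>t p z. P t \<Longrightarrow> (p, z) \<in> fix_curve A \<Longrightarrow> z $ 2 \<noteq> 0 \<Longrightarrow> z $ 1 = t * z $ 2 \<Longrightarrow> (p, z) \<in> M"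
  shows "fix_curve A \<subseteq> zariski_closure M"
proof
  fix q assume q: "q \<in> fix_curve A"
  have ev: "\<forall>\<^sub>F t in cofinite. P t \<and> (\<forall>p z. z $ 2 \<noteq> 0 \<longrightarrow> z $ 1 = t * z $ 2 \<longrightarrow> p \<in> fixed_on_conic A z \<longrightarrow> (p, z) \<in> fix_curve A)"
    using P fix_curve_generic[OF A v] fixed_on_conic_generic[OF A v] by eventually_elim blast
  show "q \<in> zariski_closure M"
    unfolding zariski_closure_def
  proof (intro CollectI conjI allI impI)
    fix d e f assume f: "biform UNIV d e f" "\<forall>m\<in>M. f m = 0"
    show "f q = 0" by (rule fix_curve_vanish[OF q f(1) ev]) (use M f(2) in blast)
  qed (use fix_curve_nonzero[OF q] in auto)
qed

section \<open>Comparison of the discriminants\<close>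

lemma segment_disc_negative:
  assumes v: "real_axis v" and t: "t \<in> unit_segment" and nz: "axis_vec v t \<noteq> 0"
  shows "\<exists>r<0. poly (disc v) t = complex_of_real r"
proof -
  let ?p = "axis_vec v t"
  obtain r where r: "t = complex_of_real r" "- 1 < r" "r < 1" using t by (auto simp: unit_segment_def)
  have "?p $ i \<in> \<real>" for i using axis_vec_real v segment_real[OF t] by (auto simp: real_axis_def)
  then obtain a b c where abc: "?p $ 2 = complex_of_real a" "?p $ 3 = complex_of_real b" "?p $ 4 = complex_of_real c"
    by (metis Reals_cases)
  have r2: "r\<^sup>2 < 1" using r by (simp add: abs_square_less_1)
  have "poly (disc v) t = complex_of_real ((r\<^sup>2 - 1) * (a\<^sup>2 + b\<^sup>2 + (1 - r\<^sup>2) * c\<^sup>2))"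
    unfolding poly_disc lor_def axis_vec_first abc unfolding r(1) by (simp add: power2_eq_square algebra_simps)
  moreover have "a\<^sup>2 + b\<^sup>2 + (1 - r\<^sup>2) * c\<^sup>2 > 0"
  proof -
    have "a \<noteq> 0 \<or> b \<noteq> 0 \<or> c \<noteq> 0" using nz abc axis_vec_first[of v t] by (auto simp: vec4_eq_iff)
    moreover have "(1 - r\<^sup>2) * c\<^sup>2 \<ge> 0" "c \<noteq> 0 \<Longrightarrow> (1 - r\<^sup>2) * c\<^sup>2 > 0" using r2 by auto
    ultimately show ?thesis
      by (smt (verit) zero_le_power2 zero_less_power2)
  qed
  ultimately show ?thesis using r2 by (intro exI[of _ "(r\<^sup>2 - 1) * (a\<^sup>2 + b\<^sup>2 + (1 - r\<^sup>2) * c\<^sup>2)"]) (auto simp: mult_less_0_iff)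
qed

text \<open>On the segment \<open>s\<close> is purely imaginary and nonzero. This takes the place of
  the linear independence of 1 and a square root of \<open>disc v\<close> over R(t).\<close>

lemma segment_independent:
  assumes v: "real_axis v" and t: "t \<in> unit_segment" and nz: "axis_vec v t \<noteq> 0"
    and s: "s\<^sup>2 = poly (disc v) t" and cd: "c \<in> \<real>" "d \<in> \<real>" "c + s * d = 0"
  shows "c = 0 \<and> d = 0"
proof -
  obtain r where r: "r < 0" "poly (disc v) t = complex_of_real r"
    using segment_disc_negative[OF v t nz] by blast
  obtain x y where xy: "c = complex_of_real x" "d = complex_of_real y" using cd(1,2) by (metis Reals_cases)
  have "c = - (s * d)" using cd(3) by (simp add: add_eq_0_iff2)
  then have "c\<^sup>2 = s\<^sup>2 * d\<^sup>2" by (simp add: power_mult_distrib)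
  then have "complex_of_real (x\<^sup>2) = complex_of_real (r * y\<^sup>2)" unfolding s r xy by simp
  then have e: "x\<^sup>2 = r * y\<^sup>2" by (simp only: of_real_eq_iff)
  moreover have "r * y\<^sup>2 \<le> 0" using r(1) by (simp add: mult_le_0_iff)
  ultimately have "x\<^sup>2 = 0" by (metis antisym zero_le_power2)
  then show ?thesis using e r(1) by (simp add: xy)
qed

text \<open>The Gram determinant is the square of the determinant of the vectors times
  \<open>1 - t^2\<close>, the determinant of the form on the plane \<open>w = t z\<close>.
  Orthogonality reduces it to its diagonal.\<close>

lemma gram_det3:
  assumes "x $ 1 = t * x $ 4" "y $ 1 = t * y $ 4" "z $ 1 = t * z $ 4"
    and "lor x y = 0" "lor x z = 0" "lor y z = 0"
  shows "lor x x * lor y y * lor z z = - (t\<^sup>2 - 1) * (det3 x y z)\<^sup>2"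
proof -
  have "lor x x * lor y y * lor z z + 2 * lor x y * lor y z * lor x z - lor x x * (lor y z)\<^sup>2
    - lor y y * (lor x z)\<^sup>2 - lor z z * (lor x y)\<^sup>2 = - (t\<^sup>2 - 1) * (det3 x y z)\<^sup>2"
    unfolding lor_def det3_def assms(1-3) by (simp add: power2_eq_square algebra_simps)
  then show ?thesis using assms(4-6) by simp
qed

text \<open>
  A pair of conjugate points \<open>c \<plusminus> s d\<close> of the conic on the polar line of \<open>w\<close> makes \<open>c, d, w\<close> an
  orthogonal basis. Its Gram determinant compares the discriminant \<open>s\<^sup>2\<close> with the one of \<open>w\<close>.
\<close>

lemma conjugate_pair_discriminants:
  fixes c d :: "4 \<Rightarrow> complex poly"
  assumes v: "real_axis v" and w: "real_axis w"
    and cd: "\<And>i. poly_over \<real> (c i)" "\<And>i. poly_over \<real> (d i)"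
    and H: "\<forall>\<^sub>F t in cofinite. t \<in> unit_segment \<longrightarrow> (\<forall>s x. s\<^sup>2 = poly (disc v) t \<longrightarrow>
      x = (\<chi> i. poly (c i) t + s * poly (d i) t) \<longrightarrow> x \<in> fibre t \<and> lor x (axis_vec w t) = 0)"
  shows "norm_equivalent v w"
proof -
  \<comment> \<open>Here \<open>Q\<close> is the norm of \<open>d\<close> and \<open>k\<close> the
    determinant of \<open>c\<close>, \<open>d\<close>, \<open>w\<close>. The Gram identity reads
    \<open>q(v) Q^2 q(w) = k^2\<close>, and multiplication by \<open>q(w)\<close> explains
    \<open>h = Q q(w)\<close>.\<close>
  define Q where "Q = d 2 * d 2 + d 3 * d 3 - delta_poly * (d 4 * d 4)"
  define h where "h = Q * axis_norm w"
  define k where "k = c 2 * (d 3 * w $ 3 - d 4 * w $ 2) - c 3 * (d 2 * w $ 3 - d 4 * w $ 1)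
     + c 4 * (d 2 * w $ 2 - d 3 * w $ 1)"
  have real: "poly_over \<real> h" "poly_over \<real> k" unfolding h_def Q_def k_def
    using w by (intro poly_over_intros cd poly_over_axis_norm poly_over_delta; auto simp: real_axis_def)+
  have fin: "poly Q t \<noteq> 0 \<and> poly (k * k * axis_norm w - h * h * axis_norm v) t = 0"
    if t: "t \<in> unit_segment" "t\<^sup>2 \<noteq> 1" and nz: "axis_vec v t \<noteq> 0" "axis_q v t \<noteq> 0"
      and H: "\<And>s x. s\<^sup>2 = poly (disc v) t \<Longrightarrow> x = (\<chi> i. poly (c i) t + s * poly (d i) t) \<Longrightarrow>
        x \<in> fibre t \<and> lor x (axis_vec w t) = 0" for t
  proof -
    define C where "C = (\<chi> i. poly (c i) t)"
    define D where "D = (\<chi> i. poly (d i) t)"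
    let ?W = "axis_vec w t"
    define s where "s = csqrt (poly (disc v) t)"
    have s: "s\<^sup>2 = poly (disc v) t" "s \<noteq> 0" using t nz by (auto simp: s_def poly_disc)
    have x: "C + s *s D \<in> fibre t" "lor (C + s *s D) ?W = 0"
      using H[OF s(1), of "C + s *s D"] by (auto simp: C_def D_def vec_eq_iff)
    have x': "C + (- s) *s D \<in> fibre t" "lor (C + (- s) *s D) ?W = 0"
      using H[of "- s" "C + (- s) *s D"] s(1) by (auto simp: C_def D_def vec_eq_iff)
    have 1: "C $ 1 = t * C $ 4" "D $ 1 = t * D $ 4"
    proof -
      have e: "C $ 1 + s * D $ 1 = t * (C $ 4 + s * D $ 4)" "C $ 1 - s * D $ 1 = t * (C $ 4 - s * D $ 4)"
        using x x' by (auto simp: fibre_def)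
      then have "2 * C $ 1 = 2 * (t * C $ 4)" by (simp add: algebra_simps) algebra
      then show c: "C $ 1 = t * C $ 4" by simp
      then have "s * D $ 1 = s * (t * D $ 4)" using e(1) by (simp add: algebra_simps)
      then show "D $ 1 = t * D $ 4" using s(2) by simp
    qed
    have 2: "lor C C + s\<^sup>2 * lor D D = 0" "lor C D = 0" "lor C ?W = 0" "lor D ?W = 0"
    proof -
      have e: "lor C C + s\<^sup>2 * lor D D + 2 * s * lor C D = 0" "lor C C + s\<^sup>2 * lor D D - 2 * s * lor C D = 0"
      proof -
        have ee: "lor (C + r *s D) (C + r *s D) = lor C C + r\<^sup>2 * lor D D + 2 * r * lor C D" for r
          by (simp add: lor_commute[of D C] power2_eq_square algebra_simps)
        have "lor (C + s *s D) (C + s *s D) = 0" "lor (C + (- s) *s D) (C + (- s) *s D) = 0"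
          using x(1) x'(1) unfolding fibre_def by blast+
        then show "lor C C + s\<^sup>2 * lor D D + 2 * s * lor C D = 0"
          "lor C C + s\<^sup>2 * lor D D - 2 * s * lor C D = 0"
          unfolding ee by simp_all
      qed
      then have "2 * (lor C C + s\<^sup>2 * lor D D) = 0" by algebra
      then show a: "lor C C + s\<^sup>2 * lor D D = 0" by (metis mult_eq_0_iff zero_neq_numeral)
      then show "lor C D = 0" using e(1) s(2) by simp
      have f: "lor C ?W + s * lor D ?W = 0" "lor C ?W - s * lor D ?W = 0"
        using x(2) x'(2) by auto
      then have "2 * lor C ?W = 0" by algebra
      then show b: "lor C ?W = 0" by simp
      then show "lor D ?W = 0" using f(1) s(2) by simp
    qed
    have Q: "poly Q t = lor D D"
      unfolding lor_def 1(2) by (simp add: Q_def D_def power2_eq_square algebra_simps)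
    have K: "poly k t = det3 C D ?W"
      by (simp add: k_def det3_def C_def D_def axis_vec_def)
    have tr: "t \<in> \<real>" using t segment_real by blast
    have r: "C $ i \<in> \<real>" "D $ i \<in> \<real>" for i using poly_over_Reals_real[OF cd(1) tr] poly_over_Reals_real[OF cd(2) tr]
      by (auto simp: C_def D_def)
    \<comment> \<open>If \<open>D\<close> were isotropic, so would be \<open>C\<close>, since
      \<open>lor C C = - s^2 lor D D\<close>. Both are real, so anisotropy on the segment would make
      \<open>C + s D\<close> zero.\<close>
    have DD: "lor D D \<noteq> 0"
    proof
      assume z: "lor D D = 0"
      then have "D = 0" "C = 0" using segment_anisotropic[OF t(1)] r 1 2 by auto
      then show False using x(1) by (simp add: fibre_def)
    qed
    have "lor C C * lor D D * lor ?W ?W = - (t\<^sup>2 - 1) * (det3 C D ?W)\<^sup>2"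
      by (rule gram_det3[OF 1 axis_vec_first 2(2,3,4)])
    moreover have "lor C C = - (t\<^sup>2 - 1) * axis_q v t * lor D D"
      using 2(1) unfolding s poly_disc by algebra
    ultimately have "- (t\<^sup>2 - 1) * (axis_q v t * (lor D D)\<^sup>2 * lor ?W ?W) = - (t\<^sup>2 - 1) * (det3 C D ?W)\<^sup>2"
      by (simp add: power2_eq_square mult_ac)
    then have "axis_q v t * (lor D D)\<^sup>2 * lor ?W ?W = (det3 C D ?W)\<^sup>2"
      using t(2) by (metis mult_cancel_left neg_equal_0_iff_equal right_minus_eq)
    then have "poly (k * k * axis_norm w - h * h * axis_norm v) t = 0"
      unfolding h_def poly_diff poly_mult K Q poly_axis_norm by (simp add: power2_eq_square) algebra
    then show ?thesis using DD Q by simp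
  qed
  have anz: "\<forall>\<^sub>F t in cofinite. axis_vec v t \<noteq> 0"
    using axis_vec_nonzero v by (auto simp: real_axis_def)
  have ev: "\<forall>\<^sub>F t in cofinite. t \<in> unit_segment \<longrightarrow> poly Q t \<noteq> 0 \<and> poly (k * k * axis_norm w - h * h * axis_norm v) t = 0"
    using H eventually_delta_neq_0 anz axis_norm_generic[OF v]
  proof eventually_elim
    case (elim t)
    then show ?case using fin[of t] by blast
  qed
  then have "k * k * axis_norm w - h * h * axis_norm v = 0"
    by (intro poly_zero_on_segment) (erule eventually_mono, blast)
  then have eq: "k * k * axis_norm w = h * h * axis_norm v" by simp
  have "Q \<noteq> 0" using eventually_segment_ex[OF ev] by auto
  then have "h \<noteq> 0" using axis_norm_nonzero[OF w] by (simp add: h_def)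
  moreover from this have "k \<noteq> 0" using eq axis_norm_nonzero[OF v] by auto
  ultimately show ?thesis unfolding norm_equivalent_def using eq real by blast
qed

lemma biform_base_linear: "biform UNIV 0 1 (\<lambda>q :: (complex ^ 'n) \<times> (complex ^ 2). snd q $ 1 - t * snd q $ 2)"
  by (intro biform_diff biform_cmul biform_snd_coord) auto

text \<open>Otherwise \<open>M\<close> would lie over finitely many base points, and the product of
  their linear forms would vanish on a curve that has points over generic \<open>t\<close>.\<close>

lemma fix_curve_closure_generic:
  assumes A: "A \<in> Bir_S_pi" and v: "axis_of A v" and M: "fix_curve A \<subseteq> zariski_closure M"
    and P: "\<forall>\<^sub>F t in cofinite. P t"
  shows "\<exists>p z t. (p, z) \<in> M \<and> z $ 2 \<noteq> 0 \<and> z $ 1 = t * z $ 2 \<and> P t"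
proof (rule ccontr)
  assume n: "\<not> ?thesis"
  define T where "T = {t. \<not> P t}"
  have T: "finite T" using P by (simp add: T_def eventually_cofinite)
  define f where "f q = snd q $ 2 * (\<Prod>t\<in>T. snd q $ 1 - t * snd q $ 2)" for q :: "(complex ^ 4) \<times> (complex ^ 2)"
  have "biform UNIV (0 + (\<Sum>t\<in>T. 0)) (1 + (\<Sum>t\<in>T. 1)) f"
    unfolding f_def by (intro biform_mult biform_prod biform_snd_coord biform_base_linear T) auto
  moreover have "f m = 0" if "m \<in> M" for m
  proof (cases "snd m $ 2 = 0")
    case False
    have "\<not> P (snd m $ 1 / snd m $ 2)"
    proof
      assume P: "P (snd m $ 1 / snd m $ 2)"
      have "\<exists>p z t. (p, z) \<in> M \<and> z $ 2 \<noteq> 0 \<and> z $ 1 = t * z $ 2 \<and> P t"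
        by (rule exI[of _ "fst m"], rule exI[of _ "snd m"], rule exI[of _ "snd m $ 1 / snd m $ 2"])
          (use that False P in auto)
      with n show False by contradiction
    qed
    then have "snd m $ 1 / snd m $ 2 \<in> T" by (simp add: T_def)
    then have "(\<Prod>t\<in>T. snd m $ 1 - t * snd m $ 2) = 0"
      using T False by (auto intro!: bexI[of _ "snd m $ 1 / snd m $ 2"])
    then show ?thesis by (simp add: f_def)
  qed (simp add: f_def)
  ultimately have van: "f q = 0" if "q \<in> fix_curve A" for q
    using M that unfolding zariski_closure_def by blast
  have rv: "real_axis v" using v by (simp add: axis_of_def)
  have "\<forall>\<^sub>F t in cofinite. t \<notin> T \<and> (\<exists>s. s\<^sup>2 = poly (disc v) t \<and> fixed_pt v t s \<noteq> 0)"
    using P axis_norm_generic[OF rv] axis_norm_generic[OF real_axis_polar_a[OF rv]] eventually_delta_neq_0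
  proof eventually_elim
    case (elim t)
    then show ?case
      by (intro conjI exI[of _ "csqrt (poly (disc v) t)"] fixed_pt_nonzero) (auto simp: T_def poly_disc)
  qed
  then obtain t s where ts: "t \<notin> T" "s\<^sup>2 = poly (disc v) t" "fixed_pt v t s \<noteq> 0"
    using eventually_happens'[OF cofinite_complex_nontriv] by blast
  have "f (fixed_pt v t s, vec2 t 1) = 0" by (rule van[OF fixed_pt_in_fix_curve[OF A v ts(2,3)]])
  then have "\<exists>t'\<in>T. t - t' = 0" using T by (simp add: f_def)
  then show False using ts(1) by simp
qed

lemma quad_funs_choice:
  assumes "\<And>i. (\<lambda>x. g x $ i) \<in> quad_funs K D"
  shows "\<exists>F G. (\<forall>i. poly_over K (F i)) \<and> (\<forall>i. poly_over K (G i)) \<and>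
    (\<forall>t s. s\<^sup>2 = poly D t \<longrightarrow> g (t, s) = (\<chi> i. poly (F i) t + s * poly (G i) t))"
proof -
  have "\<forall>i. \<exists>FG. poly_over K (fst FG) \<and> poly_over K (snd FG) \<and>
    (\<forall>t s. s\<^sup>2 = poly D t \<longrightarrow> g (t, s) $ i = poly (fst FG) t + s * poly (snd FG) t)"
    using assms unfolding quad_funs_def by fastforce
  then obtain FG where "\<And>i. poly_over K (fst (FG i)) \<and> poly_over K (snd (FG i)) \<and>
    (\<forall>t s. s\<^sup>2 = poly D t \<longrightarrow> g (t, s) $ i = poly (fst (FG i)) t + s * poly (snd (FG i)) t)" by metis
  then show ?thesis
    by (intro exI[of _ "\<lambda>i. fst (FG i)"] exI[of _ "\<lambda>i. snd (FG i)"]) (auto simp: vec_eq_iff)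
qed

lemma segment_quad_nonzero:
  assumes v: "real_axis v"
    and o: "\<And>i. poly_over \<real> (F i)" "\<And>i. poly_over \<real> (G i)" and nz: "F j \<noteq> 0 \<or> G j \<noteq> 0"
  shows "\<forall>\<^sub>F t in cofinite. t \<in> unit_segment \<longrightarrow>
    (\<forall>s. s\<^sup>2 = poly (disc v) t \<longrightarrow> (\<chi> i. poly (F i) t + s * poly (G i) t) \<noteq> (0 :: complex ^ 'n))"
proof -
  have "\<forall>\<^sub>F t in cofinite. poly (F j) t \<noteq> 0 \<or> poly (G j) t \<noteq> 0"
  proof (cases "F j = 0")
    case True
    then have "finite {t. poly (G j) t = 0}" using nz poly_roots_finite by blast
    then show ?thesis unfolding eventually_cofinite by (rule finite_subset[rotated]) auto
  next
    case False
    then have "finite {t. poly (F j) t = 0}" using poly_roots_finite by blast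
    then show ?thesis unfolding eventually_cofinite by (rule finite_subset[rotated]) auto
  qed
  moreover have "\<forall>\<^sub>F t in cofinite. axis_vec v t \<noteq> 0" using axis_vec_nonzero v by (auto simp: real_axis_def)
  ultimately show ?thesis
  proof eventually_elim
    case (elim t)
    show ?case
    proof (intro impI allI notI)
      fix s assume t: "t \<in> unit_segment" and s: "s\<^sup>2 = poly (disc v) t"
        and z: "(\<chi> i. poly (F i) t + s * poly (G i) t) = (0 :: complex ^ 'n)"
      have "poly (F j) t + s * poly (G j) t = 0" using arg_cong[OF z, of "\<lambda>x. x $ j"] by simp
      then have "poly (F j) t = 0 \<and> poly (G j) t = 0"
        by (intro segment_independent[OF v t elim(2) s] poly_over_Reals_real o segment_real[OF t])
      then show False using elim(1) by blast
    qed
  qed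
qed

text \<open>Applying \<open>\<rho>\<close> to the universal point \<open>fixed_pt v t s\<close>
  gives \<open>F + s G\<close> with real polynomial vectors, which is the required point of the
  second curve. It is not identically zero: the domain of \<open>\<rho>\<close> contains a point
  over a generic \<open>t\<close>, and such a point is a multiple of some
  \<open>fixed_pt v t s\<close>.\<close>

lemma birational_discriminants:
  assumes A: "A \<in> Bir_S_pi" and v: "axis_of A v" and B: "B \<in> Bir_S_pi" and w: "axis_of B w"
    and rho: "bi_rational_map \<real> (fix_curve A) (fix_curve B) \<rho>"
    and pi: "\<forall>q\<in>fix_curve A. bi_defined \<rho> q \<longrightarrow> proj_eq (snd (\<rho> q)) (snd q)"
  shows "norm_equivalent v w"
proof -
  have rv: "real_axis v" and rw: "real_axis w" using v w by (simp_all add: axis_of_def)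
  obtain d e where de: "\<And>i. biform \<real> d e (\<lambda>q. fst (\<rho> q) $ i)"
    using rho unfolding bi_rational_map_def biform_map_def by auto
  obtain d' e' where de': "\<And>i. biform \<real> d' e' (\<lambda>q. snd (\<rho> q) $ i)"
    using rho unfolding bi_rational_map_def biform_map_def by auto
  let ?q = "\<lambda>x. (fixed_pt v (fst x) (snd x), vec2 (fst x) 1)"
  have fq: "(\<lambda>x. fixed_pt v (fst x) (snd x) $ i) \<in> quad_funs \<real> (disc v)" for i
    using real_axis_polar_a[OF rv] poly_over_polar_b[OF rv]
    by (intro fixed_pt_quad poly_over_disc rv) (auto simp: real_axis_def)
  note alg = biform_fun_algebra[OF coeff_ring_Reals quad_funs_algebra[OF coeff_ring_Reals poly_over_disc[OF rv]]
      _ fq vec2_t_quad[OF coeff_ring_Reals]]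
  obtain F G where FG: "\<And>i. poly_over \<real> (F i)" "\<And>i. poly_over \<real> (G i)"
    "\<And>t s. s\<^sup>2 = poly (disc v) t \<Longrightarrow> fst (\<rho> (?q (t, s))) = (\<chi> i. poly (F i) t + s * poly (G i) t)"
    using quad_funs_choice[of "\<lambda>x. fst (\<rho> (?q x))", OF alg[OF de]] by auto
  obtain F' G' where FG': "\<And>i. poly_over \<real> (F' i)" "\<And>i. poly_over \<real> (G' i)"
    "\<And>t s. s\<^sup>2 = poly (disc v) t \<Longrightarrow> snd (\<rho> (?q (t, s))) = (\<chi> i. poly (F' i) t + s * poly (G' i) t)"
    using quad_funs_choice[of "\<lambda>x. snd (\<rho> (?q x))", OF alg[OF de']] by auto
  have cl: "fix_curve A \<subseteq> zariski_closure {q \<in> fix_curve A. bi_defined \<rho> q}"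
    using rho by (simp add: bi_rational_map_def)
  have ev: "\<forall>\<^sub>F t in cofinite. poly (disc v) t \<noteq> 0 \<and> axis_q (polar_a v) t \<noteq> 0"
    using axis_norm_generic[OF rv] axis_norm_generic[OF real_axis_polar_a[OF rv]] eventually_delta_neq_0
    by eventually_elim (simp add: poly_disc)
  obtain p z t where pz: "(p, z) \<in> fix_curve A" "bi_defined \<rho> (p, z)" "z $ 2 \<noteq> 0" "z $ 1 = t * z $ 2"
    and t: "poly (disc v) t \<noteq> 0" "axis_q (polar_a v) t \<noteq> 0"
    using fix_curve_closure_generic[OF A v cl ev] by auto
  have "p \<in> fibre t" "lor p (axis_vec v t) = 0" using fix_curve_fibre[OF A v pz(1,3,4)] .
  then obtain s k where sk: "s\<^sup>2 = poly (disc v) t" "k \<noteq> 0" "p = k *s fixed_pt v t s"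
    using polar_isotropic[of p t v] t unfolding fibre_def fixed_pt_def by auto
  have z: "z = (z $ 2) *s vec2 t 1" by (rule proj_eq_snd[OF pz(3,4)])
  have "fst (\<rho> (p, z)) = (k ^ d * (z $ 2) ^ e) *s fst (\<rho> (?q (t, s)))"
    by (subst z) (simp add: sk(3) vec_eq_iff biform_scale[OF de])
  moreover have "snd (\<rho> (p, z)) = (k ^ d' * (z $ 2) ^ e') *s snd (\<rho> (?q (t, s)))"
    by (subst z) (simp add: sk(3) vec_eq_iff biform_scale[OF de'])
  ultimately have "fst (\<rho> (?q (t, s))) \<noteq> 0" "snd (\<rho> (?q (t, s))) \<noteq> 0"
    using pz(2) by (auto simp: bi_defined_def)
  then obtain j j' where j: "F j \<noteq> 0 \<or> G j \<noteq> 0" "F' j' \<noteq> 0 \<or> G' j' \<noteq> 0"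
    unfolding FG(3)[OF sk(1)] FG'(3)[OF sk(1)] vec_eq_iff by fastforce
  show ?thesis
  proof (rule conjugate_pair_discriminants[OF rv rw FG(1,2)])
    show "\<forall>\<^sub>F t in cofinite. t \<in> unit_segment \<longrightarrow> (\<forall>s x. s\<^sup>2 = poly (disc v) t \<longrightarrow>
      x = (\<chi> i. poly (F i) t + s * poly (G i) t) \<longrightarrow> x \<in> fibre t \<and> lor x (axis_vec w t) = 0)"
      using segment_quad_nonzero[where F = F and G = G, OF rv FG(1,2) j(1)]
        segment_quad_nonzero[where F = F' and G = G', OF rv FG'(1,2) j(2)] ev
        axis_norm_generic[OF real_axis_polar_a[OF rv]]
    proof eventually_elim
      case (elim t)
      show ?case
      proof (intro impI allI)
        fix s x assume t: "t \<in> unit_segment" and s: "s\<^sup>2 = poly (disc v) t"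
          and x: "x = (\<chi> i. poly (F i) t + s * poly (G i) t)"
        let ?r = "?q (t, s)"
        have xr: "x = fst (\<rho> ?r)" using FG(3)[OF s] x by simp
        have def: "bi_defined \<rho> ?r"
          unfolding bi_defined_def FG(3)[OF s] FG'(3)[OF s] using elim(1,2) t s by blast
        have "s \<noteq> 0" using s elim(3) by auto
        then have X: "?r \<in> fix_curve A"
          using fixed_pt_in_fix_curve[OF A v s] fixed_pt_nonzero elim(4) by simp
        then have Y: "(fst (\<rho> ?r), snd (\<rho> ?r)) \<in> fix_curve B"
          using rho def by (auto simp: bi_rational_map_def)
        have "proj_eq (snd (\<rho> ?r)) (vec2 t 1)" using pi X def by fastforce
        then obtain c where c: "c \<noteq> 0" "snd (\<rho> ?r) = c *s vec2 t 1" unfolding proj_eq_def by blast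
        show "x \<in> fibre t \<and> lor x (axis_vec w t) = 0"
          unfolding xr using fix_curve_fibre[OF B w Y, of t] c by simp
      qed
    qed
  qed
qed

section \<open>Conjugating maps on the fibres\<close>

lemma Bir_closed: "F \<in> Bir_S_pi \<Longrightarrow> p \<in> quadric_S \<Longrightarrow> F p \<noteq> 0 \<Longrightarrow> F p \<in> quadric_S"
  by (auto simp: Bir_S_pi_def rat_self_map_S_def)

lemma generic_nonzero:
  assumes F: "\<And>i. form K d (\<lambda>v. F v $ i)" and p: "p \<in> quadric_S" "F p \<noteq> 0"
  shows "\<forall>\<^sub>F t in cofinite. \<forall>\<^sub>F u in cofinite. F (psi t u) \<noteq> 0"
proof -
  obtain i where i: "F p $ i \<noteq> 0" using p by (auto simp: vec_eq_iff)
  show ?thesis using form_generic[OF F p(1) i]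
    by (rule eventually_mono) (erule eventually_mono, auto)
qed

text \<open>The point \<open>D y'\<close>, for a generic \<open>y'\<close> with
  \<open>f y' \<noteq> 0\<close>, is sent by \<open>C\<close> to a multiple of \<open>y'\<close>.
  This keeps compositions of tuples from vanishing identically.\<close>

lemma birational_dominant:
  assumes C: "C \<in> Bir_S_pi" and D: "D \<in> Bir_S_pi" and CD: "inverse_maps_S C D"
    and f: "form K d f" and y: "y \<in> quadric_S" "f y \<noteq> 0"
  shows "\<exists>x\<in>quadric_S. f (C x) \<noteq> 0"
proof -
  obtain c e where c: "\<And>i. form \<real> c (\<lambda>v. C v $ i)" and e: "\<And>i. form \<real> e (\<lambda>v. D v $ i)"
    using form_map_degree[OF C] form_map_degree[OF D] by metis
  obtain p where p: "p \<in> quadric_S" "C (D p) \<noteq> 0" and par: "\<And>q. q \<in> quadric_S \<Longrightarrow> par (C (D q)) q"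
    using CD by (auto simp: inverse_maps_S_def rat_eq_iff_par)
  obtain p' where p': "p' \<in> quadric_S" "D p' \<noteq> 0" using Bir_nonzero[OF D] by blast
  have "form \<real> (c * e) (\<lambda>v. C (D v) $ i)" for i by (rule form_compose[OF _ c e]) simp
  note g = eventually2_conj[OF form_generic[OF f y] eventually2_conj[OF generic_nonzero[OF this p]
        eventually2_conj[OF generic_nonzero[OF e p'] eventually2_neq_0]]]
  obtain t u where tu: "f (psi t u) \<noteq> 0" "C (D (psi t u)) \<noteq> 0" "D (psi t u) \<noteq> 0" "u \<noteq> 0"
    using eventually2_ex[OF g] by blast
  have S: "psi t u \<in> quadric_S" using psi_in_S tu by blast
  then obtain k where "C (D (psi t u)) = k *s psi t u"
    using par par_iff_scale by (metis quadric_S_iff)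
  then have "f (C (D (psi t u))) \<noteq> 0" using tu form_scale[OF f] by auto
  then show ?thesis using Bir_closed[OF D S tu(3)] by blast
qed

lemma order_two_inverse: "order_two A \<Longrightarrow> inverse_maps_S A A"
  by (simp add: inverse_maps_S_def order_two_def)

text \<open>At a generic point none of the tuples vanishes, so the parallelisms can be chained. The
  resulting relation consists of minors and extends to all points of the fibre, including those
  where \<open>C\<close> vanishes.\<close>

lemma conjugation_intertwines:
  assumes A: "A \<in> Bir_S_pi" and v: "axis_of A v" and B: "B \<in> Bir_S_pi" and w: "axis_of B w"
    and C: "C \<in> Bir_S_pi" and D: "D \<in> Bir_S_pi" and CD: "inverse_maps_S C D"
    and conj: "rat_eq quadric_S (C \<circ> A \<circ> D) B"
  shows "\<forall>\<^sub>F t in cofinite. \<forall>x\<in>fibre t.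
    par (half_turn (axis_vec w t) (C x)) (C (half_turn (axis_vec v t) x))"
proof -
  obtain b where b: "\<And>i. form \<real> b (\<lambda>v. B v $ i)" using form_map_degree[OF B] by metis
  obtain c where c: "\<And>i. form \<real> c (\<lambda>v. C v $ i)" using form_map_degree[OF C] by metis
  obtain a where a: "\<And>i. form \<real> a (\<lambda>v. A v $ i)" using form_map_degree[OF A] by metis
  obtain e where e: "\<And>i. form \<real> e (\<lambda>v. D v $ i)" using form_map_degree[OF D] by metis
  obtain pc where pc: "pc \<in> quadric_S" "C pc \<noteq> 0" using Bir_nonzero[OF C] by blast
  obtain pa where pa: "pa \<in> quadric_S" "A pa \<noteq> 0" using Bir_nonzero[OF A] by blast
  obtain pd where pd: "pd \<in> quadric_S" "D (C pd) \<noteq> 0" and par: "\<And>q. q \<in> quadric_S \<Longrightarrow> par (D (C q)) q"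
    using CD by (auto simp: inverse_maps_S_def rat_eq_iff_par)
  obtain pb where pb: "pb \<in> quadric_S" "B (C pb) \<noteq> 0"
  proof -
    obtain p i where "p \<in> quadric_S" "B p $ i \<noteq> 0" using Bir_nonzero[OF B] by (auto simp: vec_eq_iff)
    from birational_dominant[OF C D CD b this] show ?thesis using that by (metis zero_index)
  qed
  have dc: "form \<real> (e * c) (\<lambda>v. D (C v) $ i)" for i by (rule form_compose[OF _ e c]) simp
  have bc: "form \<real> (b * c) (\<lambda>v. B (C v) $ i)" for i by (rule form_compose[OF _ b c]) simp
  note g = eventually2_conj[OF generic_nonzero[OF dc pd] eventually2_conj[OF generic_nonzero[OF bc pb]
      eventually2_conj[OF generic_nonzero[OF c pc] eventually2_conj[OF generic_nonzero[OF a pa] eventually2_neq_0]]]]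
  have v': "\<forall>\<^sub>F t in cofinite. \<forall>x\<in>fibre t. par (A x) (half_turn (axis_vec v t) x)" "real_axis v"
    and w': "\<forall>\<^sub>F t in cofinite. \<forall>x\<in>fibre t. par (B x) (half_turn (axis_vec w t) x)" "real_axis w"
    using v w by (auto simp: axis_of_def)
  show ?thesis
    using g v'(1) w'(1) eventually_delta_neq_0 axis_norm_generic[OF v'(2)]
  proof eventually_elim
    case (elim t)
    let ?V = "axis_vec v t" and ?W = "axis_vec w t"
    have gen: "\<forall>\<^sub>F u in cofinite. par (half_turn ?W (C (psi t u))) (C (half_turn ?V (psi t u)))"
      using elim(1)
    proof eventually_elim
      case e: (elim u)
      let ?x = "psi t u"
      have x: "?x \<in> fibre t" "?x \<in> quadric_S" "?x \<noteq> 0" using e psi_in_fibre psi_in_S psi_nonzero by auto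
      have Cx: "C ?x \<in> fibre t" using Bir_S_pi_fibre[OF C elim(4) x(1)] e by blast
      then have CS: "C ?x \<in> quadric_S" using fibre_subset by blast
      obtain k where k: "D (C ?x) = k *s ?x" using par[OF x(2)] par_iff_scale[OF x(3)] by blast
      then have k0: "k \<noteq> 0" using e by auto
      have "par (C (A (D (C ?x)))) (B (C ?x))" using conj CS by (auto simp: rat_eq_iff_par)
      moreover have "C (A (D (C ?x))) = ((k ^ a) ^ c) *s C (A ?x)"
      proof -
        have e1: "A (k *s ?x) = (k ^ a) *s A ?x" by (simp add: vec_eq_iff form_scale[OF a])
        show ?thesis unfolding k e1 by (simp add: vec_eq_iff form_scale[OF c])
      qed
      ultimately have 1: "par (C (A ?x)) (B (C ?x))" using k0 by (simp add: par_scale_left_iff)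
      have 2: "par (B (C ?x)) (half_turn ?W (C ?x))" using elim(3) Cx by blast
      have nz: "half_turn ?V ?x \<noteq> 0" using half_turn_nonzero elim(5) x(3) by blast
      have "par (A ?x) (half_turn ?V ?x)" using elim(2) x(1) by blast
      then obtain m where m: "A ?x = m *s half_turn ?V ?x" using par_iff_scale[OF nz] by blast
      then have m0: "m \<noteq> 0" using e by auto
      have "C (A ?x) = (m ^ c) *s C (half_turn ?V ?x)"
        unfolding m by (simp add: vec_eq_iff form_scale[OF c])
      then have "par (C (half_turn ?V ?x)) (B (C ?x))" using 1 m0 by (simp add: par_scale_left_iff)
      then show ?case using 2 e par_sym par_trans by blast
    qed
    have f1: "form UNIV (1 * c) (\<lambda>x. half_turn ?W (C x) $ i)" for i
      by (rule form_compose[OF _ form_half_turn form_mono[OF c]]) simp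
    have f2: "form UNIV (c * 1) (\<lambda>x. C (half_turn ?V x) $ i)" for i
      by (rule form_compose[OF _ form_mono[OF c] form_half_turn]) simp
    show ?case using par_on_fibre[OF f1 f2 gen elim(4)] by blast
  qed
qed

text \<open>A parametrization of the fibre starting at a fixed point, on which \<open>half_turn\<close> acts by \<open>x \<mapsto> - x\<close>.\<close>

definition fibre_curve :: "complex poly ^ 3 \<Rightarrow> complex \<Rightarrow> complex \<Rightarrow> complex \<Rightarrow> complex ^ 4" where
  "fibre_curve v t s x = (let w = (t\<^sup>2 - 1) * axis_q (polar_a v) t in
     fixed_pt v t s + (2 * w * x) *s axis_vec v t + (w * x\<^sup>2) *s fixed_pt v t (- s))"

context
  fixes v :: "complex poly ^ 3" and t s a
  defines "a \<equiv> axis_vec (polar_a v) t"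
  assumes s: "s\<^sup>2 = poly (disc v) t" and t: "t\<^sup>2 \<noteq> 1" and nz: "axis_q v t \<noteq> 0"
    and nza: "lor a a \<noteq> 0"
begin

lemma s_nonzero: "s \<noteq> 0"
  using s t nz by (auto simp: poly_disc)

lemma lor_fixed_pts: "lor (fixed_pt v t s) (fixed_pt v t (- s)) = - 2 * poly (disc v) t * lor a a"
proof -
  have "lor (fixed_pt v t s) (fixed_pt v t (- s)) = lor (axis_vec (polar_b v) t) (axis_vec (polar_b v) t) - s\<^sup>2 * lor a a"
    unfolding fixed_pt_def a_def
    by (simp add: polar_ba lor_commute[of "axis_vec (polar_a v) t" "axis_vec (polar_b v) t"] power2_eq_square algebra_simps)
  then show ?thesis unfolding polar_bb s a_def by simp
qed

lemma fibre_curve_in_fibre: "fibre_curve v t s x \<in> fibre t"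
proof -
  let ?w = "(t\<^sup>2 - 1) * lor a a"
  have s': "(- s)\<^sup>2 = poly (disc v) t" using s by simp
  note p = fixed_pt_props[OF s] fixed_pt_props[OF s']
  have e: "fibre_curve v t s x = fixed_pt v t s + (2 * ?w * x) *s axis_vec v t + (?w * x\<^sup>2) *s fixed_pt v t (- s)"
    by (simp add: fibre_curve_def a_def Let_def)
  have "lor (fibre_curve v t s x) (fibre_curve v t s x) =
    (2 * ?w * x)\<^sup>2 * axis_q v t + 2 * (?w * x\<^sup>2) * lor (fixed_pt v t s) (fixed_pt v t (- s))"
    unfolding e using p
    by (simp add: lor_commute[of "axis_vec v t" "fixed_pt v t s"] lor_commute[of "axis_vec v t" "fixed_pt v t (- s)"] lor_commute[of "fixed_pt v t (- s)" "fixed_pt v t s"] power2_eq_square algebra_simps)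
  \<comment> \<open>The constant \<open>?w\<close> is chosen for this cancellation: the product of
    the two fixed points under \<open>lor\<close> is \<open>- 2 * ?w * axis_q v t\<close>.\<close>
  also have "\<dots> = 0" unfolding lor_fixed_pts poly_disc by (simp add: power2_eq_square algebra_simps)
  finally have 1: "lor (fibre_curve v t s x) (fibre_curve v t s x) = 0" .
  have "lor (fibre_curve v t s x) (fixed_pt v t (- s)) = lor (fixed_pt v t s) (fixed_pt v t (- s))"
    unfolding e using p by (simp add: lor_commute[of "axis_vec v t" "fixed_pt v t s"] lor_commute[of "axis_vec v t" "fixed_pt v t (- s)"])
  also have "\<dots> \<noteq> 0" unfolding lor_fixed_pts poly_disc using t nz nza by simp
  finally have "fibre_curve v t s x \<noteq> 0" by auto
  moreover have "fibre_curve v t s x $ 1 = t * fibre_curve v t s x $ 4"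
    unfolding e using p by (simp add: axis_vec_first algebra_simps)
  ultimately show ?thesis using 1 by (simp add: fibre_def)
qed

lemma half_turn_fibre_curve:
  "half_turn (axis_vec v t) (fibre_curve v t s x) = (- axis_q v t) *s fibre_curve v t s (- x)"
proof -
  have s': "(- s)\<^sup>2 = poly (disc v) t" using s by simp
  note p = fixed_pt_props[OF s] fixed_pt_props[OF s']
  show ?thesis unfolding half_turn_def fibre_curve_def Let_def using p
    by (simp add: vec4_eq_iff algebra_simps)
qed

text \<open>The condition excludes the conjugate fixed point, which has parameter infinity. In the
  basis of the two fixed points and the axis, with coefficients \<open>al\<close>, \<open>ga\<close>
  and \<open>b\<close>, isotropy of \<open>x\<close> reads \<open>b^2 = 4 al ga ?w\<close>, and the
  parameter is \<open>b / (2 ?w al)\<close>.\<close>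

lemma fibre_curve_covers:
  assumes x: "x \<in> fibre t" "lor x (fixed_pt v t (- s)) \<noteq> 0"
  shows "\<exists>k y. x = k *s fibre_curve v t s y"
proof -
  let ?V = "axis_vec v t" and ?P = "fixed_pt v t s" and ?M = "fixed_pt v t (- s)" and ?b = "axis_vec (polar_b v) t"
  let ?D = "poly (disc v) t"
  let ?w = "(t\<^sup>2 - 1) * lor a a"
  have s': "(- s)\<^sup>2 = poly (disc v) t" using s by simp
  note p = fixed_pt_props[OF s] fixed_pt_props[OF s']
  have D0: "?D \<noteq> 0" using t nz by (simp add: poly_disc)
  define b where "b = lor x ?V / lor ?V ?V"
  define x' where "x' = x - b *s ?V"
  have "lor x' ?V = 0" using nz by (simp add: x'_def b_def)
  moreover have "x' $ 1 = t * x' $ 4" using x by (simp add: x'_def fibre_def axis_vec_first algebra_simps)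
  ultimately have "(?D * lor a a) *s x' = (?D * lor x' a) *s a - lor x' ?b *s ?b"
    using polar_decompose[of x' t v] unfolding a_def by blast
  then have "(?D * lor a a) *s x' = (?D * lor a a) *s ((lor x' a / lor a a) *s a + (- lor x' ?b / (?D * lor a a)) *s ?b)"
    using D0 nza by (simp add: vec4_eq_iff field_simps)
  then have "x' = (lor x' a / lor a a) *s a + (- lor x' ?b / (?D * lor a a)) *s ?b"
    using D0 nza by (metis no_zero_divisors vector_mul_lcancel)
  then obtain l m where lm: "x' = l *s a + m *s ?b" by blast
  define r where "r = l / s"
  have ls: "l = r * s" using s_nonzero by (simp add: r_def)
  define al where "al = (m + r) / 2"
  define ga where "ga = (m - r) / 2"
  have "x' = al *s ?P + ga *s ?M"
  proof -
    have m: "m = al + ga" and r: "r = al - ga" by (simp_all add: al_def ga_def field_simps)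
    show ?thesis unfolding lm ls m r fixed_pt_def a_def[symmetric] by (simp add: vec4_eq_iff algebra_simps)
  qed
  then have xe: "x = al *s ?P + b *s ?V + ga *s ?M" by (simp add: x'_def algebra_simps)
  have "lor x ?M = al * lor ?P ?M" unfolding xe using p by (simp add: lor_commute[of ?V ?P] lor_commute[of ?V ?M])
  then have al: "al \<noteq> 0" using x(2) by auto
  have "0 = lor x x" using x by (simp add: fibre_def)
  also have "\<dots> = b\<^sup>2 * lor ?V ?V + 2 * al * ga * lor ?P ?M"
    unfolding xe using p by (simp add: lor_commute[of ?V ?P] lor_commute[of ?V ?M] lor_commute[of ?M ?P] power2_eq_square algebra_simps)
  also have "\<dots> = (b\<^sup>2 - 4 * al * ga * ?w) * lor ?V ?V"
    unfolding lor_fixed_pts poly_disc by (simp add: algebra_simps)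
  finally have bg: "b\<^sup>2 = 4 * al * ga * ?w" using nz by simp
  have w0: "?w \<noteq> 0" using t nza by simp
  define y where "y = b / (2 * ?w * al)"
  have 1: "al * (2 * ?w * y) = b" using al w0 by (simp add: y_def)
  have "al * (?w * y\<^sup>2) = b\<^sup>2 / (4 * al * ?w)"
  proof -
    have "W \<noteq> 0 \<Longrightarrow> al * (W * (b / (2 * W * al))\<^sup>2) = b\<^sup>2 / (4 * al * W)" for W
      using al by (simp add: power2_eq_square field_simps)
    then show ?thesis using w0 unfolding y_def by blast
  qed
  also have "\<dots> = ga" unfolding bg using al w0 by simp
  finally have 2: "al * (?w * y\<^sup>2) = ga" .
  have "x = al *s fibre_curve v t s y"
    unfolding xe fibre_curve_def Let_def a_def[symmetric] vector_add_ldistrib vector_smult_assoc 1 2 ..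
  then show ?thesis by blast
qed

end

section \<open>Polynomials in the outer variable \<open>x\<close> and the inner variable
  \<open>t\<close>\<close>

definition ev2 :: "complex poly poly \<Rightarrow> complex \<Rightarrow> complex \<Rightarrow> complex" where
  "ev2 P t x = poly (poly P [:x:]) t"

lemma ev2_simps [simp]:
  "ev2 (P + Q) t x = ev2 P t x + ev2 Q t x" "ev2 (P * Q) t x = ev2 P t x * ev2 Q t x"
  "ev2 [:p:] t x = poly p t" "ev2 0 t x = 0" "ev2 1 t x = 1" "ev2 (monom 1 k) t x = x ^ k"
  by (simp_all add: ev2_def poly_monom poly_power)

lemma ev2_zero: "ev2 P t 0 = poly (coeff P 0) t"
  by (simp add: ev2_def poly_0_coeff_0)

lemma ev2_poly_funs: "(\<lambda>x. ev2 P t x) \<in> poly_funs"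
proof (induction P)
  case 0
  show ?case by simp
next
  case (pCons p P)
  have "ev2 (pCons p P) t x = poly p t + x * ev2 P t x" for x
    by (simp add: ev2_def)
  then show ?case using pCons by (auto intro!: poly_funs_intros)
qed

definition poly2_over :: "complex set \<Rightarrow> complex poly poly \<Rightarrow> bool" where
  "poly2_over K P \<longleftrightarrow> (\<forall>i. poly_over K (coeff P i))"

lemma poly_over_sum: "coeff_ring K \<Longrightarrow> (\<And>i. i \<in> I \<Longrightarrow> poly_over K (f i)) \<Longrightarrow> poly_over K (sum f I)"
  by (induction I rule: infinite_finite_induct) (auto intro: poly_over_intros)

lemma poly2_over_intros:
  assumes "coeff_ring K"
  shows "poly2_over K P \<Longrightarrow> poly2_over K Q \<Longrightarrow> poly2_over K (P + Q)"
    "poly2_over K P \<Longrightarrow> poly2_over K Q \<Longrightarrow> poly2_over K (P * Q)"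
    "poly_over K p \<Longrightarrow> poly2_over K P \<Longrightarrow> poly2_over K (pCons p P)"
    "poly2_over K 0"
  using assms unfolding poly2_over_def coeff_mult
  by (auto intro!: poly_over_intros poly_over_sum simp: coeff_pCons split: nat.split)

text \<open>The analogue of \<open>quad_funs\<close> with the parameter \<open>x\<close> of
  \<open>fibre_curve\<close> as an additional polynomial variable.\<close>

definition quad_param_funs :: "complex set \<Rightarrow> complex poly \<Rightarrow> (complex \<times> complex \<times> complex \<Rightarrow> complex) set" where
  "quad_param_funs K D = {g. \<exists>P Q. poly2_over K P \<and> poly2_over K Q \<and>
     (\<forall>t s x. s\<^sup>2 = poly D t \<longrightarrow> g (t, s, x) = ev2 P t x + s * ev2 Q t x)}"

lemma quad_param_funs_algebra:
  assumes K: "coeff_ring K" and D: "poly_over K D"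
  shows "fun_algebra K (quad_param_funs K D)"
  unfolding fun_algebra_def
proof (intro conjI ballI)
  show "(\<lambda>_. k) \<in> quad_param_funs K D" if "k \<in> K" for k
    unfolding quad_param_funs_def using that K
    by (intro CollectI exI[of _ "[:[:k:]:]"] exI[of _ 0]) (auto intro!: poly_over_intros poly2_over_intros)
next
  fix f g assume "f \<in> quad_param_funs K D" "g \<in> quad_param_funs K D"
  then obtain F G F' G' where o: "poly2_over K F" "poly2_over K G" "poly2_over K F'" "poly2_over K G'"
    and f: "\<And>t s x. s\<^sup>2 = poly D t \<Longrightarrow> f (t, s, x) = ev2 F t x + s * ev2 G t x"
    and g: "\<And>t s x. s\<^sup>2 = poly D t \<Longrightarrow> g (t, s, x) = ev2 F' t x + s * ev2 G' t x"
    unfolding quad_param_funs_def by blast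
  show "(\<lambda>x. f x + g x) \<in> quad_param_funs K D"
    unfolding quad_param_funs_def
    by (intro CollectI exI[of _ "F + F'"] exI[of _ "G + G'"])
      (auto intro!: poly2_over_intros K o simp: f g algebra_simps)
  have "f (t, s, x) * g (t, s, x) = ev2 (F * F' + [:D:] * (G * G')) t x + s * ev2 (F * G' + G * F') t x"
    if "s\<^sup>2 = poly D t" for t s x
    unfolding f[OF that] g[OF that] ev2_simps by (simp flip: that) (simp add: power2_eq_square algebra_simps)
  then show "(\<lambda>x. f x * g x) \<in> quad_param_funs K D"
    unfolding quad_param_funs_def
    by (intro CollectI exI[of _ "F * F' + [:D:] * (G * G')"] exI[of _ "F * G' + G * F'"])
      (auto simp del: mult_pCons_left mult_pCons_right intro!: poly2_over_intros K D o)
qed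

lemma quad_param_funs_poly: "coeff_ring K \<Longrightarrow> poly_over K p \<Longrightarrow> (\<lambda>x. poly p (fst x)) \<in> quad_param_funs K D"
  unfolding quad_param_funs_def
  by (intro CollectI exI[of _ "[:p:]"] exI[of _ 0]) (auto intro!: poly2_over_intros)

lemma quad_param_funs_s: "coeff_ring K \<Longrightarrow> (\<lambda>x. fst (snd x)) \<in> quad_param_funs K D"
  unfolding quad_param_funs_def
  by (intro CollectI exI[of _ 0] exI[of _ "[:1:]"]) (auto intro!: poly_over_intros poly2_over_intros)

lemma quad_param_funs_x:
  assumes "coeff_ring K"
  shows "(\<lambda>x. snd (snd x)) \<in> quad_param_funs K D"
proof -
  have "ev2 [:0, 1:] t x = x" for t x by (simp add: ev2_def)
  moreover have "poly2_over K [:0, 1:]" using assms by (intro poly2_over_intros poly_over_intros)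
  ultimately show ?thesis unfolding quad_param_funs_def using assms
    by (intro CollectI exI[of _ "[:0, 1:]"] exI[of _ 0]) (auto intro: poly2_over_intros)
qed

lemma fibre_curve_quad:
  assumes v: "real_axis v"
  shows "(\<lambda>x. fibre_curve v (fst x) (fst (snd x)) (snd (snd x)) $ i) \<in> quad_param_funs \<real> (disc v)"
proof -
  have alg: "fun_algebra \<real> (quad_param_funs \<real> (disc v))"
    by (intro quad_param_funs_algebra poly_over_disc v) auto
  have add: "(\<lambda>x. f x + g x) \<in> quad_param_funs \<real> (disc v)" and mult: "(\<lambda>x. f x * g x) \<in> quad_param_funs \<real> (disc v)"
    if "f \<in> quad_param_funs \<real> (disc v)" "g \<in> quad_param_funs \<real> (disc v)" for f g
    using alg that by (auto simp: fun_algebra_def)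
  have const: "(\<lambda>x. k) \<in> quad_param_funs \<real> (disc v)" if "k \<in> \<real>" for k
    using alg that by (auto simp: fun_algebra_def)
  have poly: "(\<lambda>x. poly p (fst x)) \<in> quad_param_funs \<real> (disc v)" if "poly_over \<real> p" for p
    using that by (intro quad_param_funs_poly) auto
  have t: "fst \<in> quad_param_funs \<real> (disc v)"
    using poly[OF poly_over_X[OF coeff_ring_Reals]] by simp
  have axis: "(\<lambda>x. axis_vec w (fst x) $ i) \<in> quad_param_funs \<real> (disc v)" if "\<And>i. poly_over \<real> (w $ i)" for w i
    using exhaust_4[of i] that by (auto simp: axis_vec_def intro!: mult poly t)
  have ra: "\<And>i. poly_over \<real> (polar_a v $ i)" "\<And>i. poly_over \<real> (v $ i)"
    using v real_axis_polar_a[OF v] by (auto simp: real_axis_def)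
  note ax = axis[OF ra(1)] axis[OF ra(2)] axis[OF poly_over_polar_b[OF v]]
  have om: "(\<lambda>x. poly (delta_poly * axis_norm (polar_a v)) (fst x)) \<in> quad_param_funs \<real> (disc v)"
    by (intro poly poly_over_intros poly_over_delta poly_over_axis_norm real_axis_polar_a v) auto
  have fixp: "(\<lambda>x. fixed_pt v (fst x) (c * fst (snd x)) $ i) \<in> quad_param_funs \<real> (disc v)" if "c \<in> \<real>" for c i
    unfolding fixed_pt_def vector_add_component vector_smult_component
    by (intro add mult ax const that quad_param_funs_s) auto
  have "(\<lambda>x. fixed_pt v (fst x) (1 * fst (snd x)) $ i
      + (2 * poly (delta_poly * axis_norm (polar_a v)) (fst x) * snd (snd x)) * axis_vec v (fst x) $ i
      + (poly (delta_poly * axis_norm (polar_a v)) (fst x) * (snd (snd x) * snd (snd x))) * fixed_pt v (fst x) (- 1 * fst (snd x)) $ i)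
      \<in> quad_param_funs \<real> (disc v)"
    by (intro add mult fixp ax om const quad_param_funs_x) auto
  then show ?thesis
    by (simp add: fibre_curve_def Let_def poly_axis_norm power2_eq_square)
qed

text \<open>Here \<open>k\<close> is the lowest order in the outer variable among all entries.
  Dividing by this power makes the tuple nonzero at 0 as a vector of polynomials in
  \<open>t\<close>.\<close>

lemma divide_common_power:
  fixes P Q :: "'i \<Rightarrow> complex poly poly"
  assumes "P j \<noteq> 0 \<or> Q j \<noteq> 0"
  shows "\<exists>k P' Q'. (\<forall>i. P i = monom 1 k * P' i \<and> Q i = monom 1 k * Q' i) \<and>
    (\<exists>j. coeff (P' j) 0 \<noteq> 0 \<or> coeff (Q' j) 0 \<noteq> 0) \<and>
    (\<forall>i. P' i = poly_shift k (P i) \<and> Q' i = poly_shift k (Q i))"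
proof -
  define k where "k = (LEAST k. \<exists>j. coeff (P j) k \<noteq> 0 \<or> coeff (Q j) k \<noteq> 0)"
  have "\<exists>k j. coeff (P j) k \<noteq> 0 \<or> coeff (Q j) k \<noteq> 0" using assms by (auto simp: poly_eq_iff)
  then have k: "\<exists>j. coeff (P j) k \<noteq> 0 \<or> coeff (Q j) k \<noteq> 0" unfolding k_def by (rule LeastI_ex)
  have "coeff (P j) l = 0 \<and> coeff (Q j) l = 0" if "l < k" for l j
    using not_less_Least[OF that[unfolded k_def]] by blast
  then have "P i = monom 1 k * poly_shift k (P i) \<and> Q i = monom 1 k * poly_shift k (Q i)" for i
    by (auto simp: poly_eq_iff coeff_monom_mult coeff_poly_shift)
  then show ?thesis using k
    by (intro exI[of _ k] exI[of _ "\<lambda>i. poly_shift k (P i)"] exI[of _ "\<lambda>i. poly_shift k (Q i)"])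
      (auto simp: coeff_poly_shift)
qed

text \<open>Along \<open>fibre_curve\<close> the tuple \<open>C\<close> is \<open>x^k\<close> times
  a tuple \<open>H\<close> with coefficients \<open>F + s G\<close> at \<open>x = 0\<close>. The
  intertwining relation becomes \<open>half_turn w (H x)\<close> parallel to \<open>H (- x)\<close>;
  at \<open>x = 0\<close> it shows that \<open>H 0\<close> is fixed by the half-turn of
  \<open>w\<close>, hence lies on its polar line.\<close>

lemma conjugate_discriminants:
  assumes A: "A \<in> Bir_S_pi" and v: "axis_of A v" and B: "B \<in> Bir_S_pi" and w: "axis_of B w"
    and conj: "conjugate_Bir_S_pi A B"
  shows "norm_equivalent v w"
proof -
  have rv: "real_axis v" and rw: "real_axis w" using v w by (simp_all add: axis_of_def)
  obtain C D where C: "C \<in> Bir_S_pi" and D: "D \<in> Bir_S_pi" and CD: "inverse_maps_S C D"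
    and CAD: "rat_eq quadric_S (C \<circ> A \<circ> D) B" using conj unfolding conjugate_Bir_S_pi_def by blast
  obtain c where c: "\<And>i. form \<real> c (\<lambda>v. C v $ i)" using form_map_degree[OF C] by metis
  let ?g = "\<lambda>x i. C (fibre_curve v (fst x) (fst (snd x)) (snd (snd x))) $ i"
  have "(\<lambda>x. ?g x i) \<in> quad_param_funs \<real> (disc v)" for i
    by (intro form_fun_algebra[OF _ quad_param_funs_algebra c] fibre_curve_quad poly_over_disc rv) auto
  then have "\<forall>i. \<exists>PQ. poly2_over \<real> (fst PQ) \<and> poly2_over \<real> (snd PQ) \<and>
     (\<forall>t s x. s\<^sup>2 = poly (disc v) t \<longrightarrow> C (fibre_curve v t s x) $ i = ev2 (fst PQ) t x + s * ev2 (snd PQ) t x)"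
    unfolding quad_param_funs_def by fastforce
  then obtain PQ where PQ: "\<And>i. poly2_over \<real> (fst (PQ i)) \<and> poly2_over \<real> (snd (PQ i)) \<and>
     (\<forall>t s x. s\<^sup>2 = poly (disc v) t \<longrightarrow> C (fibre_curve v t s x) $ i = ev2 (fst (PQ i)) t x + s * ev2 (snd (PQ i)) t x)"
    by metis
  have good: "\<forall>\<^sub>F t in cofinite. t\<^sup>2 \<noteq> 1 \<and> axis_q v t \<noteq> 0 \<and>
     axis_q (polar_a v) t \<noteq> 0"
    using axis_norm_generic[OF rv] axis_norm_generic[OF real_axis_polar_a[OF rv]] eventually_delta_neq_0
    by eventually_elim simp
  \<comment> \<open>For a good \<open>t\<close> the curve covers the fibre up to one point, in
    particular some \<open>psi t u\<close> at which \<open>C\<close> does not vanish.\<close>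
  have "\<exists>j. fst (PQ j) \<noteq> 0 \<or> snd (PQ j) \<noteq> 0"
  proof -
    obtain p where p: "p \<in> quadric_S" "C p \<noteq> 0" using Bir_nonzero[OF C] by blast
    obtain t where t: "\<forall>\<^sub>F u in cofinite. C (psi t u) \<noteq> 0" "t\<^sup>2 \<noteq> 1" "axis_q v t \<noteq> 0"
       "axis_q (polar_a v) t \<noteq> 0"
      using eventually_happens'[OF cofinite_complex_nontriv eventually_conj[OF generic_nonzero[OF c p] good]] by blast
    define s where "s = csqrt (poly (disc v) t)"
    have s: "s\<^sup>2 = poly (disc v) t" "(- s)\<^sup>2 = poly (disc v) t" by (simp_all add: s_def)
    have s0: "s \<noteq> 0" by (rule s_nonzero[OF s(1) t(2-4)])
    have "fixed_pt v t s \<in> fibre t" using fixed_pt_props[OF s(1)] fixed_pt_nonzero[OF s0 t(4)] by (simp add: fibre_def)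
    moreover have "lor (fixed_pt v t s) (fixed_pt v t (- s)) \<noteq> 0"
      unfolding lor_fixed_pts[OF s(1) t(2-4)] using t by (simp add: poly_disc)
    ultimately have "\<forall>\<^sub>F u in cofinite. lor (psi t u) (fixed_pt v t (- s)) \<noteq> 0"
      by (intro fibre_generic[OF form_lor _ t(2)])
    from eventually_happens'[OF cofinite_complex_nontriv eventually_conj[OF eventually_conj[OF this t(1)] eventually_cofinite_neq[of 0]]]
    obtain u where u: "lor (psi t u) (fixed_pt v t (- s)) \<noteq> 0" "C (psi t u) \<noteq> 0" "u \<noteq> 0" by blast
    obtain k y where ky: "psi t u = k *s fibre_curve v t s y"
      using fibre_curve_covers[OF s(1) t(2-4) psi_in_fibre[OF u(3)] u(1)] by blast
    have "C (psi t u) = k ^ c *s C (fibre_curve v t s y)"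
      unfolding ky by (simp add: vec_eq_iff form_scale[OF c])
    then have "C (fibre_curve v t s y) \<noteq> 0" using u(2) by auto
    then obtain j where "C (fibre_curve v t s y) $ j \<noteq> 0" by (auto simp: vec_eq_iff)
    then have "ev2 (fst (PQ j)) t y + s * ev2 (snd (PQ j)) t y \<noteq> 0" using PQ s(1) by metis
    then show ?thesis by (intro exI[of _ j]) auto
  qed
  then obtain j where "fst (PQ j) \<noteq> 0 \<or> snd (PQ j) \<noteq> 0" by blast
  from divide_common_power[of "\<lambda>i. fst (PQ i)" j "\<lambda>i. snd (PQ i)", OF this]
  obtain k P Q where div: "\<And>i. fst (PQ i) = monom 1 k * P i" "\<And>i. snd (PQ i) = monom 1 k * Q i"
    and nz: "\<exists>j. coeff (P j) 0 \<noteq> 0 \<or> coeff (Q j) 0 \<noteq> 0"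
    and sh: "\<And>i. P i = poly_shift k (fst (PQ i))" "\<And>i. Q i = poly_shift k (snd (PQ i))" by metis
  define F where "F i = coeff (P i) 0" for i
  define G where "G i = coeff (Q i) 0" for i
  have FG: "poly_over \<real> (F i)" "poly_over \<real> (G i)" for i
    using PQ[of i] by (simp_all add: F_def G_def sh coeff_poly_shift poly2_over_def)
  define H where "H t s x = (\<chi> i. ev2 (P i) t x + s * ev2 (Q i) t x)" for t s x
  have H: "C (fibre_curve v t s x) = x ^ k *s H t s x" if "s\<^sup>2 = poly (disc v) t" for t s x
    using PQ that by (simp add: vec_eq_iff H_def div algebra_simps)
  have Hp: "(\<lambda>x. H t s x $ i) \<in> poly_funs" for t s i
    unfolding H_def by (auto intro!: poly_funs_intros ev2_poly_funs)
  obtain jj where "F jj \<noteq> 0 \<or> G jj \<noteq> 0" using nz by (auto simp: F_def G_def)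
  note nzev = segment_quad_nonzero[where F = F and G = G, OF rv FG this]
  show ?thesis
  proof (rule conjugate_pair_discriminants[OF rv rw FG])
    show "\<forall>\<^sub>F t in cofinite. t \<in> unit_segment \<longrightarrow> (\<forall>s x. s\<^sup>2 = poly (disc v) t \<longrightarrow>
      x = (\<chi> i. poly (F i) t + s * poly (G i) t) \<longrightarrow> x \<in> fibre t \<and> lor x (axis_vec w t) = 0)"
      using nzev good axis_norm_generic[OF rw] conjugation_intertwines[OF A v B w C D CD CAD]
    proof eventually_elim
      case (elim t)
      then have t: "t\<^sup>2 \<noteq> 1" "axis_q v t \<noteq> 0"
       "axis_q (polar_a v) t \<noteq> 0" by auto
      let ?W = "axis_vec w t"
      show ?case
      proof (intro impI allI)
        fix s x assume seg: "t \<in> unit_segment" and s: "s\<^sup>2 = poly (disc v) t"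
          and x: "x = (\<chi> i. poly (F i) t + s * poly (G i) t)"
        have x0: "x \<noteq> 0" unfolding x by (rule elim(1)[rule_format, OF seg s])
        have xH: "x = H t s 0" by (simp add: x H_def ev2_zero F_def G_def)
        note curve = fibre_curve_in_fibre[OF s t]
        have cprop: "lor (C (fibre_curve v t s y)) (C (fibre_curve v t s y)) = 0 \<and>
          C (fibre_curve v t s y) $ 1 = t * C (fibre_curve v t s y) $ 4" for y
          using Bir_S_pi_fibre[OF C t(1) curve[of y]]
          by (cases "C (fibre_curve v t s y) = 0") (auto simp: fibre_def)
        have Hprop: "lor (H t s y) (H t s y) = 0" "H t s y $ 1 - t * H t s y $ 4 = 0" if "y \<noteq> 0" for y
          using cprop[of y] that unfolding H[OF s] by auto
        have ev0: "\<forall>\<^sub>F y in cofinite. y \<noteq> (0 :: complex)" by (rule eventually_cofinite_neq)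
        have "lor x x = 0" unfolding xH
        proof (rule poly_funs_zero_eventually[of "\<lambda>y. lor (H t s y) (H t s y)"])
          show "(\<lambda>y. lor (H t s y) (H t s y)) \<in> poly_funs"
            unfolding lor_def by (intro poly_funs_intros Hp)
          show "\<forall>\<^sub>F y in cofinite. lor (H t s y) (H t s y) = 0"
            using ev0 by eventually_elim (rule Hprop)
        qed
        moreover have "x $ 1 - t * x $ 4 = 0" unfolding xH
        proof (rule poly_funs_zero_eventually[of "\<lambda>y. H t s y $ 1 - t * H t s y $ 4"])
          show "(\<lambda>y. H t s y $ 1 - t * H t s y $ 4) \<in> poly_funs"
            by (intro poly_funs_intros Hp poly_funs_const)
          show "\<forall>\<^sub>F y in cofinite. H t s y $ 1 - t * H t s y $ 4 = 0"
            using ev0 by eventually_elim (rule Hprop)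
        qed
        ultimately have xf: "x \<in> fibre t" using x0 by (simp add: fibre_def)
        have parH: "par (half_turn ?W (H t s y)) (H t s (- y))" if y: "y \<noteq> 0" for y
        proof -
          let ?q = "- axis_q v t"
          have "par (half_turn ?W (C (fibre_curve v t s y))) (C (half_turn (axis_vec v t) (fibre_curve v t s y)))"
            using elim(4) curve by blast
          moreover have "C (half_turn (axis_vec v t) (fibre_curve v t s y)) = (?q ^ c * (- y) ^ k) *s H t s (- y)"
          proof -
            have sc: "C (r *s z) = (r ^ c) *s C z" for r z by (simp add: vec_eq_iff form_scale[OF c])
            show ?thesis
              unfolding half_turn_fibre_curve[OF s t] sc H[OF s, of "- y"] vector_smult_assoc ..
          qed
          moreover have "half_turn ?W (C (fibre_curve v t s y)) = (y ^ k) *s half_turn ?W (H t s y)"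
            unfolding H[OF s] half_turn_scale ..
          ultimately show ?thesis using y t(2) by (simp add: par_scale_left_iff par_scale_right_iff)
        qed
        \<comment> \<open>The minors of \<open>half_turn ?W (H t s y)\<close> and
          \<open>H t s (- y)\<close> are polynomials in \<open>y\<close> that vanish for
          \<open>y \<noteq> 0\<close>, hence also at 0.\<close>
        have "par (half_turn ?W x) x"
          unfolding par_def
        proof (intro allI)
          fix i j
          have neg: "(\<lambda>y. H t s (- y) $ i) \<in> poly_funs" for i
          proof -
            obtain p where "\<And>y. H t s y $ i = poly p y" using Hp[of t s i] by (auto simp: poly_funs_def fun_eq_iff)
            then have "H t s (- y) $ i = poly (pcompose p [:0, - 1:]) y" for y by (simp add: poly_pcompose)
            then show ?thesis by simp
          qed
          have ht: "(\<lambda>y. half_turn ?W (H t s y) $ i) \<in> poly_funs" for i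
            by (rule poly_funs_form[OF form_half_turn Hp])
          have "half_turn ?W (H t s 0) $ i * H t s (- 0) $ j - half_turn ?W (H t s 0) $ j * H t s (- 0) $ i = 0"
          proof (rule poly_funs_zero_eventually[of "\<lambda>y. half_turn ?W (H t s y) $ i * H t s (- y) $ j - half_turn ?W (H t s y) $ j * H t s (- y) $ i"])
            show "\<forall>\<^sub>F y in cofinite. half_turn ?W (H t s y) $ i * H t s (- y) $ j - half_turn ?W (H t s y) $ j * H t s (- y) $ i = 0"
              using ev0 by eventually_elim (use parH in \<open>simp add: par_def\<close>)
          qed (intro poly_funs_intros ht neg)
          then show "half_turn ?W x $ i * x $ j = half_turn ?W x $ j * x $ i" by (simp add: xH)
        qed
        moreover have "lor x x = 0" using xf by (simp add: fibre_def)
        ultimately have "lor x ?W = 0" by (intro half_turn_par_self[OF elim(3) _ x0])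
        with xf show "x \<in> fibre t \<and> lor x ?W = 0" by blast
      qed
    qed
  qed
qed

section \<open>Conjugation by a half-turn\<close>

lemma par_on_S:
  assumes F: "\<And>i. form K d (\<lambda>v. F v $ i)" and G: "\<And>i. form K' e (\<lambda>v. G v $ i)"
    and gen: "\<forall>\<^sub>F t in cofinite. \<forall>\<^sub>F u in cofinite. par (F (psi t u)) (G (psi t u))"
    and p: "p \<in> quadric_S"
  shows "par (F p) (G p)"
proof (rule ccontr)
  assume "\<not> ?thesis"
  then obtain i j where ij: "F p $ i * G p $ j - F p $ j * G p $ i \<noteq> 0" by (auto simp: par_def)
  have "form UNIV (d + e) (\<lambda>v. F v $ i * G v $ j - F v $ j * G v $ i)"
    by (intro form_diff form_mult form_mono[OF F] form_mono[OF G]) auto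
  from eventually2_ex[OF eventually2_conj[OF form_generic[OF this p ij] gen]]
  show False by (auto simp: par_def)
qed

text \<open>The half-turns of all fibres in one tuple of forms: the homogenized axis is evaluated at
  the base point of \<open>p\<close>.\<close>

definition axis_map :: "complex poly ^ 3 \<Rightarrow> complex ^ 4 \<Rightarrow> complex ^ 4" where
  "axis_map n p = half_turn (axis_form n (pi_S p)) p"

lemma axis_map_affine:
  assumes "p $ 1 = t * p $ 4"
  shows "axis_map n p = ((p $ 4) ^ Suc (axis_degree n))\<^sup>2 *s half_turn (axis_vec n t) p"
  unfolding axis_map_def using axis_form_affine[of "pi_S p" t n] assms
  by (simp add: half_turn_scale_axis del: power_Suc)

lemma axis_map_fibre:
  assumes "p \<in> fibre t" "p $ 4 \<noteq> 0"
  shows "\<exists>c. c \<noteq> 0 \<and> axis_map n p = c *s half_turn (axis_vec n t) p"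
  using assms axis_map_affine[of p t n] unfolding fibre_def
  by (intro exI[of _ "((p $ 4) ^ Suc (axis_degree n))\<^sup>2"]) (simp del: power_Suc)

lemma half_turn_fibre:
  assumes "axis_q n t \<noteq> 0" "p \<in> fibre t"
  shows "half_turn (axis_vec n t) p \<in> fibre t"
proof -
  have "half_turn (axis_vec n t) p \<noteq> 0" using assms half_turn_nonzero by (auto simp: fibre_def)
  moreover have "lor (half_turn (axis_vec n t) p) (half_turn (axis_vec n t) p) = 0"
    using assms by (simp add: lor_half_turn fibre_def)
  moreover have "half_turn (axis_vec n t) p $ 1 = t * half_turn (axis_vec n t) p $ 4"
    using assms by (simp add: half_turn_def fibre_def axis_vec_first algebra_simps)
  ultimately show ?thesis by (simp add: fibre_def)
qed

lemma form_axis_map: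
  assumes "real_axis n"
  shows "form \<real> (2 * Suc (axis_degree n) + 1) (\<lambda>p. axis_map n p $ i)"
proof -
  let ?e = "Suc (axis_degree n)"
  have pi: "form \<real> 1 (\<lambda>p. pi_S p $ k)" for k
    using exhaust_2[of k] form_coord[OF coeff_ring_Reals] by auto
  have N: "form \<real> ?e (\<lambda>p. axis_form n (pi_S p) $ k)" for k
    using form_compose[OF coeff_ring_Reals form_axis_form pi] assms by (auto simp: real_axis_def)
  have 1: "form \<real> (1 + ?e) (\<lambda>p. lor p (axis_form n (pi_S p)))"
    unfolding lor_def by (intro form_add form_diff form_mult N form_coord coeff_ring_Reals)
  have 2: "form \<real> (?e + ?e) (\<lambda>p. lor (axis_form n (pi_S p)) (axis_form n (pi_S p)))"
    unfolding lor_def by (intro form_add form_diff form_mult N form_coord coeff_ring_Reals)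
  have "form \<real> (2 * ?e + 1) (\<lambda>p. 2 * (lor p (axis_form n (pi_S p)) * axis_form n (pi_S p) $ i)
     - lor (axis_form n (pi_S p)) (axis_form n (pi_S p)) * p $ i)"
    by (intro form_diff form_cmul form_mult'[OF _ 1 N] form_mult'[OF _ 2 form_coord]) auto
  then show ?thesis by (simp add: axis_map_def half_turn_def mult.assoc)
qed

text \<open>One witness on the fibre is enough: the half-turn sends the image of
  \<open>psi t 1\<close> back to a multiple of \<open>psi t 1\<close>, whose last coordinate is
  nonzero.\<close>

lemma axis_map_generic:
  assumes n: "real_axis n"
  shows "\<forall>\<^sub>F t in cofinite. \<forall>\<^sub>F u in cofinite. u \<noteq> 0 \<and> half_turn (axis_vec n t) (psi t u) $ 4 \<noteq> 0"
  using axis_norm_generic[OF n] eventually_delta_neq_0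
proof eventually_elim
  case (elim t)
  have p: "psi t 1 \<in> fibre t" by (rule psi_in_fibre) simp
  have "half_turn (axis_vec n t) (half_turn (axis_vec n t) (psi t 1)) $ 4 \<noteq> 0"
    using elim(1) by (simp add: half_turn_twice)
  from eventually_conj[OF eventually_cofinite_neq fibre_generic[OF form_half_turn half_turn_fibre[OF elim(1) p] elim(2) this]]
  show ?case .
qed

lemma axis_map_Bir:
  assumes n: "real_axis n"
  shows "axis_map n \<in> Bir_S_pi" "inverse_maps_S (axis_map n) (axis_map n)"
proof -
  let ?T = "axis_map n" and ?d = "2 * Suc (axis_degree n) + 1"
  note T = form_axis_map[OF n]
  have TT: "form \<real> (?d * ?d) (\<lambda>p. ?T (?T p) $ i)" for i by (rule form_compose[OF _ T T]) simp
  have gen: "\<forall>\<^sub>F t in cofinite. \<forall>\<^sub>F u in cofinite.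
      u \<noteq> 0 \<and> ?T (psi t u) $ 4 \<noteq> 0 \<and> ?T (?T (psi t u)) \<noteq> 0 \<and> par (?T (?T (psi t u))) (psi t u)"
    using axis_map_generic[OF n] axis_norm_generic[OF n]
  proof eventually_elim
    case (elim t)
    let ?N = "axis_vec n t"
    show ?case using elim(1)
    proof eventually_elim
      case e: (elim u)
      then have f: "psi t u \<in> fibre t" using psi_in_fibre by blast
      obtain c where c: "c \<noteq> 0" "?T (psi t u) = c *s half_turn ?N (psi t u)"
        using axis_map_fibre[OF f] e by auto
      have f': "?T (psi t u) \<in> fibre t" "?T (psi t u) $ 4 \<noteq> 0"
        unfolding c(2) using c(1) e half_turn_fibre[OF elim(2) f] by (auto simp: fibre_scale)
      obtain k where k: "k \<noteq> 0" "?T (?T (psi t u)) = k *s half_turn ?N (?T (psi t u))"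
        using axis_map_fibre[OF f'] by auto
      have "half_turn ?N (?T (psi t u)) = (c * (lor ?N ?N)\<^sup>2) *s psi t u"
        unfolding c(2) half_turn_scale half_turn_twice vector_smult_assoc ..
      then have "?T (?T (psi t u)) = (k * c * (lor ?N ?N)\<^sup>2) *s psi t u"
        using k(2) by (simp add: vector_smult_assoc mult.assoc)
      moreover have "par ((k * c * (lor ?N ?N)\<^sup>2) *s psi t u) (psi t u)" by (intro par_scale_left) simp
      ultimately show ?case using f' e k(1) c(1) elim(2) psi_nonzero by simp
    qed
  qed
  obtain t u where tu: "u \<noteq> 0" "?T (psi t u) $ 4 \<noteq> 0" "?T (?T (psi t u)) \<noteq> 0"
    using eventually2_ex[OF gen] by blast
  have S: "psi t u \<in> quadric_S" using psi_in_S tu by blast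
  have "form_map \<real> ?T" unfolding form_map_def using T by blast
  moreover have "?T (psi t u) \<noteq> 0" using tu(2) by auto
  moreover have "?T p \<in> quadric_S" if "p \<in> quadric_S" "?T p \<noteq> 0" for p
    using that by (simp add: quadric_S_iff axis_map_def lor_half_turn)
  ultimately have self: "rat_self_map_S ?T" unfolding rat_self_map_S_def using S by blast
  have "par (?T (?T p)) p" if "p \<in> quadric_S" for p
    by (rule par_on_S[OF TT form_coord[OF coeff_ring_UNIV] _ that])
      (use gen in \<open>auto elim!: eventually_mono\<close>)
  moreover have "\<exists>p\<in>quadric_S. p \<noteq> 0" using S by (auto simp: quadric_S_iff)
  ultimately have "rat_eq quadric_S (?T \<circ> ?T) id" unfolding rat_eq_iff_par using S tu(3) by auto
  then show inv: "inverse_maps_S ?T ?T" by (simp add: inverse_maps_S_def)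
  have "par (pi_S (?T p)) (pi_S p)" for p
  proof -
    have "axis_form n (pi_S p) $ 1 * p $ 4 = axis_form n (pi_S p) $ 4 * p $ 1"
      using axis_form_first[of n "pi_S p"] by simp
    then have "?T p $ 1 * p $ 4 = ?T p $ 4 * p $ 1"
      by (simp add: axis_map_def half_turn_def) algebra
    then show ?thesis by (auto simp: par_def forall_2)
  qed
  moreover have "pi_S (?T (psi t u)) \<noteq> 0" "pi_S (psi t u) \<noteq> 0"
    using tu by (auto simp: vec_eq_iff forall_2)
  ultimately have "rat_eq quadric_S (pi_S \<circ> ?T) pi_S"
    unfolding rat_eq_iff_par using S by auto
  then show "?T \<in> Bir_S_pi" unfolding Bir_S_pi_def using self inv by blast
qed

text \<open>Conjugation by an isometry moves the axis. The unnormalised half-turn is quadratic in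
  its axis, which absorbs exactly the factor \<open>(lor n n)^2\<close>.\<close>

lemma half_turn_conjugate:
  "half_turn n (half_turn v (half_turn n x)) = half_turn (half_turn n v) x"
proof -
  have "lor (half_turn n x) v = lor x (half_turn n v)" 
    by (simp add: half_turn_def lor_commute algebra_simps)
  moreover have "half_turn n (half_turn v (half_turn n x)) =
    (2 * lor (half_turn n x) v) *s half_turn n v - (lor v v * (lor n n)\<^sup>2) *s x"
    unfolding half_turn_twice[symmetric] vector_smult_assoc[symmetric]
    by (simp add: half_turn_def[of v] half_turn_def[of n] vec4_eq_iff algebra_simps)
  ultimately show ?thesis
    by (simp add: half_turn_def[of "half_turn n v"] lor_half_turn mult.commute)
qed

definition maps_axis :: "complex poly ^ 3 \<Rightarrow> complex poly ^ 3 \<Rightarrow> complex poly ^ 3 \<Rightarrow> bool" where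
  "maps_axis n v w \<longleftrightarrow> (\<forall>\<^sub>F t in cofinite. \<exists>c. c \<noteq> 0 \<and>
     half_turn (axis_vec n t) (axis_vec v t) = c *s axis_vec w t)"

text \<open>On a generic fibre the conjugate of the half-turn about \<open>v\<close> is the
  half-turn about the image of \<open>v\<close>, which is proportional to \<open>w\<close>.
  Dominance of the factors ensures that the composed tuple is not identically zero.\<close>

lemma axis_map_conjugates:
  assumes A: "A \<in> Bir_S_pi" "order_two A" and v: "axis_of A v" and B: "B \<in> Bir_S_pi" and w: "axis_of B w"
    and n: "real_axis n"
    and nv: "maps_axis n v w"
  shows "conjugate_Bir_S_pi A B"
proof -
  let ?T = "axis_map n" and ?d = "2 * Suc (axis_degree n) + 1"
  note T = form_axis_map[OF n]
  obtain a where a: "\<And>i. form \<real> a (\<lambda>v. A v $ i)" using form_map_degree[OF A(1)] by metis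
  obtain b where b: "\<And>i. form \<real> b (\<lambda>v. B v $ i)" using form_map_degree[OF B] by metis
  have AT: "form \<real> (a * ?d) (\<lambda>p. A (?T p) $ i)" for i by (rule form_compose[OF _ a T]) simp
  have TA: "form \<real> (?d * a) (\<lambda>p. ?T (A p) $ i)" for i by (rule form_compose[OF _ T a]) simp
  have TAT: "form \<real> (?d * (a * ?d)) (\<lambda>p. ?T (A (?T p)) $ i)" for i by (rule form_compose[OF _ T AT]) simp
  have "\<exists>p\<in>quadric_S. ?T (A (?T p)) \<noteq> 0"
  proof -
    obtain y i where "y \<in> quadric_S" "?T y $ i \<noteq> 0"
      using Bir_nonzero[OF axis_map_Bir(1)[OF n]] by (auto simp: vec_eq_iff)
    from birational_dominant[OF A(1) A(1) order_two_inverse[OF A(2)] T this]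
    obtain x where "x \<in> quadric_S" "?T (A x) $ i \<noteq> 0" by blast
    from birational_dominant[OF axis_map_Bir(1)[OF n] axis_map_Bir(1)[OF n] axis_map_Bir(2)[OF n] TA this]
    show ?thesis by (metis zero_index)
  qed
  moreover have "\<exists>p\<in>quadric_S. B p \<noteq> 0" using Bir_nonzero[OF B] .
  moreover have "par (?T (A (?T p))) (B p)" if p: "p \<in> quadric_S" for p
  proof (rule par_on_S[OF TAT b _ p])
    have v': "\<forall>\<^sub>F t in cofinite. \<forall>x\<in>fibre t. par (A x) (half_turn (axis_vec v t) x)" "real_axis v"
      and w': "\<forall>\<^sub>F t in cofinite. \<forall>x\<in>fibre t. par (B x) (half_turn (axis_vec w t) x)" "real_axis w"
      using v w by (auto simp: axis_of_def)
    show "\<forall>\<^sub>F t in cofinite. \<forall>\<^sub>F u in cofinite. par (?T (A (?T (psi t u)))) (B (psi t u))"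
      using v'(1) w'(1) nv[unfolded maps_axis_def] axis_norm_generic[OF n] axis_norm_generic[OF v'(2)] axis_norm_generic[OF w'(2)]
    proof eventually_elim
      case (elim t)
      let ?N = "axis_vec n t" and ?V = "axis_vec v t" and ?W = "axis_vec w t"
      obtain c where c: "c \<noteq> 0" "half_turn ?N ?V = c *s ?W" using elim(3) by blast
      show ?case using eventually_cofinite_neq[of 0]
      proof eventually_elim
        case (elim u)
        let ?x = "psi t u"
        have x: "?x \<in> fibre t" "?x \<noteq> 0" "?x $ 4 \<noteq> 0" using elim psi_in_fibre psi_nonzero by auto
        obtain c1 where c1: "c1 \<noteq> 0" "?T ?x = c1 *s half_turn ?N ?x"
          using axis_map_fibre[OF x(1,3)] by blast
        let ?y = "half_turn ?N ?x"
        have y: "?y \<in> fibre t" using half_turn_fibre x(1) \<open>lor ?N ?N \<noteq> 0\<close> by blast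
        let ?z = "half_turn ?V ?y"
        have z: "?z \<in> fibre t" using half_turn_fibre y \<open>lor ?V ?V \<noteq> 0\<close> by blast
        then have z0: "?z \<noteq> 0" by (simp add: fibre_def)
        have "par (A ?y) ?z" using \<open>\<forall>x\<in>fibre t. par (A x) (half_turn ?V x)\<close> y by blast
        then obtain c2 where c2: "A ?y = c2 *s ?z" using par_iff_scale[OF z0] by blast
        have scA: "A (r *s p) = (r ^ a) *s A p" for r p by (simp add: vec_eq_iff form_scale[OF a])
        have scT: "?T (r *s p) = (r ^ ?d) *s ?T p" for r p
          by (simp only: vec_eq_iff form_scale[OF T] vector_smult_component) simp
        have 1: "?T (A (?T ?x)) = ((c1 ^ a * c2) ^ ?d) *s ?T ?z"
          unfolding c1(2) scA c2 vector_smult_assoc scT ..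
        have "?T ?z = ((?z $ 4) ^ Suc (axis_degree n))\<^sup>2 *s half_turn ?N ?z"
          using axis_map_affine z by (simp only: fibre_def mem_Collect_eq)
        also have "half_turn ?N ?z = (c\<^sup>2) *s half_turn ?W ?x"
          unfolding half_turn_conjugate c(2) half_turn_scale_axis ..
        finally have "par (?T (A (?T ?x))) (half_turn ?W ?x)"
          unfolding 1 by (intro par_scale_left) (simp add: par_scale_left)
        moreover have "par (B ?x) (half_turn ?W ?x)" using \<open>\<forall>x\<in>fibre t. par (B x) (half_turn ?W x)\<close> x(1) by blast
        moreover have "half_turn ?W ?x \<noteq> 0" using half_turn_nonzero \<open>lor ?W ?W \<noteq> 0\<close> x(2) by blast
        ultimately show ?case using par_sym par_trans by blast
      qed
    qed
  qed
  ultimately have "rat_eq quadric_S (?T \<circ> A \<circ> ?T) B" by (simp add: rat_eq_iff_par)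
  then show ?thesis unfolding conjugate_Bir_S_pi_def using axis_map_Bir[OF n] by blast
qed

text \<open>The counterpart of \<open>axis_map\<close> on the blown-up surface. The axis is
  evaluated at the separate base coordinate, which is available even over the base-points of
  \<open>pi\<close>.\<close>

definition axis_bimap :: "complex poly ^ 3 \<Rightarrow> (complex ^ 4) \<times> (complex ^ 2) \<Rightarrow> (complex ^ 4) \<times> (complex ^ 2)" where
  "axis_bimap n q = (half_turn (axis_form n (snd q)) (fst q), snd q)"

lemma biform_axis_bimap:
  assumes "real_axis n"
  shows "biform \<real> 1 (2 * Suc (axis_degree n)) (\<lambda>q. half_turn (axis_form n (snd q)) (fst q) $ i)"
proof -
  let ?e = "Suc (axis_degree n)"
  have N: "biform \<real> 0 ?e (\<lambda>q :: (complex ^ 4) \<times> (complex ^ 2). axis_form n (snd q) $ k)" for k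
    using assms by (intro biform_snd form_axis_form) (auto simp: real_axis_def)
  have f: "biform \<real> 1 0 (\<lambda>q :: (complex ^ 4) \<times> (complex ^ 2). fst q $ k)" for k
    by (intro biform_fst_coord coeff_ring_Reals)
  note l = biform_lor[OF coeff_ring_Reals f N] biform_lor[OF coeff_ring_Reals N N]
  have "biform \<real> 1 (2 * ?e) (\<lambda>q :: (complex ^ 4) \<times> (complex ^ 2). 2 * (lor (fst q) (axis_form n (snd q)) * axis_form n (snd q) $ i)
     - lor (axis_form n (snd q)) (axis_form n (snd q)) * fst q $ i)"
    by (intro biform_diff biform_cmul biform_mult'[OF _ l(1) N] biform_mult'[OF _ l(2) f]) auto
  then show ?thesis by (simp add: half_turn_def mult.assoc)
qed

lemma axis_bimap_affine:
  assumes "z $ 1 = t * z $ 2"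
  shows "axis_bimap n (p, z) = (((z $ 2) ^ Suc (axis_degree n))\<^sup>2 *s half_turn (axis_vec n t) p, z)"
  using axis_form_affine[OF assms, of n] by (simp add: axis_bimap_def half_turn_scale_axis del: power_Suc)

text \<open>An isometry that moves \<open>v\<close> to \<open>w\<close> moves the polar line of
  \<open>v\<close> to that of \<open>w\<close>. A biform that vanishes at the fixed points of
  \<open>B\<close> over generic \<open>t\<close> therefore pulls back to one that vanishes on the
  curve of \<open>A\<close>.\<close>

lemma axis_bimap_rational:
  assumes A: "A \<in> Bir_S_pi" and v: "axis_of A v" and B: "B \<in> Bir_S_pi" and w: "axis_of B w"
    and n: "real_axis n"
    and nv: "maps_axis n v w"
  shows "bi_rational_map \<real> (fix_curve A) (fix_curve B) (axis_bimap n)"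
    and "fix_curve A \<subseteq> zariski_closure
      {q \<in> fix_curve A. bi_defined (axis_bimap n) q \<and> bi_proj_eq (axis_bimap n (axis_bimap n q)) q}"
proof -
  let ?r = "axis_bimap n"
  have good: "(p, z) \<in> {q \<in> fix_curve A. bi_defined ?r q \<and> bi_proj_eq (?r (?r q)) q}"
    if "axis_q n t \<noteq> 0" "(p, z) \<in> fix_curve A" "z $ 2 \<noteq> 0" "z $ 1 = t * z $ 2" for t p z
  proof -
    have p: "p \<noteq> 0" "z \<noteq> 0" using fix_curve_nonzero[OF that(2)] by auto
    define c where "c = ((z $ 2) ^ Suc (axis_degree n))\<^sup>2"
    have c: "c \<noteq> 0" using that(3) by (simp add: c_def)
    have r: "?r (x, z) = (c *s half_turn (axis_vec n t) x, z)" for x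
      unfolding c_def by (rule axis_bimap_affine[OF that(4)])
    have "bi_defined ?r (p, z)"
      using half_turn_nonzero[OF that(1) p(1)] c p(2) by (simp add: bi_defined_def r)
    moreover have "?r (?r (p, z)) = ((c * c * (axis_q n t)\<^sup>2) *s p, z)"
      unfolding r half_turn_scale half_turn_twice by (simp add: mult.assoc)
    then have "bi_proj_eq (?r (?r (p, z))) (p, z)"
      unfolding bi_proj_eq_def using c that(1)
      by (auto simp: proj_eq_def[of _ p] intro!: exI[of _ "c * c * (axis_q n t)\<^sup>2"])
    ultimately show ?thesis using that(2) by blast
  qed
  show dense: "fix_curve A \<subseteq> zariski_closure
      {q \<in> fix_curve A. bi_defined ?r q \<and> bi_proj_eq (?r (?r q)) q}"
    by (rule fix_curve_dense[OF A v axis_norm_generic[OF n] good])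
  have maps: "?r q \<in> fix_curve B" if q: "q \<in> fix_curve A" and def: "bi_defined ?r q" for q
    unfolding fix_curve_def
  proof (intro INT_I)
    fix E :: "(complex ^ 2) set" assume "E \<in> {E. finite E}"
    then have E: "finite E" by simp
    show "?r q \<in> zariski_closure (fixed_points_off B E)"
      unfolding zariski_closure_def
    proof (intro CollectI conjI allI impI)
      fix d e f assume f: "biform UNIV d e f" and van: "\<forall>m\<in>fixed_points_off B E. f m = 0"
      have g: "biform UNIV (d * 1) (d * (2 * Suc (axis_degree n)) + e) (\<lambda>q. f (half_turn (axis_form n (snd q)) (fst q), snd q))"
      proof (rule biform_compose_fst[OF coeff_ring_UNIV f])
        show "biform UNIV 1 (2 * Suc (axis_degree n)) (\<lambda>q. half_turn (axis_form n (snd q)) (fst q) $ i)" for i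
          using biform_axis_bimap[OF n, of i] unfolding biform_def by blast
      qed
      have ev: "\<forall>\<^sub>F t in cofinite. (\<exists>c. c \<noteq> 0 \<and> half_turn (axis_vec n t) (axis_vec v t) = c *s axis_vec w t) \<and>
        axis_q n t \<noteq> 0 \<and> (\<forall>e\<in>E. \<not> proj_eq (vec2 t 1) e) \<and>
        (\<forall>z. z $ 2 \<noteq> 0 \<longrightarrow> z $ 1 = t * z $ 2 \<longrightarrow> fixed_on_conic A z = {p \<in> fibre t. lor p (axis_vec v t) = 0}) \<and>
        (\<forall>z. z $ 2 \<noteq> 0 \<longrightarrow> z $ 1 = t * z $ 2 \<longrightarrow> fixed_on_conic B z = {p \<in> fibre t. lor p (axis_vec w t) = 0})"
        by (intro eventually_conj nv[unfolded maps_axis_def] axis_norm_generic[OF n] eventually_not_proj_eq[OF E]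
            fixed_on_conic_generic[OF A v] fixed_on_conic_generic[OF B w])
      have "(\<lambda>q. f (half_turn (axis_form n (snd q)) (fst q), snd q)) q = 0"
      proof (rule fix_curve_vanish[OF q g ev], elim conjE exE)
        fix t p z c
        assume z: "z $ 2 \<noteq> 0" "z $ 1 = t * z $ 2" and p: "p \<in> fixed_on_conic A z"
          and c: "c \<noteq> (0 :: complex)" "half_turn (axis_vec n t) (axis_vec v t) = c *s axis_vec w t"
          and nn: "axis_q n t \<noteq> 0" and tE: "\<forall>e\<in>E. \<not> proj_eq (vec2 t 1) e"
          and fA: "\<forall>z. z $ 2 \<noteq> 0 \<longrightarrow> z $ 1 = t * z $ 2 \<longrightarrow> fixed_on_conic A z = {p \<in> fibre t. lor p (axis_vec v t) = 0}"
          and fB: "\<forall>z. z $ 2 \<noteq> 0 \<longrightarrow> z $ 1 = t * z $ 2 \<longrightarrow> fixed_on_conic B z = {p \<in> fibre t. lor p (axis_vec w t) = 0}"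
        have p': "p \<in> fibre t" "lor p (axis_vec v t) = 0" using p fA z by auto
        define k where "k = ((z $ 2) ^ Suc (axis_degree n))\<^sup>2"
        have k: "k \<noteq> 0" using z by (simp add: k_def)
        let ?h = "half_turn (axis_vec n t) p"
        have "c * lor ?h (axis_vec w t) = lor ?h (half_turn (axis_vec n t) (axis_vec v t))" by (simp add: c(2))
        also have "\<dots> = 0" by (simp add: lor_half_turn p')
        finally have "lor ?h (axis_vec w t) = 0" using c(1) by simp
        moreover have "?h \<in> fibre t" by (rule half_turn_fibre[OF nn p'(1)])
        ultimately have "k *s ?h \<in> fixed_on_conic B z" using fB z k by (simp add: fibre_scale)
        moreover have "\<not> proj_eq z e" if "e \<in> E" for e
        proof
          assume "proj_eq z e"
          moreover have "proj_eq (vec2 t 1) z" 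
            using proj_eq_snd[OF z] z(1) proj_eq_sym unfolding proj_eq_def by metis
          ultimately show False using tE that proj_eq_trans by blast
        qed
        moreover have "z \<noteq> 0" using z by auto
        ultimately have "(k *s ?h, z) \<in> fixed_points_off B E" by (simp add: fixed_points_off_def)
        then have "f (k *s ?h, z) = 0" using van by blast
        then show "f (half_turn (axis_form n (snd (p, z))) (fst (p, z)), snd (p, z)) = 0"
          using axis_bimap_affine[OF z(2), of n p] by (simp add: axis_bimap_def k_def del: power_Suc)
      qed
      then show "f (?r q) = 0" by (simp add: axis_bimap_def)
    qed (use def in \<open>simp_all add: bi_defined_def\<close>)
  qed
  show "bi_rational_map \<real> (fix_curve A) (fix_curve B) ?r"
    unfolding bi_rational_map_def
  proof (intro conjI ballI impI)
    show "biform_map \<real> (fst \<circ> ?r)"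
      unfolding biform_map_def using biform_axis_bimap[OF n] by (auto simp: axis_bimap_def)
    have "biform \<real> 0 1 (\<lambda>q :: (complex ^ 4) \<times> (complex ^ 2). snd q $ i)" for i
      by (intro biform_snd_coord coeff_ring_Reals)
    then show "biform_map \<real> (snd \<circ> ?r)"
      unfolding biform_map_def by (auto simp: axis_bimap_def)
    show "fix_curve A \<subseteq> zariski_closure {q \<in> fix_curve A. bi_defined ?r q}"
      using dense by (rule order_trans) (rule zariski_closure_mono, blast)
  qed (rule maps)
qed

text \<open>For vectors of equal norm, \<open>2 lor a (a + b)\<close> is the norm of
  \<open>a + b\<close>, so the two terms of the half-turn combine into a multiple of
  \<open>b\<close>.\<close>

lemma half_turn_bisector:
  assumes "lor a a = lor b b"
  shows "half_turn (a + b) a = lor (a + b) (a + b) *s b"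
proof -
  have 1: "2 * lor a (a + b) = lor (a + b) (a + b)" using assms by (simp add: lor_commute[of b a])
  have 2: "q *s (a + b) - q *s a = q *s b" for q by (simp add: vec_eq_iff algebra_simps)
  show ?thesis unfolding half_turn_def 1 2 ..
qed

text \<open>It suffices that the bisector is a nonzero vector: being real, it is then anisotropic
  and its half-turn is invertible on generic fibres. The sum and the difference cannot both vanish
  because they add up to \<open>2 h v\<close>.\<close>

lemma bisecting_axis:
  assumes v: "real_axis v" and w: "real_axis w"
    and eqv: "norm_equivalent v w"
  shows "\<exists>n. real_axis n \<and> maps_axis n v w \<and> maps_axis n w v"
proof -
  obtain h k where hk: "poly_over \<real> h" "poly_over \<real> k" "h \<noteq> 0" "k \<noteq> 0"
    "k * k * axis_norm w = h * h * axis_norm v" using eqv unfolding norm_equivalent_def by blast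
  define m where "m l = (\<chi> i. h * v $ i + l * w $ i)" for l
  have mt: "axis_vec (m l) t = poly h t *s axis_vec v t + poly l t *s axis_vec w t" for l t
    by (simp add: axis_vec_def m_def vec4_eq_iff algebra_simps)
  have "m k \<noteq> 0 \<or> m (- k) \<noteq> 0"
  proof (rule ccontr)
    assume "\<not> ?thesis"
    then have "h * v $ i + k * w $ i = 0" "h * v $ i + - k * w $ i = 0" for i
      unfolding m_def by (auto simp: vec_eq_iff)
    then have "(h * v $ i + k * w $ i) + (h * v $ i + - k * w $ i) = 0" for i by simp
    then have "smult 2 (h * v $ i) = 0" for i by (simp add: smult_add_left[of 1 1, simplified])
    then have "v $ i = 0" for i using hk(3) by simp
    then show False using v by (auto simp: real_axis_def vec_eq_iff)
  qed
  then obtain l where l: "l = k \<or> l = - k" "m l \<noteq> 0" by blast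
  have lo: "poly_over \<real> l" using l(1) hk(2) poly_over_uminus by auto
  have "poly_over \<real> (m l $ i)" for i
    using v w unfolding m_def by (auto simp: real_axis_def intro!: poly_over_intros hk lo)
  then have n: "real_axis (m l)" using l(2) by (simp add: real_axis_def)
  have "l \<noteq> 0" using l(1) hk(4) by auto
  then have "\<forall>\<^sub>F t in cofinite. poly h t \<noteq> 0 \<and> poly l t \<noteq> 0"
    using poly_roots_finite[OF hk(3)] poly_roots_finite[of l] by (simp add: eventually_conj_iff eventually_cofinite)
  then have both: "\<forall>\<^sub>F t in cofinite. (\<exists>c. c \<noteq> 0 \<and> half_turn (axis_vec (m l) t) (axis_vec v t) = c *s axis_vec w t) \<and>
    (\<exists>c. c \<noteq> 0 \<and> half_turn (axis_vec (m l) t) (axis_vec w t) = c *s axis_vec v t)"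
    using axis_norm_generic[OF n]
  proof eventually_elim
    case (elim t)
    let ?V = "axis_vec v t" and ?W = "axis_vec w t" and ?N = "axis_vec (m l) t"
    let ?a = "poly h t *s ?V" and ?b = "poly l t *s ?W"
    have "l * l * axis_norm w = h * h * axis_norm v" using l(1) hk(5) by auto
    from arg_cong[OF this, of "\<lambda>p. poly p t"]
    have eq: "lor ?a ?a = lor ?b ?b" by (simp add: poly_axis_norm mult.assoc)
    have solve: "half_turn ?N V = (lor ?N ?N * c' / c) *s W"
      if c: "c \<noteq> 0" and e: "half_turn ?N (c *s V) = lor ?N ?N *s (c' *s W)" for c c' V W
    proof -
      have "c *s half_turn ?N V = c *s ((lor ?N ?N * c' / c) *s W)"
        using e c unfolding half_turn_scale vector_smult_assoc by simp
      then show ?thesis using c by (metis vector_mul_lcancel)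
    qed
    have "half_turn ?N ?a = lor ?N ?N *s ?b" using half_turn_bisector[OF eq] by (simp only: mt)
    moreover have "half_turn ?N ?b = lor ?N ?N *s ?a"
      using half_turn_bisector[OF eq[symmetric]] by (simp only: mt add.commute)
    ultimately have "half_turn ?N ?V = (lor ?N ?N * poly l t / poly h t) *s ?W"
      "half_turn ?N ?W = (lor ?N ?N * poly h t / poly l t) *s ?V"
      using elim solve by blast+
    moreover have "lor ?N ?N * poly l t / poly h t \<noteq> 0" "lor ?N ?N * poly h t / poly l t \<noteq> 0"
      using elim by auto
    ultimately show ?case by blast
  qed
  show ?thesis
    using n both unfolding maps_axis_def by (intro exI[of _ "m l"]) (simp add: eventually_conj_iff)
qed

theorem theorem5p21:
  fixes A B :: "complex ^ 4 \<Rightarrow> complex ^ 4"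
  assumes "A \<in> Bir_S_pi" and "order_two A"
    and "B \<in> Bir_S_pi" and "order_two B"
  shows "conjugate_Bir_S_pi A B \<longleftrightarrow>
    (\<exists>\<rho>. bi_birational_map \<real> (fix_curve A) (fix_curve B) \<rho> \<and>
      (\<forall>q\<in>fix_curve A. bi_defined \<rho> q \<longrightarrow> proj_eq (snd (\<rho> q)) (snd q)))"
proof -
  obtain v where v: "axis_of A v" using involution_axis[OF assms(1,2)] by blast
  obtain w where w: "axis_of B w" using involution_axis[OF assms(3,4)] by blast
  have rv: "real_axis v" and rw: "real_axis w" using v w by (simp_all add: axis_of_def)
  show ?thesis
  proof
    assume "conjugate_Bir_S_pi A B"
    from bisecting_axis[OF rv rw conjugate_discriminants[OF assms(1) v assms(3) w this]]
    obtain n where n: "real_axis n" and vw: "maps_axis n v w" and wv: "maps_axis n w v" by blast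
    \<comment> \<open>The half-turn exchanges the two axes, so the same tuple serves as the inverse
      map.\<close>
    have "bi_birational_map \<real> (fix_curve A) (fix_curve B) (axis_bimap n)"
      unfolding bi_birational_map_def
      using axis_bimap_rational[OF assms(1) v assms(3) w n vw] axis_bimap_rational[OF assms(3) w assms(1) v n wv]
      by blast
    moreover have "proj_eq (snd (axis_bimap n q)) (snd q)" for q by (simp add: axis_bimap_def)
    ultimately show "\<exists>\<rho>. bi_birational_map \<real> (fix_curve A) (fix_curve B) \<rho> \<and>
      (\<forall>q\<in>fix_curve A. bi_defined \<rho> q \<longrightarrow> proj_eq (snd (\<rho> q)) (snd q))" by blast
  next
    assume "\<exists>\<rho>. bi_birational_map \<real> (fix_curve A) (fix_curve B) \<rho> \<and>
      (\<forall>q\<in>fix_curve A. bi_defined \<rho> q \<longrightarrow> proj_eq (snd (\<rho> q)) (snd q))"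
    then obtain \<rho> where rho: "bi_rational_map \<real> (fix_curve A) (fix_curve B) \<rho>"
      and pi: "\<forall>q\<in>fix_curve A. bi_defined \<rho> q \<longrightarrow> proj_eq (snd (\<rho> q)) (snd q)"
      unfolding bi_birational_map_def by blast
    from bisecting_axis[OF rv rw birational_discriminants[OF assms(1) v assms(3) w rho pi]]
    obtain n where "real_axis n" "maps_axis n v w" by blast
    then show "conjugate_Bir_S_pi A B" by (rule axis_map_conjugates[OF assms(1,2) v assms(3) w])
  qed
qed

end
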